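(* Let $q=2^n$ with $n\ge 2$ odd and $G=\mathrm{SL}_2(q)$. Then $\mathfrak{c}(\chi_i)=1\in\mathrm{Br}(\mathbb{Q}(\chi_i))$ for all $1\le i\le\frac{q-2}{2}$.
   Context: $\chi_i$ is the irreducible character of $\mathrm{SL}_2(q)$ of degree $q+1$ with values $1$ on $c=\begin{pmatrix}1&0\\1&1\end{pmatrix}$, $\zeta_{q-1}^{i\ell}+\zeta_{q-1}^{-i\ell}$ on $a^\ell$ where $a=\mathrm{diag}(\nu,\nu^{-1})$, $\nu$ a generator of $\mathbb{F}_q^\times$, $\zeta_r=e^{2\pi i/r}$, and $0$ on nontrivial elements of order dividing $q+1$. Its character field $K=\mathbb{Q}(\chi_i)$ is totally real and the Schur index is 1, so there is a $KG$-module $W$ affording $\chi_i$; $\mathfrak{c}(\chi_i)\in\mathrm{Br}(K)$ is the Brauer class of the even Clifford algebra $\mathcal{C}_0(W,F)$ (even part of the tensor algebra modulo $w\otimes w-\frac12F(w,w)$) for any nonzero $G$-invariant symmetric bilinear form $F$ on $W$. *)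

theory Defs
  imports
    "Jordan_Normal_Form.VS_Connect"
    "Jordan_Normal_Form.Determinant"
    "HOL-Algebra.Generated_Fields"
    "HOL-Algebra.Multiplicative_Group"
    "HOL-Algebra.QuotRing"
begin

section \<open>Group modules and characters\<close>

locale group_module = vectorspace K W + G: group G
  for K :: "('k, 'r) ring_scheme" and W :: "('k, 'w, 'm) module_scheme"
    and G :: "('g, 's) monoid_scheme" +
  fixes \<rho> :: "'g \<Rightarrow> 'w \<Rightarrow> 'w"
  assumes fin_dim: "fin_dim"
    and action_linear: "g \<in> carrier G \<Longrightarrow> \<rho> g \<in> LinearCombinations.module_hom K W W"
    and action_one: "w \<in> carrier W \<Longrightarrow> \<rho> \<one>\<^bsub>G\<^esub> w = w"
    and action_mult: "\<lbrakk>g \<in> carrier G; h \<in> carrier G; w \<in> carrier W\<rbrakk>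
      \<Longrightarrow> \<rho> (g \<otimes>\<^bsub>G\<^esub> h) w = \<rho> g (\<rho> h w)"

text \<open>\<open>c b\<close> is the family of coordinates of \<open>T b\<close> in the basis \<open>B\<close>.\<close>

definition has_trace ::
  "('k, 'r) ring_scheme \<Rightarrow> ('k, 'w, 'm) module_scheme \<Rightarrow> ('w \<Rightarrow> 'w) \<Rightarrow> 'k \<Rightarrow> bool" where
  "has_trace K W T t \<longleftrightarrow>
    (\<exists>B c. finite B \<and> vectorspace.basis K W B \<and>
      (\<forall>b\<in>B. c b \<in> B \<rightarrow> carrier K \<and> T b = LinearCombinations.module.lincomb W (c b) B) \<and>
      t = (\<Oplus>\<^bsub>K\<^esub>b\<in>B. c b b))"

definition affords ::
  "('k, 'r) ring_scheme \<Rightarrow> ('k, 'w, 'm) module_scheme \<Rightarrow> ('g, 's) monoid_scheme \<Rightarrow>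
    ('g \<Rightarrow> 'w \<Rightarrow> 'w) \<Rightarrow> ('g \<Rightarrow> 'k) \<Rightarrow> bool" where
  "affords K W G \<rho> \<chi> \<longleftrightarrow>
    group_module K W G \<rho> \<and> (\<forall>g\<in>carrier G. has_trace K W (\<rho> g) (\<chi> g))"

definition irreducible_module ::
  "('k, 'r) ring_scheme \<Rightarrow> ('k, 'w, 'm) module_scheme \<Rightarrow> ('g, 's) monoid_scheme \<Rightarrow>
    ('g \<Rightarrow> 'w \<Rightarrow> 'w) \<Rightarrow> bool" where
  "irreducible_module K W G \<rho> \<longleftrightarrow>
    group_module K W G \<rho> \<and> carrier W \<noteq> {\<zero>\<^bsub>W\<^esub>} \<and>
    (\<forall>S. VectorSpace.subspace K S W \<and> (\<forall>g\<in>carrier G. \<rho> g ` S \<subseteq> S) \<longrightarrow>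
      S = {\<zero>\<^bsub>W\<^esub>} \<or> S = carrier W)"

text \<open>Up to isomorphism the underlying space of a complex representation is \<open>\<complex>\<^sup>m\<close>.\<close>

definition irreducible_character :: "('g, 's) monoid_scheme \<Rightarrow> ('g \<Rightarrow> complex) \<Rightarrow> bool" where
  "irreducible_character G \<chi> \<longleftrightarrow>
    (\<exists>m \<rho>. irreducible_module class_ring (module_vec TYPE(complex) m) G \<rho> \<and>
      affords class_ring (module_vec TYPE(complex) m) G \<rho> \<chi>)"

definition character_field :: "('g, 's) monoid_scheme \<Rightarrow> ('g \<Rightarrow> complex) \<Rightarrow> complex ring" where
  "character_field G \<chi> = class_ring\<lparr>carrier := generate_field class_ring (\<chi> ` carrier G)\<rparr>"

definition invariant_symmetric_form ::
  "('k, 'r) ring_scheme \<Rightarrow> ('k, 'w, 'm) module_scheme \<Rightarrow> ('g, 's) monoid_scheme \<Rightarrow>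
    ('g \<Rightarrow> 'w \<Rightarrow> 'w) \<Rightarrow> ('w \<Rightarrow> 'w \<Rightarrow> 'k) \<Rightarrow> bool" where
  "invariant_symmetric_form K W G \<rho> F \<longleftrightarrow>
    (\<forall>v\<in>carrier W. \<forall>w\<in>carrier W. F v w \<in> carrier K \<and> F v w = F w v) \<and>
    (\<forall>u\<in>carrier W. \<forall>v\<in>carrier W. \<forall>w\<in>carrier W.
      F (u \<oplus>\<^bsub>W\<^esub> v) w = F u w \<oplus>\<^bsub>K\<^esub> F v w) \<and>
    (\<forall>a\<in>carrier K. \<forall>v\<in>carrier W. \<forall>w\<in>carrier W.
      F (a \<odot>\<^bsub>W\<^esub> v) w = a \<otimes>\<^bsub>K\<^esub> F v w) \<and>
    (\<forall>g\<in>carrier G. \<forall>v\<in>carrier W. \<forall>w\<in>carrier W. F (\<rho> g v) (\<rho> g w) = F v w)"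


section \<open>Algebras and Brauer equivalence\<close>

text \<open>An algebra over \<open>K\<close> is given by a \<open>module\<close> record whose ring fields carry the
  (not necessarily commutative) multiplication.\<close>

locale central_simple_algebra = vectorspace K A + A: ring A
  for K :: "('k, 'r) ring_scheme" and A :: "('k, 'a, 'm) module_scheme" +
  assumes fin_dim: "fin_dim"
    and smult_mult_left: "\<lbrakk>a \<in> carrier K; x \<in> carrier A; y \<in> carrier A\<rbrakk>
      \<Longrightarrow> (a \<odot>\<^bsub>A\<^esub> x) \<otimes>\<^bsub>A\<^esub> y = a \<odot>\<^bsub>A\<^esub> (x \<otimes>\<^bsub>A\<^esub> y)"
    and smult_mult_right: "\<lbrakk>a \<in> carrier K; x \<in> carrier A; y \<in> carrier A\<rbrakk>
      \<Longrightarrow> x \<otimes>\<^bsub>A\<^esub> (a \<odot>\<^bsub>A\<^esub> y) = a \<odot>\<^bsub>A\<^esub> (x \<otimes>\<^bsub>A\<^esub> y)"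
    and central: "\<lbrakk>z \<in> carrier A; \<And>x. x \<in> carrier A \<Longrightarrow> z \<otimes>\<^bsub>A\<^esub> x = x \<otimes>\<^bsub>A\<^esub> z\<rbrakk>
      \<Longrightarrow> \<exists>a\<in>carrier K. z = a \<odot>\<^bsub>A\<^esub> \<one>\<^bsub>A\<^esub>"
    and nontrivial: "\<one>\<^bsub>A\<^esub> \<noteq> \<zero>\<^bsub>A\<^esub>"
    and simple: "ideal I A \<Longrightarrow> I = {\<zero>\<^bsub>A\<^esub>} \<or> I = carrier A"

definition base_algebra :: "('k, 'r) ring_scheme \<Rightarrow> ('k, 'k) module" where
  "base_algebra K = \<lparr>carrier = carrier K, mult = mult K, one = one K, zero = zero K,
    add = add K, smult = mult K\<rparr>"

definition matrix_algebra ::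
  "nat \<Rightarrow> ('k, 'a, 'm) module_scheme \<Rightarrow> ('k, nat \<times> nat \<Rightarrow> 'a) module" where
  "matrix_algebra m A = \<lparr>
    carrier = {..<m} \<times> {..<m} \<rightarrow>\<^sub>E carrier A,
    mult = (\<lambda>M N. \<lambda>(i, j)\<in>{..<m} \<times> {..<m}. \<Oplus>\<^bsub>A\<^esub>l\<in>{..<m}. M (i, l) \<otimes>\<^bsub>A\<^esub> N (l, j)),
    one = (\<lambda>(i, j)\<in>{..<m} \<times> {..<m}. if i = j then \<one>\<^bsub>A\<^esub> else \<zero>\<^bsub>A\<^esub>),
    zero = (\<lambda>_\<in>{..<m} \<times> {..<m}. \<zero>\<^bsub>A\<^esub>),
    add = (\<lambda>M N. \<lambda>p\<in>{..<m} \<times> {..<m}. M p \<oplus>\<^bsub>A\<^esub> N p),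
    smult = (\<lambda>a M. \<lambda>p\<in>{..<m} \<times> {..<m}. a \<odot>\<^bsub>A\<^esub> M p)\<rparr>"

definition algebra_isomorphic ::
  "('k, 'r) ring_scheme \<Rightarrow> ('k, 'a, 'm) module_scheme \<Rightarrow> ('k, 'b, 'n) module_scheme \<Rightarrow> bool" where
  "algebra_isomorphic K A B \<longleftrightarrow> ring_iso A B \<inter> LinearCombinations.module_hom K A B \<noteq> {}"

definition brauer_equivalent ::
  "('k, 'r) ring_scheme \<Rightarrow> ('k, 'a, 'm) module_scheme \<Rightarrow> ('k, 'b, 'n) module_scheme \<Rightarrow> bool" where
  "brauer_equivalent K A B \<longleftrightarrow>
    central_simple_algebra K A \<and> central_simple_algebra K B \<and>
    (\<exists>l m. l > 0 \<and> m > 0 \<and> algebra_isomorphic K (matrix_algebra l A) (matrix_algebra m B))"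

text \<open>The class of \<open>A\<close> is the neutral element of \<open>Br(K)\<close>, i.e. the class of \<open>K\<close>.\<close>

definition brauer_trivial :: "('k, 'r) ring_scheme \<Rightarrow> ('k, 'a, 'm) module_scheme \<Rightarrow> bool" where
  "brauer_trivial K A \<longleftrightarrow> brauer_equivalent K A (base_algebra K)"


section \<open>Tensor algebra and even Clifford algebra\<close>

definition quotient_algebra ::
  "('k, 'a, 'm) module_scheme \<Rightarrow> 'a set \<Rightarrow> ('k, 'a set) module" where
  "quotient_algebra A I = \<lparr>carrier = carrier (A Quot I), mult = mult (A Quot I),
    one = one (A Quot I), zero = zero (A Quot I), add = add (A Quot I),
    smult = (\<lambda>a X. \<Union>x\<in>X. I +>\<^bsub>A\<^esub> (a \<odot>\<^bsub>A\<^esub> x))\<rparr>"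

text \<open>The free associative algebra on the set \<open>S\<close>: finitely supported functions on words
  over \<open>S\<close>, with the convolution product for concatenation of words.\<close>

definition free_algebra :: "('k, 'r) ring_scheme \<Rightarrow> 's set \<Rightarrow> ('k, 's list \<Rightarrow> 'k) module" where
  "free_algebra K S = \<lparr>
    carrier = {f. range f \<subseteq> carrier K \<and> finite {u. f u \<noteq> \<zero>\<^bsub>K\<^esub>} \<and> {u. f u \<noteq> \<zero>\<^bsub>K\<^esub>} \<subseteq> lists S},
    mult = (\<lambda>f g u. \<Oplus>\<^bsub>K\<^esub>j\<in>{..length u}. f (take j u) \<otimes>\<^bsub>K\<^esub> g (drop j u)),
    one = (\<lambda>u. if u = [] then \<one>\<^bsub>K\<^esub> else \<zero>\<^bsub>K\<^esub>),
    zero = (\<lambda>u. \<zero>\<^bsub>K\<^esub>),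
    add = (\<lambda>f g u. f u \<oplus>\<^bsub>K\<^esub> g u),
    smult = (\<lambda>a f u. a \<otimes>\<^bsub>K\<^esub> f u)\<rparr>"

definition free_gen :: "('k, 'r) ring_scheme \<Rightarrow> 's \<Rightarrow> 's list \<Rightarrow> 'k" where
  "free_gen K s = (\<lambda>u. if u = [s] then \<one>\<^bsub>K\<^esub> else \<zero>\<^bsub>K\<^esub>)"

text \<open>The tensor algebra of \<open>W\<close> is obtained from the free algebra on the set of all vectors of
  \<open>W\<close> by making the insertion of generators linear. The word \<open>[w\<^sub>1, \<dots>, w\<^sub>k]\<close> becomes
  \<open>w\<^sub>1 \<otimes> \<dots> \<otimes> w\<^sub>k\<close>.\<close>

definition linearity_ideal ::
  "('k, 'r) ring_scheme \<Rightarrow> ('k, 'w, 'm) module_scheme \<Rightarrow> ('w list \<Rightarrow> 'k) set" where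
  "linearity_ideal K W = (let A = free_algebra K (carrier W) in
    Idl\<^bsub>A\<^esub>
      ({free_gen K (v \<oplus>\<^bsub>W\<^esub> w) \<ominus>\<^bsub>A\<^esub> (free_gen K v \<oplus>\<^bsub>A\<^esub> free_gen K w) |v w.
          v \<in> carrier W \<and> w \<in> carrier W} \<union>
       {free_gen K (a \<odot>\<^bsub>W\<^esub> w) \<ominus>\<^bsub>A\<^esub> a \<odot>\<^bsub>A\<^esub> free_gen K w |a w.
          a \<in> carrier K \<and> w \<in> carrier W}))"

definition tensor_algebra ::
  "('k, 'r) ring_scheme \<Rightarrow> ('k, 'w, 'm) module_scheme \<Rightarrow> ('k, ('w list \<Rightarrow> 'k) set) module" where
  "tensor_algebra K W = quotient_algebra (free_algebra K (carrier W)) (linearity_ideal K W)"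

definition tensor_proj ::
  "('k, 'r) ring_scheme \<Rightarrow> ('k, 'w, 'm) module_scheme \<Rightarrow> ('w list \<Rightarrow> 'k) \<Rightarrow> ('w list \<Rightarrow> 'k) set" where
  "tensor_proj K W f = linearity_ideal K W +>\<^bsub>free_algebra K (carrier W)\<^esub> f"

definition tensor_even ::
  "('k, 'r) ring_scheme \<Rightarrow> ('k, 'w, 'm) module_scheme \<Rightarrow> ('w list \<Rightarrow> 'k) set set" where
  "tensor_even K W = tensor_proj K W `
    {f \<in> carrier (free_algebra K (carrier W)). \<forall>u. odd (length u) \<longrightarrow> f u = \<zero>\<^bsub>K\<^esub>}"

definition clifford_ideal ::
  "('k, 'r) ring_scheme \<Rightarrow> ('k, 'w, 'm) module_scheme \<Rightarrow> ('w \<Rightarrow> 'w \<Rightarrow> 'k) \<Rightarrow>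
    ('w list \<Rightarrow> 'k) set set" where
  "clifford_ideal K W F = (let T = tensor_algebra K W; \<iota> = (\<lambda>w. tensor_proj K W (free_gen K w)) in
    Idl\<^bsub>T\<^esub> {\<iota> w \<otimes>\<^bsub>T\<^esub> \<iota> w \<ominus>\<^bsub>T\<^esub>
        (inv\<^bsub>K\<^esub> (\<one>\<^bsub>K\<^esub> \<oplus>\<^bsub>K\<^esub> \<one>\<^bsub>K\<^esub>) \<otimes>\<^bsub>K\<^esub> F w w) \<odot>\<^bsub>T\<^esub> \<one>\<^bsub>T\<^esub> |w. w \<in> carrier W})"

definition clifford_algebra ::
  "('k, 'r) ring_scheme \<Rightarrow> ('k, 'w, 'm) module_scheme \<Rightarrow> ('w \<Rightarrow> 'w \<Rightarrow> 'k) \<Rightarrow>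
    ('k, ('w list \<Rightarrow> 'k) set set) module" where
  "clifford_algebra K W F = quotient_algebra (tensor_algebra K W) (clifford_ideal K W F)"

definition even_clifford_algebra ::
  "('k, 'r) ring_scheme \<Rightarrow> ('k, 'w, 'm) module_scheme \<Rightarrow> ('w \<Rightarrow> 'w \<Rightarrow> 'k) \<Rightarrow>
    ('k, ('w list \<Rightarrow> 'k) set set) module" where
  "even_clifford_algebra K W F = (clifford_algebra K W F)
    \<lparr>carrier := (\<lambda>t. clifford_ideal K W F +>\<^bsub>tensor_algebra K W\<^esub> t) ` tensor_even K W\<rparr>"


section \<open>The characters of degree \<open>q + 1\<close> of \<open>SL\<^sub>2(q)\<close>\<close>

definition SL2 :: "'f::field mat monoid" where
  "SL2 = \<lparr>carrier = {A \<in> carrier_mat 2 2. det A = 1}, mult = (*), one = 1\<^sub>m 2\<rparr>"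

definition generates_units :: "'f::field \<Rightarrow> bool" where
  "generates_units \<nu> \<longleftrightarrow> \<nu> \<noteq> 0 \<and> (\<forall>x. x \<noteq> 0 \<longrightarrow> (\<exists>k::nat. x = \<nu> ^ k))"

definition elt_c :: "'f::field mat" where
  "elt_c = mat_of_rows_list 2 [[1, 0], [1, 1]]"

definition elt_a :: "'f::field \<Rightarrow> 'f mat" where
  "elt_a \<nu> = mat_of_rows_list 2 [[\<nu>, 0], [0, inverse \<nu>]]"

definition zeta :: "nat \<Rightarrow> complex" where
  "zeta r = exp (2 * of_real pi * \<i> / of_nat r)"

text \<open>The powers \<open>a\<^sup>l = 1\<close> are excluded since there the value is the degree. In characteristic two
  every element of the group is conjugate to \<open>1\<close>, to \<open>c\<close>, to a power of \<open>a\<close>, or has order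
  dividing \<open>q + 1\<close>, so these values determine \<open>\<chi>\<close>.\<close>

definition is_chi :: "nat \<Rightarrow> 'f::field \<Rightarrow> nat \<Rightarrow> ('f mat \<Rightarrow> complex) \<Rightarrow> bool" where
  "is_chi q \<nu> i \<chi> \<longleftrightarrow>
    irreducible_character SL2 \<chi> \<and>
    \<chi> \<one>\<^bsub>SL2\<^esub> = of_nat (q + 1) \<and>
    \<chi> elt_c = 1 \<and>
    (\<forall>l::nat. elt_a \<nu> [^]\<^bsub>SL2\<^esub> l \<noteq> \<one>\<^bsub>SL2\<^esub> \<longrightarrow>
      \<chi> (elt_a \<nu> [^]\<^bsub>SL2\<^esub> l) = zeta (q - 1) powi int (i * l) + zeta (q - 1) powi (- int (i * l))) \<and>
    (\<forall>g\<in>carrier SL2. g \<noteq> \<one>\<^bsub>SL2\<^esub> \<and> group.ord SL2 g dvd q + 1 \<longrightarrow> \<chi> g = 0)"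

end

theory Submission
  imports Defs "HOL-Analysis.Determinants" "HOL-Analysis.Complex_Transcendental"
begin

text \<open>
  Restricted to a Borel subgroup, the module \<open>W\<close> is the orthogonal sum of the fixed space of the
  unipotent radical \<open>U\<close> and of \<open>q - 1\<close> lines, one for each nontrivial character of \<open>U\<close>. The torus
  permutes these lines regularly, so they carry orthogonal vectors \<open>v\<^sub>y\<close> of the same norm \<open>c\<close>.
  Projecting the image of \<open>v\<^sub>1\<close> under the Weyl element to the fixed space of \<open>U\<close> gives a vector of norm
  \<open>2c/q\<close>, as one reads off from character values; since \<open>n\<close> is odd, \<open>2/q\<close> is a square. Hence the
  form is \<open>c\<langle>1,\<dots>,1\<rangle> \<bottom> \<langle>c\<^sub>0\<rangle>\<close> with \<open>q\<close> entries \<open>1\<close>. As \<open>8\<close> divides \<open>q\<close>, octonion multiplication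
  yields anticommuting \<open>K\<close>-rational matrices with the required squares, and the resulting representation
  identifies the even Clifford algebra with a full matrix algebra over \<open>K\<close>.
\<close>

unbundle no vec_syntax
notation vec_nth (infixl "$h" 90)

section \<open>Idempotent matrices and additive characters\<close>

text \<open>Everything has to be rational over \<open>K\<close>, a field known only as a subfield of
  the complex numbers. The unipotent radical has exponent two, so its characters take the values 1
  and -1 and the isotypic projections have entries in \<open>K\<close>; hence the lines are defined
  over \<open>K\<close> itself. Square roots enter twice. Since \<open>q = 2 * r^2\<close> with
  \<open>r = 2 ^ ((n - 1) div 2)\<close>, rescaling by \<open>r\<close> gives the projected vector
  the same norm as the others. The second root, of \<open>c0 / 2\<close>, is a common factor of all
  representing matrices and enters products of two of them only through its square; the even
  Clifford algebra sees nothing else. There remain \<open>q\<close> anticommuting matrices over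
  \<open>K\<close> with square \<open>c / c0\<close>. The octonions provide eight of size 16 for
  every value of this ratio, and graded tensor powers provide the rest. Independence of the even
  monomials is not taken from the theory of Clifford algebras: the trace form separates their
  images, and their number is exactly the dimension of the matrix algebra.\<close>

lemma matrix_mult_sum_left:
  fixes B :: "complex^'m^'n"
  shows "(\<Sum>x\<in>A. f x) ** B = (\<Sum>x\<in>A. f x ** B)"
  by (induction A rule: infinite_finite_induct) (auto simp: matrix_matrix_mult_def vec_eq_iff distrib_right sum.distrib)

lemma matrix_mult_sum_right:
  fixes B :: "complex^'m^'n"
  shows "B ** (\<Sum>x\<in>A. f x) = (\<Sum>x\<in>A. B ** f x)"
  by (induction A rule: infinite_finite_induct) (auto simp: matrix_matrix_mult_def vec_eq_iff distrib_left sum.distrib)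

lemma matrix_mult_scaleR:
  fixes A :: "complex^'m^'n" and B :: "complex^'k^'m"
  shows "(r *\<^sub>R A) ** B = r *\<^sub>R (A ** B)" "A ** (r *\<^sub>R B) = r *\<^sub>R (A ** B)"
  by (simp_all add: matrix_matrix_mult_def vec_eq_iff scaleR_sum_right)

lemma matrix_vector_mult_sum_left:
  fixes v :: "complex^'m"
  shows "(\<Sum>x\<in>A. f x) *v v = (\<Sum>x\<in>A. f x *v v)"
  by (induction A rule: infinite_finite_induct) (auto simp: matrix_vector_mult_add_rdistrib)

lemma matrix_vector_mult_scaleR_left:
  fixes A :: "complex^'m^'n"
  shows "(r *\<^sub>R A) *v v = complex_of_real r *s (A *v v)"
  by (simp add: matrix_vector_mult_def vec_eq_iff sum_distrib_left mult.assoc) (simp add: scaleR_conv_of_real)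

lemma trace_sum: "trace (\<Sum>x\<in>A. f x) = (\<Sum>x\<in>A. trace (f x :: complex^'n^'n))"
  by (induction A rule: infinite_finite_induct) (auto simp: trace_def sum.distrib)

lemma trace_scaleR: "trace (r *\<^sub>R A) = complex_of_real r * trace (A :: complex^'n^'n)"
  by (simp add: trace_def sum_distrib_left) (simp add: scaleR_conv_of_real)

lemma matrix_vector_mult_axis: "(A :: complex^'n^'m) *v axis j 1 = column j A"
  by (simp add: matrix_vector_mult_def column_def vec_eq_iff axis_def if_distrib cong: if_cong)

text \<open>A nonzero idempotent splits off a rank one idempotent, which has trace one and lowers the
  rank; hence the trace of an idempotent counts the steps of this descent.\<close>

lemma idempotent_split:
  fixes P :: "complex^'n^'n" and v :: "complex^'n"
  assumes P: "P ** P = P" and v: "P *v v = v" "v \<noteq> 0"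
  shows "\<exists>f P'. (\<forall>x. P *v x = f x *s v + P' *v x) \<and> P' ** P' = P' \<and> trace P = 1 + trace P' \<and>
    P' *v v = 0 \<and> (\<forall>x. P *v (P' *v x) = P' *v x)"
proof -
  obtain k where k: "v $h k \<noteq> 0" using v(2) by (auto simp: vec_eq_iff)
  \<comment> \<open>The coordinate \<open>k\<close> of \<open>P *v x\<close>, normalised so that
    \<open>f v = 1\<close>; it does not change when \<open>x\<close> is replaced by
    \<open>P *v x\<close>. The matrix \<open>P'\<close> is \<open>P\<close> minus the rank one
    idempotent \<open>x \<mapsto> f x *s v\<close>.\<close>
  define f where "f x = (P *v x) $h k / v $h k" for x
  define P' where "P' = (vec_lambda (\<lambda>i. vec_lambda (\<lambda>j. P $h i $h j - v $h i * P $h k $h j / v $h k)))"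
  have P'v: "P' *v x = P *v x - f x *s v" for x
    by (simp add: P'_def f_def vec_eq_iff matrix_vector_mult_def sum_subtractf left_diff_distrib
        sum_distrib_left sum_divide_distrib algebra_simps)
  have fv: "f v = 1" using k v by (simp add: f_def)
  have PP: "P *v (P *v x) = P *v x" for x by (simp add: matrix_vector_mul_assoc P)
  have fP: "f (P *v x) = f x" for x by (simp add: f_def PP)
  have flin: "f (x - c *s y) = f x - c * f y" for x y c
    by (simp add: f_def matrix_vector_mult_diff_distrib vec.scale diff_divide_distrib)
  have PP': "P *v (P' *v x) = P' *v x" for x
    by (simp add: P'v matrix_vector_mult_diff_distrib vec.scale PP v)
  have "P' *v (P' *v x) = P' *v x" for x
    unfolding P'v[of "P' *v x"] PP' by (simp add: P'v flin fP fv)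
  hence 1: "P' ** P' = P'"
    by (simp add: matrix_eq flip: matrix_vector_mul_assoc)
  have "(\<Sum>i\<in>UNIV. v $h i * P $h k $h i) = (P *v v) $h k"
    by (simp add: matrix_vector_mult_def mult.commute)
  hence "(\<Sum>i\<in>UNIV. v $h i * P $h k $h i / v $h k) = 1"
    using k v by (simp flip: sum_divide_distrib)
  hence 2: "trace P = 1 + trace P'"
    by (simp add: trace_def P'_def sum_subtractf)
  have 3: "P' *v v = 0" by (simp add: P'v v fv)
  have "P *v x = f x *s v + P' *v x" for x by (simp add: P'v)
  with 1 2 3 PP' show ?thesis by blast
qed

lemma idempotent_trace:
  fixes P :: "complex^'n^'n"
  assumes "P ** P = P"
  shows "\<exists>k::nat. trace P = of_nat k \<and> (k = 0 \<longrightarrow> P = 0)"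
  using assms
proof (induction "vec.dim (range ((*v) P))" arbitrary: P rule: less_induct)
  case less
  show ?case
  proof (cases "P = 0")
    case True
    thus ?thesis by (auto simp: trace_def)
  next
    case False
    then obtain x where x: "P *v x \<noteq> 0" by (auto simp: matrix_eq)
    define v where "v = P *v x"
    have v: "P *v v = v" "v \<noteq> 0" using x by (auto simp: v_def matrix_vector_mul_assoc less.prems)
    obtain f P' where P': "\<And>x. P *v x = f x *s v + P' *v x" "P' ** P' = P'" "trace P = 1 + trace P'"
      "P' *v v = 0" "\<And>x. P *v (P' *v x) = P' *v x"
      using idempotent_split[OF less.prems v] by auto
    have "range ((*v) P') \<subseteq> range ((*v) P)" using P'(5) by (metis image_subset_iff rangeI)
    moreover have "v \<in> range ((*v) P)" by (simp add: v_def)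
    \<comment> \<open>\<open>P'\<close> fixes its own range but sends the nonzero \<open>v\<close>
      to zero, so the rank drops strictly.\<close>
    moreover have "v \<notin> range ((*v) P')"
      using P'(2,4) v(2) by (metis imageE matrix_vector_mul_assoc)
    ultimately have "range ((*v) P') \<subset> range ((*v) P)" by blast
    moreover have sub: "vec.subspace (range ((*v) Q))" for Q :: "complex^'n^'n"
      by (rule vec.subspace_image) (auto simp: vec.subspace_UNIV)
    ultimately have "vec.dim (range ((*v) P')) < vec.dim (range ((*v) P))"
      by (intro vec.dim_psubset) (simp add: vec.span_eq_iff[THEN iffD2])
    from less.hyps[OF this P'(2)] obtain k where "trace P' = of_nat k" by blast
    hence "trace P = of_nat (Suc k)" using P'(3) by simp
    thus ?thesis by blast
  qed
qed

lemma idempotent_trace_0: "P ** P = P \<Longrightarrow> trace P = 0 \<Longrightarrow> P = (0 :: complex^'n^'n)"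
  using idempotent_trace[of P] by auto

text \<open>Once \<open>v\<close> is split off, an idempotent of trace zero is left, and this
  vanishes.\<close>

lemma idempotent_trace_1:
  fixes P :: "complex^'n^'n"
  assumes "P ** P = P" "trace P = 1" "P *v v = v" "v \<noteq> 0"
  obtains f where "\<And>x. P *v x = f x *s v"
proof -
  obtain f P' where P': "\<And>x. P *v x = f x *s v + P' *v x" "P' ** P' = P'" "trace P = 1 + trace P'"
    using idempotent_split[OF assms(1,3,4)] by auto
  have "P' = 0" using P' assms by (intro idempotent_trace_0) auto
  thus ?thesis using P' that by auto
qed

text \<open>With \<open>P *v x = f x *s v\<close>, sandwiching \<open>A\<close> multiplies by
  \<open>f (A *v v)\<close>, and this number is the trace of \<open>P ** A\<close>. Values of the
  invariant form on the line of \<open>P\<close> thereby become traces, which the character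
  determines.\<close>

lemma idempotent_trace_1_sandwich:
  fixes P A :: "complex^'n^'n"
  assumes P: "P ** P = P" "trace P = 1"
  shows "P *v (A *v (P *v x)) = trace (P ** A) *s (P *v x)"
proof (cases "P *v x = 0")
  case False
  define v where "v = P *v x"
  have v: "P *v v = v" "v \<noteq> 0" using False by (auto simp: v_def matrix_vector_mul_assoc P)
  obtain f where f: "\<And>x. P *v x = f x *s v" using idempotent_trace_1[OF P v] by blast
  obtain k where k: "v $h k \<noteq> 0" using v(2) by (auto simp: vec_eq_iff)
  have P_entry: "P $h i $h j = f (axis j 1) * v $h i" for i j
    using arg_cong[OF f[of "axis j 1"], of "\<lambda>w. w $h i"] by (simp add: matrix_vector_mult_axis column_def)
  \<comment> \<open>Linearity of \<open>f\<close> is read off the coordinate \<open>k\<close>, in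
    which \<open>v\<close> does not vanish.\<close>
  have f_eq: "f x = (\<Sum>j\<in>UNIV. f (axis j 1) * x $h j)" for x
  proof -
    have "f x * v $h k = (P *v x) $h k" by (simp add: f)
    also have "\<dots> = (\<Sum>j\<in>UNIV. f (axis j 1) * x $h j) * v $h k"
      by (simp add: matrix_vector_mult_def P_entry sum_distrib_left sum_distrib_right mult_ac)
    finally show ?thesis using k by simp
  qed
  have "trace (P ** A) = (\<Sum>i\<in>UNIV. \<Sum>j\<in>UNIV. f (axis j 1) * v $h i * A $h j $h i)"
    by (simp add: trace_def matrix_matrix_mult_def P_entry)
  also have "\<dots> = (\<Sum>j\<in>UNIV. f (axis j 1) * (A *v v) $h j)"
    by (subst sum.swap) (simp add: matrix_vector_mult_def sum_distrib_left mult_ac)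
  also have "\<dots> = f (A *v v)" by (rule f_eq[symmetric])
  finally have "P *v (A *v v) = trace (P ** A) *s v" by (simp add: f)
  thus ?thesis by (simp add: v_def)
qed (simp add: matrix_vector_mult_0_right)

section \<open>Square roots and a sign character in characteristic two\<close>

text \<open>Squaring is additive in characteristic two, so it is injective, and on a finite field
  also surjective. The torus acts on the unipotent subgroup through squares, hence transitively on
  nonzero parameters.\<close>

lemma square_surj_char2:
  fixes y :: "'f::{field,finite}"
  assumes "(1::'f) + 1 = 0"
  obtains s where "y = s * s"
proof -
  have 2: "(z::'f) + z = 0" for z using assms by (metis distrib_right mult_1 mult_zero_left)
  have "inj (\<lambda>s::'f. s * s)"
  proof (rule injI)
    fix a b :: 'f assume "a * a = b * b"
    hence "(a + b) * (a + b) = (a * b + a * b) + (b * b + b * b)" by (simp only: distrib_left distrib_right mult.commute add_ac)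
    hence "(a + b) * (a + b) = 0" by (simp only: 2)
    hence "a + b = 0" by simp
    thus "a = b" using 2[of b] by (metis add_right_imp_eq)
  qed
  hence "surj (\<lambda>s::'f. s * s)" by (simp add: finite_UNIV_inj_surj)
  thus thesis using that by (auto simp: surj_def)
qed

text \<open>The sign character of an additive subgroup of index two that avoids 1. Such a subgroup
  is obtained as a maximal one among those avoiding 1.\<close>

lemma nontrivial_additive_character:
  assumes "(1::'f::{field,finite}) + 1 = 0"
  obtains \<psi> :: "'f::{field,finite} \<Rightarrow> real"
  where "\<And>x y. \<psi> (x + y) = \<psi> x * \<psi> y" "\<And>x. \<psi> x * \<psi> x = 1" "\<psi> 1 = -1"
proof -
  have 2: "(z::'f) + z = 0" for z using assms by (metis distrib_right mult_1 mult_zero_left)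
  define S where "S = {H::'f set. 0 \<in> H \<and> (\<forall>x\<in>H. \<forall>y\<in>H. x + y \<in> H) \<and> 1 \<notin> H}"
  have "finite S" by simp
  moreover have "{0} \<in> S" by (simp add: S_def)
  ultimately obtain H where H: "H \<in> S" and max: "\<And>H'. H' \<in> S \<Longrightarrow> H \<subseteq> H' \<Longrightarrow> H = H'"
    using finite_has_maximal2[of S "{0}"] by blast
  have H': "0 \<in> H" "\<And>x y. x \<in> H \<Longrightarrow> y \<in> H \<Longrightarrow> x + y \<in> H" "1 \<notin> H" using H by (auto simp: S_def)
  \<comment> \<open>Otherwise the union of \<open>H\<close> and its translate by \<open>x\<close>
    would be a larger additive subgroup still avoiding 1. Thus \<open>H\<close> has index two, with
    the coset of 1 as its complement.\<close>
  have coset: "1 + x \<in> H" if "x \<notin> H" for x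
  proof (rule ccontr)
    assume n: "1 + x \<notin> H"
    have xx: "x + (x + a) = a" for a using 2[of x] by (metis add.assoc add_0_left)
    have mem: "y \<in> H \<union> (+) x ` H \<longleftrightarrow> y \<in> H \<or> x + y \<in> H" for y
      using xx by (metis UnCI UnE imageE imageI)
    have "a + b \<in> H \<or> x + (a + b) \<in> H" if "a \<in> H \<or> x + a \<in> H" "b \<in> H \<or> x + b \<in> H" for a b
    proof -
      have "(x + a) + b = x + (a + b)" "a + (x + b) = x + (a + b)" "(x + a) + (x + b) = a + b"
        using xx[of "a + b"] by (simp_all only: add_ac)
      thus ?thesis using that H'(2) by metis
    qed
    hence "H \<union> (+) x ` H \<in> S"
      unfolding S_def mem_Collect_eq Ball_def mem using H'(1,3) n by (simp add: add.commute[of x 1])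
    moreover have "x \<in> H \<union> (+) x ` H" using H' by (metis UnI2 add_0_right imageI)
    ultimately show False using max[of "H \<union> (+) x ` H"] that by blast
  qed
  have add_iff: "x + y \<in> H \<longleftrightarrow> (x \<in> H \<longleftrightarrow> y \<in> H)" for x y
  proof -
    have c: "a + (a + b) = b" for a b :: 'f using 2[of a] by (metis add.assoc add_0_left)
    have c': "(1 + x) + (1 + y) = x + y" using c[of 1 "x + y"] by (simp only: add_ac)
    consider "x \<in> H" "y \<in> H" | "x \<in> H" "y \<notin> H" | "x \<notin> H" "y \<in> H" | "x \<notin> H" "y \<notin> H" by blast
    thus ?thesis
    proof cases
      case 2 thus ?thesis using H'(2)[of x "x + y"] c[of x y] by auto
    next
      case 3 thus ?thesis using H'(2)[of y "y + x"] c[of y x] by (auto simp: add.commute)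
    next
      case 4 thus ?thesis using H'(2)[of "1 + x" "1 + y"] coset c' by auto
    qed (use H'(2) in auto)
  qed
  show thesis
    by (rule that[of "\<lambda>x. if x \<in> H then 1 else -1"]) (use H'(3) in \<open>simp_all add: add_iff\<close>)
qed

section \<open>Orthogonal bases for representations of the group\<close>

text \<open>The group is reduced to unipotent, torus and Weyl matrices with their relations;
  \<open>wuw\<close> is the Bruhat decomposition in characteristic two. Torus values of the
  character enter through a single sum, from which the parameter of the character has disappeared,
  so the whole family is treated at once. \<open>F\<close> is bilinear on all complex vectors, while
  \<open>K\<close> records where rational data stay rational.\<close>

locale sl2_form =
  fixes u t :: "'f::{field,finite} \<Rightarrow> complex^'n^'n" and w :: "complex^'n^'n"
    and F :: "complex^'n \<Rightarrow> complex^'n \<Rightarrow> complex" and K :: "complex set" and q :: nat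
  assumes char2: "(1::'f) + 1 = 0"
    and u_add: "u (x + y) = u x ** u y" and u_0: "u 0 = mat 1"
    and t_mult: "y \<noteq> 0 \<Longrightarrow> z \<noteq> 0 \<Longrightarrow> t (y * z) = t y ** t z" and t_1: "t 1 = mat 1"
    and tu: "y \<noteq> 0 \<Longrightarrow> t y ** u x = u (x / (y * y)) ** t y"
    and ww: "w ** w = mat 1"
    and wt: "y \<noteq> 0 \<Longrightarrow> w ** t y = t (inverse y) ** w"
    and wuw: "x \<noteq> 0 \<Longrightarrow> w ** u x ** w = u (inverse x) ** t x ** w ** u (inverse x)"
    and card_n: "CARD('n) = q + 1"
    and q_eq: "q = CARD('f)"
    and trace_u1: "trace (u 1) = 1"
    and sum_trace_t: "(\<Sum>y\<in>UNIV-{0,1}. trace (t y)) = -2"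
    and F_add: "F (x' + y') z' = F x' z' + F y' z'"
    and F_scale: "F (a *s x') z' = a * F x' z'"
    and F_sym: "F x' z' = F z' x'"
    and F_u: "F (u x *v x') (u x *v z') = F x' z'"
    and F_t: "y \<noteq> 0 \<Longrightarrow> F (t y *v x') (t y *v z') = F x' z'"
    and F_w: "F (w *v x') (w *v z') = F x' z'"
    and F_nonzero: "\<exists>x' z'. F x' z' \<noteq> 0"
    and K_1: "1 \<in> K" and K_diff: "a \<in> K \<Longrightarrow> b \<in> K \<Longrightarrow> a - b \<in> K"
    and K_mult: "a \<in> K \<Longrightarrow> b \<in> K \<Longrightarrow> a * b \<in> K" and K_inverse: "a \<in> K \<Longrightarrow> inverse a \<in> K"
    and u_K: "u x $h i $h j \<in> K" and t_K: "y \<noteq> 0 \<Longrightarrow> t y $h i $h j \<in> K" and w_K: "w $h i $h j \<in> K"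
    and F_K: "(\<And>i. x' $h i \<in> K) \<Longrightarrow> (\<And>i. z' $h i \<in> K) \<Longrightarrow> F x' z' \<in> K"
begin

section \<open>Field arithmetic, closure properties of \<open>K\<close>, and adjoints for the
  form\<close>

lemma q_gt_1: "q > 1"
proof -
  have "card {0, 1::'f} \<le> q" unfolding q_eq by (rule card_mono) auto
  thus ?thesis by simp
qed

lemma double_0: "(z::'f) + z = 0"
  using char2 by (metis distrib_right mult_1 mult_zero_left)

lemma add_eq_0: "(x::'f) + y = 0 \<longleftrightarrow> x = y"
  using double_0 by (metis add_right_cancel)

lemma square_eq_iff: "(x::'f) * x = y * y \<longleftrightarrow> x = y"
proof
  assume eq: "x * x = y * y"
  have "(x + y) * (x + y) = (x * x + y * y) + (x * y + x * y)"
    by (simp only: distrib_left distrib_right mult.commute add_ac)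
  also have "\<dots> = 0" by (simp only: double_0 eq add_0_left)
  finally show "x = y" by (simp add: add_eq_0)
qed simp

lemma K_0: "0 \<in> K" using K_diff[OF K_1 K_1] by simp

lemma K_add: "a \<in> K \<Longrightarrow> b \<in> K \<Longrightarrow> a + b \<in> K"
  using K_diff[of 0 b] K_diff[of a "- b"] K_0 by simp

lemma K_sum: "(\<And>x. x \<in> A \<Longrightarrow> f x \<in> K) \<Longrightarrow> sum f A \<in> K"
  by (induction A rule: infinite_finite_induct) (auto simp: K_0 K_add)

lemma K_of_nat: "of_nat k \<in> K"
  by (induction k) (auto simp: K_0 K_1 K_add)

lemma K_mult_vec: "(\<And>i j. A $h i $h j \<in> K) \<Longrightarrow> (\<And>i. x $h i \<in> K) \<Longrightarrow> (A *v x) $h i \<in> K"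
  for A :: "complex^'n^'n"
  by (simp add: matrix_vector_mult_def K_sum K_mult)

lemma F_add_right: "F z (x + y) = F z x + F z y" by (metis F_add F_sym)
lemma F_scale_right: "F z (a *s x) = a * F z x" by (metis F_scale F_sym)
lemma F_0: "F 0 z = 0" using F_scale[of 0 0 z] by simp
lemma F_0_right: "F z 0 = 0" by (metis F_0 F_sym)
lemma F_sum: "F (\<Sum>x\<in>A. f x) z = (\<Sum>x\<in>A. F (f x) z)"
  by (induction A rule: infinite_finite_induct) (auto simp: F_0 F_add)
lemma F_sum_right: "F z (\<Sum>x\<in>A. f x) = (\<Sum>x\<in>A. F z (f x))"
  by (induction A rule: infinite_finite_induct) (auto simp: F_0_right F_add_right)

lemma uu: "u x ** u x = mat 1" by (simp add: double_0 u_0 flip: u_add)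
lemma tt: "y \<noteq> 0 \<Longrightarrow> t y ** t (inverse y) = mat 1" "y \<noteq> 0 \<Longrightarrow> t (inverse y) ** t y = mat 1"
  by (simp_all add: t_1 flip: t_mult)

lemma F_u_adj: "F (u x *v a) b = F a (u x *v b)"
  using F_u[of x a "u x *v b"] by (simp add: matrix_vector_mul_assoc uu)
lemma F_w_adj: "F (w *v a) b = F a (w *v b)"
  using F_w[of a "w *v b"] by (simp add: matrix_vector_mul_assoc ww)
lemma F_t_adj: "y \<noteq> 0 \<Longrightarrow> F (t y *v a) b = F a (t (inverse y) *v b)"
  using F_t[of y a "t (inverse y) *v b"] by (simp add: matrix_vector_mul_assoc tt)

text \<open>The group is generated by the conjugates of the unipotent subgroup.\<close>

lemma w_eq: "w = u 1 ** (w ** u 1 ** w) ** u 1"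
proof -
  have "u 1 ** (w ** u 1 ** w) ** u 1 = (u 1 ** u 1) ** t 1 ** w ** (u 1 ** u 1)"
    by (simp add: wuw matrix_mul_assoc)
  thus ?thesis by (simp add: uu t_1)
qed

lemma t_eq: assumes "x \<noteq> 0" shows "t x = u (inverse x) ** (w ** u x ** w) ** u (inverse x) ** w"
proof -
  have "u (inverse x) ** (w ** u x ** w) ** u (inverse x) ** w =
    (u (inverse x) ** u (inverse x)) ** t x ** w ** (u (inverse x) ** u (inverse x)) ** w"
    using assms by (simp add: wuw matrix_mul_assoc)
  also have "\<dots> = t x ** (w ** w)" by (simp add: uu flip: matrix_mul_assoc)
  finally show ?thesis by (simp add: ww)
qed

section \<open>Traces of products, found by conjugation\<close>

lemma trace_conj: "A ** B = mat 1 \<Longrightarrow> trace (B ** C ** A) = trace (C :: complex^'n^'n)"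
  by (metis matrix_mul_assoc matrix_mul_lid trace_mul_sym)

text \<open>With \<open>x = s * s\<close>, the torus element \<open>t s\<close> conjugates
  \<open>u x\<close> to \<open>u 1\<close>.\<close>

lemma trace_u: assumes "x \<noteq> 0" shows "trace (u x) = 1"
proof -
  obtain s where s: "x = s * s" using square_surj_char2[OF char2] by blast
  with assms have "s \<noteq> 0" by auto
  have "trace (t s ** u x ** t (inverse s)) = trace (u x)"
    using trace_conj[of "t (inverse s)" "t s"] tt \<open>s \<noteq> 0\<close> by simp
  moreover have "t s ** u x ** t (inverse s) = u 1"
    using \<open>s \<noteq> 0\<close> by (simp add: tu s tt flip: matrix_mul_assoc)
  ultimately show ?thesis by (simp add: trace_u1)
qed

text \<open>In characteristic two the Weyl element is an involution conjugate to \<open>u 1\<close>,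
  by \<open>w_eq\<close>.\<close>

lemma trace_w: "trace w = 1"
proof -
  have "trace w = trace (w ** u 1 ** w)" using w_eq trace_conj[OF uu] by metis
  also have "\<dots> = 1" using trace_conj[OF ww] by (simp add: trace_u1)
  finally show ?thesis .
qed

text \<open>The Weyl element inverts the torus, so \<open>t y ** w\<close> is the conjugate of
  \<open>w\<close> by \<open>t s\<close>, where \<open>y = s * s\<close>.\<close>

lemma trace_tw: assumes "y \<noteq> 0" shows "trace (t y ** w) = 1"
proof -
  obtain s where s: "y = s * s" using square_surj_char2[OF char2] by blast
  with assms have s0: "s \<noteq> 0" by auto
  have "t y ** w = t s ** (t s ** w)" using s0 by (simp add: s t_mult matrix_mul_assoc)
  also have "t s ** w = w ** t (inverse s)" using wt[of "inverse s"] s0 by simp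
  finally have "t y ** w = t s ** w ** t (inverse s)" by (simp add: matrix_mul_assoc)
  thus ?thesis using trace_conj[of "t (inverse s)" "t s" w] tt s0 by (simp add: trace_w)
qed

text \<open>For \<open>y \<noteq> 1\<close> also \<open>1 + y * y\<close> is nonzero, and
  conjugation by \<open>u z\<close> with \<open>z = x / (1 + y * y)\<close> carries
  \<open>t y\<close> to \<open>t y ** u x\<close>.\<close>

lemma trace_tu: assumes "y \<noteq> 0" "y \<noteq> 1" shows "trace (t y ** u x) = trace (t y)"
proof -
  have "1 + y * y \<noteq> 0" using square_eq_iff[of 1 y] assms by (simp add: add_eq_0)
  define z where "z = x / (1 + y * y)"
  have "z * (1 + y * y) = x" using \<open>1 + y * y \<noteq> 0\<close> by (simp add: z_def)
  hence x: "x = z * (y * y) + z" by (simp add: algebra_simps)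
  have "u z ** t y = t y ** u (z * (y * y))" using tu[of y "z * (y * y)"] assms by simp
  hence "u z ** t y ** u z = t y ** u x" by (simp add: x u_add matrix_mul_assoc)
  thus ?thesis using trace_conj[OF uu, of z "t y"] by simp
qed

end

locale sl2_form_char = sl2_form u t w F K q
  for u t :: "'f::{field,finite} \<Rightarrow> complex^'n^'n" and w F K q +
  fixes \<psi> :: "'f \<Rightarrow> real"
  assumes psi_add: "\<psi> (x + y) = \<psi> x * \<psi> y" and psi_square: "\<psi> x * \<psi> x = 1" and psi_1: "\<psi> 1 = -1"
begin

section \<open>Isotypic projections for the unipotent subgroup\<close>

lemma psi_0: "\<psi> 0 = 1"
  using psi_add[of 0 0] psi_square[of 0] by simp

text \<open>For \<open>y \<noteq> 0\<close>, translating \<open>x\<close> by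
  \<open>inverse y\<close> multiplies every term by \<open>\<psi> 1 = -1\<close>, so the sum equals
  its own negative.\<close>

lemma sum_psi: "(\<Sum>x\<in>UNIV. \<psi> (x * y)) = (if y = 0 then real q else 0)"
proof (cases "y = 0")
  case False
  have "(\<Sum>x\<in>UNIV. \<psi> (x * y)) = (\<Sum>x\<in>UNIV. \<psi> ((x + inverse y) * y))"
    by (rule sum.reindex_bij_witness[of _ "\<lambda>x. x + inverse y" "\<lambda>x. x - inverse y"]) auto
  also have "\<dots> = - (\<Sum>x\<in>UNIV. \<psi> (x * y))"
    using False by (simp add: distrib_right psi_add psi_1 sum_negf)
  finally show ?thesis using False by simp
qed (simp add: psi_0 q_eq)

text \<open>The projection to the eigenspace of the unipotent subgroup for the character
  \<open>x \<mapsto> \<psi> (x * y)\<close>. The usual complex conjugate is absent because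
  \<open>\<psi>\<close> is real; as \<open>y\<close> varies, the projections add up to the
  identity.\<close>

definition P where "P y = (1 / real q) *\<^sub>R (\<Sum>x\<in>UNIV. \<psi> (x * y) *\<^sub>R u x)"

lemma uP: "u z ** P y = \<psi> (z * y) *\<^sub>R P y"
proof -
  have "(\<Sum>x\<in>UNIV. \<psi> (x * y) *\<^sub>R u (z + x)) = (\<Sum>x\<in>UNIV. \<psi> ((z + x) * y) *\<^sub>R u x)"
    by (rule sum.reindex_bij_witness[of _ "\<lambda>x. z + x" "\<lambda>x. z + x"])
      (simp_all add: double_0 flip: add.assoc)
  also have "\<dots> = \<psi> (z * y) *\<^sub>R (\<Sum>x\<in>UNIV. \<psi> (x * y) *\<^sub>R u x)"
    by (simp add: distrib_right psi_add scaleR_sum_right)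
  finally show ?thesis
    by (simp add: P_def matrix_mult_scaleR matrix_mult_sum_right flip: u_add)
qed

lemma Pu: "P y ** u z = \<psi> (z * y) *\<^sub>R P y"
proof -
  have "P y ** u z = u z ** P y"
    by (simp add: P_def matrix_mult_scaleR matrix_mult_sum_right matrix_mult_sum_left flip: u_add)
      (simp add: add.commute)
  thus ?thesis by (simp add: uP)
qed

lemma PP: "P y ** P z = (if y = z then P y else 0)"
proof -
  have "P y ** P z = (1 / real q) *\<^sub>R (\<Sum>x\<in>UNIV. (\<psi> (x * y) * \<psi> (x * z)) *\<^sub>R P z)"
    by (subst (1) P_def) (simp add: matrix_mult_scaleR matrix_mult_sum_left uP)
  also have "\<dots> = (1 / real q) *\<^sub>R (\<Sum>x\<in>UNIV. \<psi> (x * (y + z))) *\<^sub>R P z"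
    by (simp add: distrib_left psi_add flip: scaleR_sum_left)
  finally show ?thesis using q_gt_1 by (simp add: sum_psi add_eq_0)
qed

lemma sum_P: "(\<Sum>y\<in>UNIV. P y) = mat 1"
proof -
  have comm: "(\<Sum>x\<in>UNIV. \<psi> (y * x)) = (if y = 0 then real q else 0)" for y
    using sum_psi[of y] by (simp add: mult.commute)
  have "(\<Sum>y\<in>UNIV. P y) = (1 / real q) *\<^sub>R (\<Sum>x\<in>UNIV. (\<Sum>y\<in>UNIV. \<psi> (x * y)) *\<^sub>R u x)"
    unfolding P_def by (simp only: flip: scaleR_sum_right scaleR_sum_left) (simp only: sum.swap[of _ UNIV UNIV] flip: scaleR_sum_left)
  also have "\<dots> = (1 / real q) *\<^sub>R (\<Sum>x\<in>UNIV. if x = (0::'f) then real q *\<^sub>R u 0 else 0)"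
    unfolding comm by (rule arg_cong[of _ _ "(*\<^sub>R) _"], rule sum.cong) auto
  finally show ?thesis using q_gt_1 by (simp add: u_0)
qed

text \<open>On the unipotent subgroup the character is the trivial plus the regular one: it is 1 off
  the identity and \<open>q + 1\<close> at it. So the trivial eigenspace has dimension two and every
  other one is a line.\<close>

lemma trace_P: "trace (P y) = (if y = 0 then 2 else 1)"
proof -
  have q: "complex_of_nat q \<noteq> 0" using q_gt_1 by simp
  have "(\<Sum>x\<in>UNIV. complex_of_real (\<psi> (x * y)) * trace (u x)) =
      (\<Sum>x\<in>UNIV. complex_of_real (\<psi> (x * y)) + (if x = 0 then of_nat q else 0))"
  proof (intro sum.cong refl)
    fix x
    show "complex_of_real (\<psi> (x * y)) * trace (u x) = complex_of_real (\<psi> (x * y)) + (if x = 0 then of_nat q else 0)"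
      by (cases "x = 0") (auto simp: trace_u u_0 trace_I card_n psi_0)
  qed
  also have "\<dots> = of_real (\<Sum>x\<in>UNIV. \<psi> (x * y)) + of_nat q"
    by (simp add: sum.distrib)
  finally show ?thesis using q
    by (simp add: P_def trace_scaleR trace_sum sum_psi field_simps)
qed

lemma tP: "y \<noteq> 0 \<Longrightarrow> t y ** P z = P (z * (y * y)) ** t y"
proof -
  assume y: "y \<noteq> 0"
  have "(\<Sum>x\<in>UNIV. \<psi> (x * z) *\<^sub>R u (x / (y * y))) = (\<Sum>x\<in>UNIV. \<psi> (x * (z * (y * y))) *\<^sub>R u x)"
    using y by (intro sum.reindex_bij_witness[of _ "\<lambda>x. x * (y * y)" "\<lambda>x. x / (y * y)"]) (auto simp: mult_ac)
  hence "(\<Sum>x\<in>UNIV. \<psi> (x * z) *\<^sub>R u (x / (y * y))) ** t y = (\<Sum>x\<in>UNIV. \<psi> (x * (z * (y * y))) *\<^sub>R u x) ** t y"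
    by simp
  thus ?thesis
    using y by (simp add: P_def matrix_mult_scaleR matrix_mult_sum_left matrix_mult_sum_right tu)
qed

text \<open>The Borel subgroup has no nonzero fixed vector. Up to the factor \<open>q - 1\<close>
  the sum \<open>Z\<close> is the idempotent onto its fixed vectors, and its trace is
  \<open>2 + (-2)\<close>: the identity of the torus contributes the trace of \<open>P 0\<close>,
  the other elements contribute the sum of their own traces.\<close>

lemma sum_tP_0: "(\<Sum>y\<in>UNIV-{0}. t y) ** P 0 = 0"
proof -
  let ?U = "UNIV - {0::'f}"
  have c: "card ?U = q - 1" by (simp add: q_eq)
  define Z where "Z = (\<Sum>y\<in>?U. t y ** P 0)"
  have tZ: "t s ** Z = Z" if "s \<noteq> 0" for s
    unfolding Z_def matrix_mult_sum_right
    by (rule sum.reindex_bij_witness[of _ "\<lambda>x. x / s" "\<lambda>x. s * x"]) (use that in \<open>auto simp: matrix_mul_assoc t_mult\<close>)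
  have P0Z: "P 0 ** Z = Z"
    unfolding Z_def matrix_mult_sum_right
    by (rule sum.cong) (use tP[of _ 0] in \<open>auto simp: matrix_mul_assoc\<close>, metis PP matrix_mul_assoc)
  have "Z ** Z = (\<Sum>y\<in>?U. t y ** (P 0 ** Z))"
    by (subst (1) Z_def) (simp add: matrix_mult_sum_left matrix_mul_assoc)
  also have "\<dots> = (\<Sum>y\<in>?U. Z)" by (rule sum.cong) (auto simp: P0Z tZ)
  also have "\<dots> = real (q - 1) *\<^sub>R Z" by (simp add: c scaleR_conv_of_real sum_constant_scaleR)
  finally have ZZ: "Z ** Z = real (q - 1) *\<^sub>R Z" .
  have tr: "trace (t y ** P 0) = trace (t y)" if "y \<noteq> 0" "y \<noteq> 1" for y
    using q_gt_1 trace_tu[OF that]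
    by (simp add: P_def matrix_mult_scaleR matrix_mult_sum_right trace_scaleR trace_sum psi_0 flip: q_eq)
  have "trace Z = trace (t 1 ** P 0) + (\<Sum>y\<in>UNIV-{0,1}. trace (t y ** P 0))"
    unfolding Z_def trace_sum by (subst sum.remove[of _ 1]) (auto intro!: arg_cong[of _ _ "sum _"])
  also have "\<dots> = 2 + (\<Sum>y\<in>UNIV-{0,1}. trace (t y))"
    by (simp add: t_1 trace_P) (rule sum.cong, auto simp: tr)
  finally have "trace Z = 0" by (simp add: sum_trace_t)
  hence "(1 / real (q - 1)) *\<^sub>R Z = 0"
    using q_gt_1 by (intro idempotent_trace_0) (simp_all add: matrix_mult_scaleR ZZ trace_scaleR)
  hence "Z = 0" using q_gt_1 by simp
  thus ?thesis by (simp add: Z_def matrix_mult_sum_left)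
qed

text \<open>The matrices \<open>u x\<close> are involutions preserving the form, hence self-adjoint,
  and so are their linear combinations.\<close>

lemma F_P_adj: "F (P y *v a) b = F a (P y *v b)"
  by (simp add: P_def matrix_vector_mult_scaleR_left matrix_vector_mult_sum_left F_scale F_scale_right
      F_sum F_sum_right F_u_adj)

lemma F_P_orthogonal: "y \<noteq> z \<Longrightarrow> F (P y *v a) (P z *v b) = 0"
  by (simp add: F_P_adj matrix_vector_mul_assoc PP F_0_right)

lemma sum_P_vec: "(\<Sum>y\<in>UNIV. P y *v x) = x"
  by (simp add: sum_P flip: matrix_vector_mult_sum_left)

text \<open>All nontrivial eigenspaces are torus translates of the one for 1, because
  \<open>y\<close> is a square.\<close>

lemma P_conj: assumes "y \<noteq> 0" obtains s where "s \<noteq> 0" "\<And>x. P y *v x = t s *v (P 1 *v (t (inverse s) *v x))"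
proof -
  obtain s where s: "y = s * s" using square_surj_char2[OF char2] by blast
  with assms have s0: "s \<noteq> 0" by auto
  have "P y = P y ** (t s ** t (inverse s))" using s0 by (simp add: tt)
  also have "\<dots> = t s ** P 1 ** t (inverse s)" using tP[of s 1] s0 by (simp add: s matrix_mul_assoc)
  finally have "P y *v x = t s *v (P 1 *v (t (inverse s) *v x))" for x
    by (simp add: matrix_vector_mul_assoc matrix_mul_assoc)
  thus thesis using that[of s] s0 by blast
qed

lemma fixed_vector_0:
  assumes "P 0 *v x = x" "\<And>y. y \<noteq> 0 \<Longrightarrow> t y *v x = x" shows "x = 0"
proof -
  have "0 = (\<Sum>y\<in>UNIV-{0}. t y) *v (P 0 *v x)" by (simp add: matrix_vector_mul_assoc sum_tP_0)
  also have "\<dots> = (\<Sum>y\<in>UNIV-{0::'f}. x)" by (simp add: matrix_vector_mult_sum_left assms)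
  also have "\<dots> = of_nat (q - 1) *s x" by (simp add: vec_eq_iff q_eq sum_component del: sum_constant) simp
  finally show ?thesis using q_gt_1 by (simp add: vec_eq_iff)
qed

text \<open>The entries of \<open>P 1\<close> lie in \<open>K\<close> since \<open>\<psi>\<close>
  takes only the values 1 and -1; a nonzero column is a rational vector of the eigenline.\<close>

lemma exists_v1: "\<exists>v. P 1 *v v = v \<and> v \<noteq> 0 \<and> (\<forall>i. v $h i \<in> K)"
proof -
  have "P 1 \<noteq> 0" using trace_P[of 1] by (auto simp: trace_def)
  then obtain i j where ij: "P 1 $h i $h j \<noteq> 0" by (auto simp: vec_eq_iff)
  have PK: "P 1 $h i $h j \<in> K" for i j
  proof -
    have "\<psi> x = 1 \<or> \<psi> x = -1" for x using psi_square[of x] by (simp add: square_eq_1_iff)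
    hence "of_real (\<psi> x) \<in> K" for x using K_1 K_diff[OF K_0 K_1] by (metis diff_0 of_real_1 of_real_minus)
    moreover have "inverse (of_nat q) \<in> K" by (intro K_inverse K_of_nat)
    ultimately have "inverse (of_nat q) * (\<Sum>x\<in>UNIV. of_real (\<psi> x) * u x $h i $h j) \<in> K"
      by (intro K_mult K_sum u_K) auto
    also have "inverse (of_nat q) * (\<Sum>x\<in>UNIV. of_real (\<psi> x) * u x $h i $h j) = P 1 $h i $h j"
      by (simp add: P_def scaleR_conv_of_real[where 'a=complex] divide_inverse)
    finally show ?thesis .
  qed
  show ?thesis
  proof (intro exI[of _ "P 1 *v axis j 1"] conjI allI)
    show "P 1 *v (P 1 *v axis j 1) = P 1 *v axis j 1" by (simp add: matrix_vector_mul_assoc PP)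
    show "P 1 *v axis j 1 \<noteq> 0" using ij by (auto simp: matrix_vector_mult_axis column_def vec_eq_iff)
    show "(P 1 *v axis j 1) $h i \<in> K" for i using PK by (simp add: matrix_vector_mult_axis column_def)
  qed
qed

end

section \<open>Nondegeneracy, the norm computation and the orthogonal basis\<close>

context sl2_form_char begin

text \<open>If \<open>v\<close> were isotropic, then by torus translation and orthogonality every
  nontrivial eigenline would lie in the radical. The form would then depend only on
  \<open>P 0 *v x\<close>, so it would be invariant under acting on one argument alone, by the
  unipotents and hence by the whole group. Averaging over the torus would make it zero, by
  \<open>sum_tP_0\<close>.\<close>

lemma F_v1_nonzero:
  assumes v: "P 1 *v v = v" "v \<noteq> 0"
  shows "F v v \<noteq> 0"
proof
  assume 0: "F v v = 0"
  obtain f where f: "\<And>x. P 1 *v x = f x *s v"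
    using idempotent_trace_1[of "P 1" v] v by (auto simp: PP trace_P)
  have F_P: "F (P y *v x) z = 0" if y0: "y \<noteq> 0" for y x z
  proof -
    obtain s where s: "s \<noteq> 0" "\<And>x. P y *v x = t s *v (P 1 *v (t (inverse s) *v x))"
      using P_conj[OF y0] by blast
    have "F (P y *v x) z = F (P y *v x) (P y *v z)"
      by (simp add: matrix_vector_mul_assoc PP flip: F_P_adj)
    also have "\<dots> = 0" by (simp add: s F_t f F_scale F_scale_right 0)
    finally show ?thesis .
  qed
  have F_P0: "F x z = F (P 0 *v x) z" for x z
  proof -
    have "F x z = (\<Sum>y\<in>UNIV. F (P y *v x) z)" by (simp add: sum_P_vec flip: F_sum)
    also have "\<dots> = (\<Sum>y\<in>UNIV. if y = (0::'f) then F (P 0 *v x) z else 0)" by (rule sum.cong) (auto simp: F_P)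
    finally show ?thesis by simp
  qed
  have inv_u: "F (u a *v x) z = F x z" for a x z
    using F_P0[of "u a *v x" z] F_P0[of x z] by (simp add: matrix_vector_mul_assoc Pu psi_0)
  have inv_wuw: "F (w *v (u a *v (w *v x))) z = F x z" for a x z
  proof -
    have "F (w *v (u a *v (w *v x))) z = F (u a *v (w *v x)) (w *v z)"
      by (simp add: F_w_adj)
    thus ?thesis by (simp add: inv_u F_w)
  qed
  have inv_w: "F (w *v x) z = F x z" for x z
    by (subst w_eq) (simp add: inv_u inv_wuw flip: matrix_vector_mul_assoc)
  have inv_t: "F (t y *v x) z = F x z" if "y \<noteq> 0" for x y z
    using that by (subst t_eq) (simp_all add: inv_u inv_wuw inv_w flip: matrix_vector_mul_assoc)
  have "F x z = 0" for x z
  proof -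
    have "of_nat (q - 1) * F x z = (\<Sum>y\<in>UNIV-{0::'f}. F (P 0 *v x) z)" by (simp flip: F_P0) (simp add: q_eq)
    also have "\<dots> = (\<Sum>y\<in>UNIV-{0}. F (t y *v (P 0 *v x)) z)" by (rule sum.cong) (auto simp: inv_t)
    also have "\<dots> = F (((\<Sum>y\<in>UNIV-{0}. t y) ** P 0) *v x) z"
      by (simp add: F_sum matrix_mult_sum_left matrix_vector_mult_sum_left matrix_vector_mul_assoc)
    also have "\<dots> = 0" by (simp add: sum_tP_0 F_0)
    finally show ?thesis using q_gt_1 by simp
  qed
  thus False using F_nonzero by blast
qed

text \<open>The radical \<open>R\<close> is stable under the group. Since \<open>v\<close> is
  anisotropic, the nontrivial projections kill \<open>R\<close>, so the unipotents fix
  \<open>R\<close> pointwise, and with them the whole group; a vector fixed by the Borel subgroup is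
  zero.\<close>

lemma F_nondegenerate:
  assumes "\<And>z. F x z = 0" shows "x = 0"
proof -
  define R where "R = {x. \<forall>z. F x z = 0}"
  obtain v where v: "P 1 *v v = v" "v \<noteq> 0" using exists_v1 by blast
  obtain f where f: "\<And>x. P 1 *v x = f x *s v"
    using idempotent_trace_1[of "P 1" v] v by (auto simp: PP trace_P)
  have R_u: "u a *v y \<in> R" and R_w: "w *v y \<in> R" and R_P: "P a *v y \<in> R" if "y \<in> R" for a y
    using that by (simp_all add: R_def F_u_adj F_w_adj F_P_adj)
  have R_t: "t a *v y \<in> R" if "y \<in> R" "a \<noteq> 0" for a y
    using that by (simp add: R_def F_t_adj)
  have P_R: "P a *v y = 0" if yR: "y \<in> R" and a0: "a \<noteq> 0" for a y
  proof -
    obtain s where s: "s \<noteq> 0" "\<And>x. P a *v x = t s *v (P 1 *v (t (inverse s) *v x))"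
      using P_conj[OF a0] by blast
    have "P 1 *v (t (inverse s) *v y) \<in> R" using yR s by (intro R_P R_t) auto
    hence "F (f (t (inverse s) *v y) *s v) v = 0" by (simp add: R_def f)
    hence "f (t (inverse s) *v y) = 0" using F_v1_nonzero[OF v] by (simp add: F_scale)
    thus ?thesis by (simp add: s f)
  qed
  have P0_R: "P 0 *v y = y" if "y \<in> R" for y
  proof -
    have "y = (\<Sum>a\<in>UNIV. P a *v y)" by (simp add: sum_P_vec)
    also have "\<dots> = (\<Sum>a\<in>UNIV. if a = (0::'f) then P 0 *v y else 0)" by (rule sum.cong) (auto simp: P_R that)
    finally show ?thesis by simp
  qed
  have inv_u: "u a *v y = y" if "y \<in> R" for a y
    using arg_cong[OF uP[of a 0], of "\<lambda>A. A *v y"] P0_R[OF that]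
    by (simp add: psi_0 flip: matrix_vector_mul_assoc)
  have inv_wuw: "w *v (u a *v (w *v y)) = y" if "y \<in> R" for a y
    using that by (simp add: inv_u R_w) (simp add: matrix_vector_mul_assoc ww)
  have inv_w: "w *v y = y" if "y \<in> R" for y
    using that by (subst w_eq) (simp add: inv_u inv_wuw flip: matrix_vector_mul_assoc)
  have inv_t: "t a *v y = y" if "y \<in> R" "a \<noteq> 0" for a y
    using that by (subst t_eq) (simp_all add: inv_u inv_wuw inv_w flip: matrix_vector_mul_assoc)
  have "x \<in> R" using assms by (simp add: R_def)
  thus ?thesis using P0_R inv_t by (intro fixed_vector_0) auto
qed

text \<open>Let \<open>\<tau> y\<close> be the same sum with \<open>P y\<close> in place of
  \<open>P 1\<close>. Torus conjugation makes \<open>\<tau>\<close> constant on nonzero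
  \<open>y\<close>, and \<open>\<tau> 0 = 0\<close> because the Borel subgroup fixes no vector. Over
  all \<open>y\<close> the projections add up to the identity, so the total is the sum of the traces
  of \<open>t x ** w\<close>, which is \<open>q - 1\<close>.\<close>

lemma sum_trace_P1_tw: "(\<Sum>x\<in>UNIV-{0}. trace (P 1 ** t x ** w)) = 1"
proof -
  define \<tau> where "\<tau> y = (\<Sum>x\<in>UNIV-{0}. trace (P y ** t x ** w))" for y
  have \<tau>_eq: "\<tau> y = \<tau> 1" if y: "y \<noteq> 0" for y
  proof -
    obtain s where s: "y = s * s" using square_surj_char2[OF char2] by blast
    with y have s0: "s \<noteq> 0" by auto
    have eq: "trace (P 1 ** t x ** w) = trace (P y ** t (y * x) ** w)" if "x \<noteq> 0" for x
    proof -
      have "trace (P 1 ** t x ** w) = trace (t s ** (P 1 ** t x ** w) ** t (inverse s))"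
        using s0 by (intro trace_conj[symmetric]) (simp add: tt)
      also have "t s ** (P 1 ** t x ** w) ** t (inverse s) = (t s ** P 1) ** t x ** (w ** t (inverse s))"
        by (simp add: matrix_mul_assoc)
      also have "\<dots> = P y ** (t s ** t x ** t s) ** w"
        using s0 wt[of "inverse s"] by (simp add: tP s matrix_mul_assoc)
      also have "t s ** t x ** t s = t (y * x)" using s0 that by (simp add: s mult_ac flip: t_mult)
      finally show ?thesis .
    qed
    show ?thesis unfolding \<tau>_def using y
      by (intro sum.reindex_bij_witness[of _ "\<lambda>x. y * x" "\<lambda>x. x / y"]) (auto simp: eq)
  qed
  have "\<tau> 0 = trace (((\<Sum>x\<in>UNIV-{0}. t x) ** P 0) ** w)"
    unfolding \<tau>_def matrix_mult_sum_left trace_sum by (rule sum.cong) (use tP[of _ 0] in auto)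
  hence \<tau>_0: "\<tau> 0 = 0" by (simp add: sum_tP_0 trace_def)
  have "(\<Sum>y\<in>UNIV. \<tau> y) = (\<Sum>x\<in>UNIV-{0}. trace ((\<Sum>y\<in>UNIV. P y) ** t x ** w))"
    unfolding \<tau>_def by (subst sum.swap) (simp add: matrix_mult_sum_left trace_sum)
  also have "\<dots> = of_nat (q - 1)" by (simp add: sum_P trace_tw) (simp add: q_eq)
  finally have "of_nat (q - 1) = (\<Sum>y\<in>UNIV. \<tau> y)" ..
  also have "\<dots> = \<tau> 0 + (\<Sum>y\<in>UNIV-{0}. \<tau> y)" by (rule sum.remove) auto
  also have "(\<Sum>y\<in>UNIV-{0}. \<tau> y) = (\<Sum>y\<in>UNIV-{0::'f}. \<tau> 1)" by (rule sum.cong) (use \<tau>_eq in blast)+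
  also have "\<dots> = of_nat (q - 1) * \<tau> 1" by (simp add: q_eq)
  finally show ?thesis using q_gt_1 \<tau>_0 by (simp add: \<tau>_def)
qed

text \<open>Written out, \<open>P 0\<close> is the average of the \<open>u x\<close>. The term
  \<open>x = 0\<close> gives \<open>F v v\<close>. Any other term becomes, by the Bruhat relation
  and the sandwich formula, a trace times \<open>F v v\<close>, and these traces sum to one. This is
  the origin of the numerator 2.\<close>

lemma F_P0_w_v1:
  assumes v: "P 1 *v v = v"
  shows "F (P 0 *v (w *v v)) (P 0 *v (w *v v)) = 2 / of_nat q * F v v"
proof -
  have t_term: "F (w *v (u x *v (w *v v))) v = trace (P 1 ** t x ** w) * F v v" if x: "x \<noteq> 0" for x
  proof -
    let ?z = "inverse x"
    have uv: "u ?z *v v = of_real (\<psi> ?z) *s v"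
      using arg_cong[OF uP[of ?z 1], of "\<lambda>A. A *v v"] v
      by (simp add: matrix_vector_mult_scaleR_left flip: matrix_vector_mul_assoc)
    have "F (w *v (u x *v (w *v v))) v = F (u ?z *v (t x *v (w *v (u ?z *v v)))) v"
      using wuw[OF x] by (simp add: matrix_vector_mul_assoc matrix_mul_assoc)
    \<comment> \<open>The outer unipotent factor moves to the other argument, where it acts on
      \<open>v\<close> by the same sign as the inner one; the two signs cancel.\<close>
    also have "\<dots> = of_real (\<psi> ?z * \<psi> ?z) * F (t x *v (w *v v)) v"
      unfolding F_u_adj uv by (simp add: F_scale F_scale_right vec.scale)
    also have "F (t x *v (w *v v)) v = F (P 1 *v ((t x ** w) *v (P 1 *v v))) v"
      by (simp add: F_P_adj v) (simp add: matrix_vector_mul_assoc)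
    also have "\<dots> = trace (P 1 ** t x ** w) * F v v"
      by (subst idempotent_trace_1_sandwich) (simp_all add: PP trace_P F_scale v matrix_mul_assoc)
    finally show ?thesis by (simp add: psi_square)
  qed
  have "F (P 0 *v (w *v v)) (P 0 *v (w *v v)) = F (P 0 *v (w *v v)) (w *v v)"
    by (simp add: F_P_adj matrix_vector_mul_assoc[of "P 0" "P 0"] PP)
  also have "\<dots> = (1 / of_nat q) * (\<Sum>x\<in>UNIV. F (u x *v (w *v v)) (w *v v))"
    by (simp add: P_def matrix_vector_mult_scaleR_left matrix_vector_mult_sum_left F_scale F_sum psi_0)
  also have "(\<Sum>x\<in>UNIV. F (u x *v (w *v v)) (w *v v)) = (\<Sum>x\<in>UNIV. F (w *v (u x *v (w *v v))) v)"
    by (simp add: F_w_adj)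
  also have "\<dots> = F v v + (\<Sum>x\<in>UNIV-{0}. F (w *v (u x *v (w *v v))) v)"
    by (subst sum.remove[of _ 0]) (simp_all add: u_0 matrix_vector_mul_assoc ww)
  also have "(\<Sum>x\<in>UNIV-{0}. F (w *v (u x *v (w *v v))) v) = (\<Sum>x\<in>UNIV-{0}. trace (P 1 ** t x ** w)) * F v v"
    unfolding sum_distrib_right by (rule sum.cong) (auto simp: t_term)
  finally show ?thesis by (simp add: sum_trace_P1_tw)
qed

text \<open>The vector \<open>e y\<close> lies in the eigenspace of \<open>y * y\<close>, and
  squaring is injective, which gives orthogonality. At \<open>y = 0\<close> the factor
  \<open>r\<close> corrects the norm, as \<open>r * r * (2 / q) = 1\<close>.\<close>

lemma orthogonal_frame:
  assumes r: "r \<in> K" "of_nat q = 2 * (r * r)"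
  obtains e :: "'f \<Rightarrow> complex^'n" and c where "c \<noteq> 0" "\<And>y i. e y $h i \<in> K"
    "\<And>y z. F (e y) (e z) = (if y = z then c else 0)"
proof -
  obtain v where v: "P 1 *v v = v" "v \<noteq> 0" and vK: "\<And>i. v $h i \<in> K" using exists_v1 by blast
  define e where "e y = (if y = 0 then r *s (P 0 *v (w *v v)) else t y *v v)" for y
  have e_P: "P (y * y) *v e y = e y" for y
  proof (cases "y = 0")
    case False
    thus ?thesis using tP[of y 1] by (simp add: e_def matrix_vector_mul_assoc) (metis v(1) matrix_vector_mul_assoc)
  qed (simp add: e_def vec.scale matrix_vector_mul_assoc[of "P 0" "P 0"] PP)
  show thesis
  proof (rule that)
    show "F v v \<noteq> 0" by (rule F_v1_nonzero[OF v])
    have PK: "P 0 $h i $h j \<in> K" for i j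
    proof -
      have "inverse (of_nat q) * (\<Sum>x\<in>UNIV. u x $h i $h j) \<in> K"
        by (intro K_mult K_sum u_K K_inverse K_of_nat)
      thus ?thesis by (simp add: P_def psi_0 scaleR_conv_of_real[where 'a=complex] divide_inverse)
    qed
    show "e y $h i \<in> K" for y i
      by (auto simp: e_def intro!: K_mult r K_mult_vec PK w_K vK t_K)
    fix y z
    show "F (e y) (e z) = (if y = z then F v v else 0)"
    proof (cases "y = z")
      case False
      hence "F (P (y * y) *v e y) (P (z * z) *v e z) = 0" by (intro F_P_orthogonal) (simp add: square_eq_iff)
      thus ?thesis using False by (simp add: e_P)
    next
      case True
      have "2 * (r * r) \<noteq> (0::complex)" using r q_gt_1 by (metis of_nat_eq_0_iff not_one_less_zero)
      thus ?thesis using True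
        by (auto simp: e_def F_t F_scale F_scale_right F_P0_w_v1[OF v(1)] r field_simps)
    qed
  qed
qed

text \<open>The frame has one vector less than the dimension. Its orthogonal complement is the image
  of the idempotent \<open>f\<close>, a line spanned by a rational vector, which is anisotropic
  because the form is nondegenerate. The index \<open>None\<close> stands for this extra
  vector.\<close>

lemma orthogonal_basis:
  assumes r: "r \<in> K" "of_nat q = 2 * (r * r)"
  obtains e :: "'f option \<Rightarrow> complex^'n" and c c0
  where "c \<noteq> 0" "c0 \<noteq> 0" "\<And>y i. e y $h i \<in> K"
    "\<And>y z. F (e y) (e z) = (if y = z then (if y = None then c0 else c) else 0)"
proof -
  obtain e :: "'f \<Rightarrow> complex^'n" and c where c: "c \<noteq> 0" and eK: "\<And>y i. e y $h i \<in> K" and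
    e: "\<And>y z. F (e y) (e z) = (if y = z then c else 0)"
    by (rule orthogonal_frame[OF r]) (rule that)
  define f where "f x = x - (\<Sum>y\<in>UNIV. (F x (e y) / c) *s e y)" for x
  have F_diff: "F (x - y) z = F x z - F y z" for x y z
    using F_add[of "x - y" y z] by simp
  have fe: "F (f x) (e z) = 0" for x z
    using c by (simp add: f_def F_diff F_sum F_scale e if_distrib cong: if_cong)
  have f_add: "f (x + y) = f x + f y" for x y
    by (simp add: f_def F_add add_divide_distrib vec.scale_left_distrib sum.distrib)
  have f_scale: "f (a *s x) = a *s f x" for a x
    by (simp add: f_def F_scale vec.scale_right_diff_distrib vec.scale_sum_right)
  have lin: "Vector_Spaces.linear (*s) (*s) f"
    by unfold_locales (simp_all add: f_add f_scale)
  have Q: "matrix f *v x = f x" for x by (rule matrix_works[OF lin])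
  have ff: "f (f x) = f x" for x by (subst (1) f_def) (simp add: fe)
  have F_expand: "F x z = (\<Sum>j\<in>UNIV. x $h j * F (axis j 1) z)" for x z
    by (subst basis_expansion[of x, symmetric]) (simp add: F_sum F_scale)
  have QQ: "matrix f ** matrix f = matrix f"
    by (simp add: matrix_eq Q ff flip: matrix_vector_mul_assoc)
  \<comment> \<open>The trace is \<open>q + 1\<close> minus one for each frame vector, since summing
    over the unit vectors turns each correction into \<open>F (e y) (e y) / c\<close>.\<close>
  have "trace (matrix f) = (\<Sum>i\<in>UNIV. 1 - (\<Sum>y\<in>UNIV. F (axis i 1) (e y) / c * e y $h i))"
    by (simp add: trace_def matrix_def f_def axis_def)
  also have "\<dots> = of_nat (q + 1) - (\<Sum>y\<in>UNIV. (\<Sum>i\<in>UNIV. e y $h i * F (axis i 1) (e y)) / c)"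
    by (simp add: sum_subtractf card_n sum_divide_distrib) (subst sum.swap, simp add: mult_ac)
  also have "\<dots> = of_nat (q + 1) - (\<Sum>y\<in>(UNIV::'f set). 1)"
    using c by (simp add: e flip: F_expand)
  also have "\<dots> = 1" by (simp add: q_eq)
  finally have tr: "trace (matrix f) = 1" .
  hence "matrix f \<noteq> 0" by (auto simp: trace_def)
  then obtain i j where "matrix f $h i $h j \<noteq> 0" by (auto simp: vec_eq_iff)
  hence ij: "f (axis j 1) $h i \<noteq> 0" by (simp add: matrix_def)
  define v where "v = f (axis j 1)"
  have v: "v \<noteq> 0" "f v = v" using ij by (auto simp: v_def ff)
  have axK: "axis j 1 $h i \<in> K" for i by (simp add: axis_def K_0 K_1)
  have FK: "F (axis j 1) (e y) \<in> K" for y by (intro F_K axK eK)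
  have cK: "c \<in> K" using F_K[of "e 0" "e 0"] eK by (simp add: e)
  have vK: "v $h i \<in> K" for i
    by (auto simp: v_def f_def divide_inverse intro!: K_diff axK K_sum K_mult FK eK K_inverse cK)
  obtain g where g: "\<And>x. f x = g x *s v"
    using idempotent_trace_1[OF QQ tr, of v] v by (auto simp: Q)
  have Fv: "F v v \<noteq> 0"
  proof
    assume 0: "F v v = 0"
    have "F v z = 0" for z
    proof -
      have "z = f z + (\<Sum>y\<in>UNIV. (F z (e y) / c) *s e y)" by (simp add: f_def)
      hence "F v z = F v (f z) + (\<Sum>y\<in>UNIV. F z (e y) / c * F v (e y))"
        by (metis (no_types, lifting) F_add_right F_scale_right F_sum_right sum.cong)
      also have "F v (e y) = 0" for y using fe[of v] by (simp add: v)
      hence "(\<Sum>y\<in>UNIV. F z (e y) / c * F v (e y)) = 0" by simp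
      also have "F v (f z) = 0" by (simp add: g F_scale_right 0)
      finally show ?thesis by simp
    qed
    thus False using F_nondegenerate v by blast
  qed
  show thesis
  proof (rule that[OF c Fv, of "\<lambda>y. case y of None \<Rightarrow> v | Some y \<Rightarrow> e y"])
    fix y z :: "'f option"
    have "F v (e y) = 0" for y using fe[of v] by (simp add: v)
    thus "F (case y of None \<Rightarrow> v | Some y \<Rightarrow> e y) (case z of None \<Rightarrow> v | Some y \<Rightarrow> e y) =
        (if y = z then if y = None then F v v else c else 0)"
      using F_sym[of "e _" v] by (auto simp: e split: option.splits)
  qed (auto simp: vK eK split: option.splits)
qed

end

lemma (in sl2_form) exists_orthogonal_basis:
  assumes r: "r \<in> K" "of_nat q = 2 * (r * r)"
  obtains e :: "'f option \<Rightarrow> complex^'n" and c c0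
  where "c \<noteq> 0" "c0 \<noteq> 0" "\<And>y i. e y $h i \<in> K"
    "\<And>y z. F (e y) (e z) = (if y = z then (if y = None then c0 else c) else 0)"
proof -
  obtain \<psi> :: "'f \<Rightarrow> real" where "\<And>x y. \<psi> (x + y) = \<psi> x * \<psi> y" "\<And>x. \<psi> x * \<psi> x = 1" "\<psi> 1 = -1"
    using nontrivial_additive_character[OF char2] by blast
  then interpret sl2_form_char u t w F K q \<psi> by unfold_locales
  show thesis by (rule orthogonal_basis[OF r]) (rule that)
qed

section \<open>Algebras over a field and their quotients\<close>

text \<open>Free, tensor and Clifford algebras are handled by the part of
  \<open>central_simple_algebra\<close> that needs neither finite dimension nor simplicity.\<close>

locale k_algebra = vectorspace K A + A: ring A
  for K :: "('k, 'r) ring_scheme" and A :: "('k, 'a, 'm) module_scheme" +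
  assumes smult_mult_left: "\<lbrakk>a \<in> carrier K; x \<in> carrier A; y \<in> carrier A\<rbrakk>
      \<Longrightarrow> (a \<odot>\<^bsub>A\<^esub> x) \<otimes>\<^bsub>A\<^esub> y = a \<odot>\<^bsub>A\<^esub> (x \<otimes>\<^bsub>A\<^esub> y)"
    and smult_mult_right: "\<lbrakk>a \<in> carrier K; x \<in> carrier A; y \<in> carrier A\<rbrakk>
      \<Longrightarrow> x \<otimes>\<^bsub>A\<^esub> (a \<odot>\<^bsub>A\<^esub> y) = a \<odot>\<^bsub>A\<^esub> (x \<otimes>\<^bsub>A\<^esub> y)"

definition k_algebra_hom ::
  "('k, 'r) ring_scheme \<Rightarrow> ('k, 'a, 'm) module_scheme \<Rightarrow> ('k, 'b, 'n) module_scheme \<Rightarrow> ('a \<Rightarrow> 'b) \<Rightarrow> bool"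
  where "k_algebra_hom K A B h \<longleftrightarrow> h \<in> carrier A \<rightarrow> carrier B \<and> h \<one>\<^bsub>A\<^esub> = \<one>\<^bsub>B\<^esub> \<and> h \<zero>\<^bsub>A\<^esub> = \<zero>\<^bsub>B\<^esub> \<and>
    (\<forall>x\<in>carrier A. \<forall>y\<in>carrier A. h (x \<oplus>\<^bsub>A\<^esub> y) = h x \<oplus>\<^bsub>B\<^esub> h y \<and> h (x \<otimes>\<^bsub>A\<^esub> y) = h x \<otimes>\<^bsub>B\<^esub> h y) \<and>
    (\<forall>a\<in>carrier K. \<forall>x\<in>carrier A. h (a \<odot>\<^bsub>A\<^esub> x) = a \<odot>\<^bsub>B\<^esub> h x)"

lemma k_algebra_homD:
  assumes "k_algebra_hom K A B h"
  shows "x \<in> carrier A \<Longrightarrow> h x \<in> carrier B" "h \<one>\<^bsub>A\<^esub> = \<one>\<^bsub>B\<^esub>" "h \<zero>\<^bsub>A\<^esub> = \<zero>\<^bsub>B\<^esub>"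
    "x \<in> carrier A \<Longrightarrow> y \<in> carrier A \<Longrightarrow> h (x \<oplus>\<^bsub>A\<^esub> y) = h x \<oplus>\<^bsub>B\<^esub> h y"
    "x \<in> carrier A \<Longrightarrow> y \<in> carrier A \<Longrightarrow> h (x \<otimes>\<^bsub>A\<^esub> y) = h x \<otimes>\<^bsub>B\<^esub> h y"
    "a \<in> carrier K \<Longrightarrow> x \<in> carrier A \<Longrightarrow> h (a \<odot>\<^bsub>A\<^esub> x) = a \<odot>\<^bsub>B\<^esub> h x"
  using assms by (auto simp: k_algebra_hom_def)

lemma k_algebraI:
  assumes K: "field K"
    and add: "\<And>x y. \<lbrakk>x \<in> carrier A; y \<in> carrier A\<rbrakk> \<Longrightarrow> x \<oplus>\<^bsub>A\<^esub> y \<in> carrier A"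
      "\<zero>\<^bsub>A\<^esub> \<in> carrier A"
      "\<And>x y z. \<lbrakk>x \<in> carrier A; y \<in> carrier A; z \<in> carrier A\<rbrakk> \<Longrightarrow> (x \<oplus>\<^bsub>A\<^esub> y) \<oplus>\<^bsub>A\<^esub> z = x \<oplus>\<^bsub>A\<^esub> (y \<oplus>\<^bsub>A\<^esub> z)"
      "\<And>x y. \<lbrakk>x \<in> carrier A; y \<in> carrier A\<rbrakk> \<Longrightarrow> x \<oplus>\<^bsub>A\<^esub> y = y \<oplus>\<^bsub>A\<^esub> x"
      "\<And>x. x \<in> carrier A \<Longrightarrow> \<zero>\<^bsub>A\<^esub> \<oplus>\<^bsub>A\<^esub> x = x"
      "\<And>x. x \<in> carrier A \<Longrightarrow> \<exists>y\<in>carrier A. y \<oplus>\<^bsub>A\<^esub> x = \<zero>\<^bsub>A\<^esub>"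
    and mult: "\<And>x y. \<lbrakk>x \<in> carrier A; y \<in> carrier A\<rbrakk> \<Longrightarrow> x \<otimes>\<^bsub>A\<^esub> y \<in> carrier A"
      "\<one>\<^bsub>A\<^esub> \<in> carrier A"
      "\<And>x y z. \<lbrakk>x \<in> carrier A; y \<in> carrier A; z \<in> carrier A\<rbrakk> \<Longrightarrow> (x \<otimes>\<^bsub>A\<^esub> y) \<otimes>\<^bsub>A\<^esub> z = x \<otimes>\<^bsub>A\<^esub> (y \<otimes>\<^bsub>A\<^esub> z)"
      "\<And>x. x \<in> carrier A \<Longrightarrow> \<one>\<^bsub>A\<^esub> \<otimes>\<^bsub>A\<^esub> x = x"
      "\<And>x. x \<in> carrier A \<Longrightarrow> x \<otimes>\<^bsub>A\<^esub> \<one>\<^bsub>A\<^esub> = x"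
      "\<And>x y z. \<lbrakk>x \<in> carrier A; y \<in> carrier A; z \<in> carrier A\<rbrakk> \<Longrightarrow> (x \<oplus>\<^bsub>A\<^esub> y) \<otimes>\<^bsub>A\<^esub> z = x \<otimes>\<^bsub>A\<^esub> z \<oplus>\<^bsub>A\<^esub> y \<otimes>\<^bsub>A\<^esub> z"
      "\<And>x y z. \<lbrakk>x \<in> carrier A; y \<in> carrier A; z \<in> carrier A\<rbrakk> \<Longrightarrow> z \<otimes>\<^bsub>A\<^esub> (x \<oplus>\<^bsub>A\<^esub> y) = z \<otimes>\<^bsub>A\<^esub> x \<oplus>\<^bsub>A\<^esub> z \<otimes>\<^bsub>A\<^esub> y"
    and smult: "\<And>a x. \<lbrakk>a \<in> carrier K; x \<in> carrier A\<rbrakk> \<Longrightarrow> a \<odot>\<^bsub>A\<^esub> x \<in> carrier A"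
      "\<And>a b x. \<lbrakk>a \<in> carrier K; b \<in> carrier K; x \<in> carrier A\<rbrakk> \<Longrightarrow> (a \<oplus>\<^bsub>K\<^esub> b) \<odot>\<^bsub>A\<^esub> x = a \<odot>\<^bsub>A\<^esub> x \<oplus>\<^bsub>A\<^esub> b \<odot>\<^bsub>A\<^esub> x"
      "\<And>a x y. \<lbrakk>a \<in> carrier K; x \<in> carrier A; y \<in> carrier A\<rbrakk> \<Longrightarrow> a \<odot>\<^bsub>A\<^esub> (x \<oplus>\<^bsub>A\<^esub> y) = a \<odot>\<^bsub>A\<^esub> x \<oplus>\<^bsub>A\<^esub> a \<odot>\<^bsub>A\<^esub> y"
      "\<And>a b x. \<lbrakk>a \<in> carrier K; b \<in> carrier K; x \<in> carrier A\<rbrakk> \<Longrightarrow> (a \<otimes>\<^bsub>K\<^esub> b) \<odot>\<^bsub>A\<^esub> x = a \<odot>\<^bsub>A\<^esub> (b \<odot>\<^bsub>A\<^esub> x)"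
      "\<And>x. x \<in> carrier A \<Longrightarrow> \<one>\<^bsub>K\<^esub> \<odot>\<^bsub>A\<^esub> x = x"
      "\<And>a x y. \<lbrakk>a \<in> carrier K; x \<in> carrier A; y \<in> carrier A\<rbrakk> \<Longrightarrow> (a \<odot>\<^bsub>A\<^esub> x) \<otimes>\<^bsub>A\<^esub> y = a \<odot>\<^bsub>A\<^esub> (x \<otimes>\<^bsub>A\<^esub> y)"
      "\<And>a x y. \<lbrakk>a \<in> carrier K; x \<in> carrier A; y \<in> carrier A\<rbrakk> \<Longrightarrow> x \<otimes>\<^bsub>A\<^esub> (a \<odot>\<^bsub>A\<^esub> y) = a \<odot>\<^bsub>A\<^esub> (x \<otimes>\<^bsub>A\<^esub> y)"
  shows "k_algebra K A"
proof -
  interpret K: field K by fact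
  have ab: "abelian_group A" by (rule abelian_groupI) (use add in auto)
  have mon: "monoid A" by (rule monoidI) (use mult in auto)
  have ring: "ring A" by (rule ringI[OF ab mon]) (use mult in auto)
  have "Module.module K A" by (rule moduleI[OF K.is_cring ab]) (use smult in auto)
  with ring K show ?thesis
    by (intro k_algebra.intro vectorspace.intro k_algebra_axioms.intro) (use smult in auto)
qed

text \<open>Equational axioms pass along a surjection compatible with the operations. Quotients are
  then algebras without repeating the axioms for cosets.\<close>

lemma k_algebra_image:
  assumes A: "k_algebra K A"
    and surj: "carrier Q = \<pi> ` carrier A"
    and ops: "\<And>x y. \<lbrakk>x \<in> carrier A; y \<in> carrier A\<rbrakk> \<Longrightarrow> \<pi> x \<oplus>\<^bsub>Q\<^esub> \<pi> y = \<pi> (x \<oplus>\<^bsub>A\<^esub> y)"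
      "\<And>x y. \<lbrakk>x \<in> carrier A; y \<in> carrier A\<rbrakk> \<Longrightarrow> \<pi> x \<otimes>\<^bsub>Q\<^esub> \<pi> y = \<pi> (x \<otimes>\<^bsub>A\<^esub> y)"
      "\<And>a x. \<lbrakk>a \<in> carrier K; x \<in> carrier A\<rbrakk> \<Longrightarrow> a \<odot>\<^bsub>Q\<^esub> \<pi> x = \<pi> (a \<odot>\<^bsub>A\<^esub> x)"
      "\<one>\<^bsub>Q\<^esub> = \<pi> \<one>\<^bsub>A\<^esub>" "\<zero>\<^bsub>Q\<^esub> = \<pi> \<zero>\<^bsub>A\<^esub>"
  shows "k_algebra K Q" "k_algebra_hom K A Q \<pi>"
proof -
  interpret k_algebra K A by fact
  show "k_algebra K Q"
  proof (rule k_algebraI)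
    show "field K" by (rule field_axioms)
    fix x assume "x \<in> carrier Q"
    then obtain x' where x: "x = \<pi> x'" "x' \<in> carrier A" by (auto simp: surj)
    show "\<exists>y\<in>carrier Q. y \<oplus>\<^bsub>Q\<^esub> x = \<zero>\<^bsub>Q\<^esub>"
      by (rule bexI[of _ "\<pi> (\<ominus>\<^bsub>A\<^esub> x')"]) (use x in \<open>simp_all add: ops surj M.l_neg\<close>)
  qed (auto simp: surj ops M.a_ac A.m_assoc A.l_distr A.r_distr smult_l_distr
      smult_r_distr smult_assoc1 smult_mult_left smult_mult_right)
  show "k_algebra_hom K A Q \<pi>" by (auto simp: k_algebra_hom_def surj ops)
qed

lemma k_algebra_subalgebra:
  assumes A: "k_algebra K A" and D: "D \<subseteq> carrier A" "\<one>\<^bsub>A\<^esub> \<in> D" "\<zero>\<^bsub>A\<^esub> \<in> D"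
    and closed: "\<And>x y. x \<in> D \<Longrightarrow> y \<in> D \<Longrightarrow> x \<oplus>\<^bsub>A\<^esub> y \<in> D" "\<And>x y. x \<in> D \<Longrightarrow> y \<in> D \<Longrightarrow> x \<otimes>\<^bsub>A\<^esub> y \<in> D"
      "\<And>a x. a \<in> carrier K \<Longrightarrow> x \<in> D \<Longrightarrow> a \<odot>\<^bsub>A\<^esub> x \<in> D"
  shows "k_algebra K (A\<lparr>carrier := D\<rparr>)"
proof -
  interpret k_algebra K A by fact
  have sub: "x \<in> D \<Longrightarrow> x \<in> carrier A" for x using D by auto
  show ?thesis
  proof (rule k_algebraI)
    show "field K" by (rule field_axioms)
    fix x assume x: "x \<in> carrier (A\<lparr>carrier := D\<rparr>)"
    have "(\<ominus>\<^bsub>K\<^esub> \<one>\<^bsub>K\<^esub>) \<odot>\<^bsub>A\<^esub> x = \<ominus>\<^bsub>A\<^esub> x" using x sub by (simp add: smult_l_minus)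
    hence "\<ominus>\<^bsub>A\<^esub> x \<in> D" using closed(3)[of "\<ominus>\<^bsub>K\<^esub> \<one>\<^bsub>K\<^esub>" x] x by simp
    thus "\<exists>y\<in>carrier (A\<lparr>carrier := D\<rparr>). y \<oplus>\<^bsub>A\<lparr>carrier := D\<rparr>\<^esub> x = \<zero>\<^bsub>A\<lparr>carrier := D\<rparr>\<^esub>"
      using x sub by (intro bexI[of _ "\<ominus>\<^bsub>A\<^esub> x"]) (simp_all add: M.l_neg)
  qed (auto simp: D closed sub M.a_ac A.m_assoc A.l_distr A.r_distr smult_l_distr
      smult_r_distr smult_assoc1 smult_mult_left smult_mult_right)
qed

context k_algebra
begin

text \<open>A ring ideal absorbs \<open>a \<odot> 1\<close>, so it is automatically a
  subspace.\<close>

lemma smult_ideal: assumes "ideal I A" "a \<in> carrier K" "x \<in> I" shows "a \<odot>\<^bsub>A\<^esub> x \<in> I"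
proof -
  interpret I: ideal I A by fact
  have x: "x \<in> carrier A" using assms I.a_subset by auto
  have "a \<odot>\<^bsub>A\<^esub> x = (a \<odot>\<^bsub>A\<^esub> \<one>\<^bsub>A\<^esub>) \<otimes>\<^bsub>A\<^esub> x" using assms x by (simp add: smult_mult_left)
  thus ?thesis using assms x by (simp add: I.I_l_closed)
qed

lemma coset_eq_iff:
  assumes "ideal I A" "x \<in> carrier A" "y \<in> carrier A"
  shows "I +>\<^bsub>A\<^esub> x = I +>\<^bsub>A\<^esub> y \<longleftrightarrow> x \<ominus>\<^bsub>A\<^esub> y \<in> I"
  using A.quotient_eq_iff_same_a_r_cos assms by blast

lemma quotient_k_algebra:
  assumes I: "ideal I A"
  shows "k_algebra K (quotient_algebra A I)" "k_algebra_hom K A (quotient_algebra A I) (\<lambda>x. I +>\<^bsub>A\<^esub> x)"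
proof -
  interpret I: ideal I A by fact
  \<comment> \<open>The scalar multiple in \<open>quotient_algebra\<close> is a union over all
    representatives of a coset. Two representatives differ by an element of the ideal, so all
    members of the union coincide.\<close>
  have sm: "(\<Union>y\<in>I +>\<^bsub>A\<^esub> x. I +>\<^bsub>A\<^esub> (a \<odot>\<^bsub>A\<^esub> y)) = I +>\<^bsub>A\<^esub> (a \<odot>\<^bsub>A\<^esub> x)"
    if a: "a \<in> carrier K" and x: "x \<in> carrier A" for a x
  proof -
    have const: "I +>\<^bsub>A\<^esub> (a \<odot>\<^bsub>A\<^esub> y) = I +>\<^bsub>A\<^esub> (a \<odot>\<^bsub>A\<^esub> x)" if y: "y \<in> I +>\<^bsub>A\<^esub> x" for y
    proof -
      obtain i where i: "i \<in> I" "y = i \<oplus>\<^bsub>A\<^esub> x" using y by (auto simp: a_r_coset_def')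
      have ic: "i \<in> carrier A" using i I.a_subset by auto
      have "a \<odot>\<^bsub>A\<^esub> y \<ominus>\<^bsub>A\<^esub> a \<odot>\<^bsub>A\<^esub> x = a \<odot>\<^bsub>A\<^esub> i"
        using a x ic i by (simp add: smult_r_distr M.minus_eq M.add.m_assoc M.r_neg)
      thus ?thesis using coset_eq_iff[OF I, of "a \<odot>\<^bsub>A\<^esub> y" "a \<odot>\<^bsub>A\<^esub> x"] smult_ideal[OF I a i(1)] a x ic i
        by simp
    qed
    have "x \<in> I +>\<^bsub>A\<^esub> x" using x by (rule I.a_rcos_self)
    hence "I +>\<^bsub>A\<^esub> x \<noteq> {}" by blast
    thus ?thesis by (rule SUP_eq_const) (rule const)
  qed
  note * = k_algebra_image[OF k_algebra_axioms, of "quotient_algebra A I" "\<lambda>x. I +>\<^bsub>A\<^esub> x"]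
  have **: "carrier (quotient_algebra A I) = (\<lambda>x. I +>\<^bsub>A\<^esub> x) ` carrier A"
    by (auto simp: quotient_algebra_def FactRing_def A_RCOSETS_def')
  show "k_algebra K (quotient_algebra A I)"
    by (rule *(1)[OF **]) (auto simp: quotient_algebra_def FactRing_def I.rcoset_mult_add I.a_rcos_sum sm M.a_coset_add_zero[OF I.a_subset])
  show "k_algebra_hom K A (quotient_algebra A I) (\<lambda>x. I +>\<^bsub>A\<^esub> x)"
    by (rule *(2)[OF **]) (auto simp: quotient_algebra_def FactRing_def I.rcoset_mult_add I.a_rcos_sum sm M.a_coset_add_zero[OF I.a_subset])
qed

text \<open>The kernel \<open>J\<close> of \<open>h\<close> is an ideal containing \<open>S\<close>,
  hence the generated ideal; \<open>h\<close> is therefore constant on cosets and may be evaluated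
  at a chosen representative.\<close>

lemma quotient_lift:
  assumes B: "k_algebra K B" and h: "k_algebra_hom K A B h" and S: "S \<subseteq> carrier A"
    and kill: "\<And>s. s \<in> S \<Longrightarrow> h s = \<zero>\<^bsub>B\<^esub>"
  shows "\<exists>h'. k_algebra_hom K (quotient_algebra A (Idl\<^bsub>A\<^esub> S)) B h' \<and>
    (\<forall>x\<in>carrier A. h' (Idl\<^bsub>A\<^esub> S +>\<^bsub>A\<^esub> x) = h x)"
proof -
  interpret B: k_algebra K B by fact
  note hD = k_algebra_homD[OF h]
  define I where "I = Idl\<^bsub>A\<^esub> S"
  have I: "ideal I A" unfolding I_def by (rule A.genideal_ideal[OF S])
  interpret I: ideal I A by fact
  have h_neg: "h (\<ominus>\<^bsub>A\<^esub> x) = \<ominus>\<^bsub>B\<^esub> h x" if "x \<in> carrier A" for x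
    using hD(4)[of "\<ominus>\<^bsub>A\<^esub> x" x] that hD by (simp add: M.l_neg B.M.minus_equality)
  define J where "J = {x \<in> carrier A. h x = \<zero>\<^bsub>B\<^esub>}"
  have "ideal J A"
  proof (rule idealI)
    show "ring A" by (rule A.ring_axioms)
    show "subgroup J (add_monoid A)"
      by (rule subgroup.intro) (auto simp: J_def hD h_neg simp flip: a_inv_def)
  qed (auto simp: J_def hD)
  hence "I \<subseteq> J" unfolding I_def using kill S by (intro A.genideal_minimal) (auto simp: J_def)
  have eq: "h x = h y" if "x \<in> carrier A" "y \<in> carrier A" "I +>\<^bsub>A\<^esub> x = I +>\<^bsub>A\<^esub> y" for x y
  proof -
    have "x \<ominus>\<^bsub>A\<^esub> y \<in> J" using that coset_eq_iff[OF I] \<open>I \<subseteq> J\<close> by auto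
    hence "h x \<ominus>\<^bsub>B\<^esub> h y = \<zero>\<^bsub>B\<^esub>" using that hD by (simp add: J_def M.minus_eq B.M.minus_eq h_neg)
    thus ?thesis using that hD by (simp add: B.A.r_right_minus_eq)
  qed
  define h' where "h' X = h (SOME x. x \<in> carrier A \<and> I +>\<^bsub>A\<^esub> x = X)" for X
  have h': "h' (I +>\<^bsub>A\<^esub> x) = h x" if "x \<in> carrier A" for x
    unfolding h'_def using that by (metis (mono_tags, lifting) eq someI)
  note \<pi> = k_algebra_homD[OF quotient_k_algebra(2)[OF I]]
  have surj: "carrier (quotient_algebra A I) = (\<lambda>x. I +>\<^bsub>A\<^esub> x) ` carrier A"
    by (auto simp: quotient_algebra_def FactRing_def A_RCOSETS_def')
  have "k_algebra_hom K (quotient_algebra A I) B h'"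
    unfolding k_algebra_hom_def surj
    by (auto simp: h' hD simp flip: \<pi>(2-6))
  with h' show ?thesis by (auto simp: I_def)
qed

end

section \<open>The free algebra over a subfield of the complex numbers\<close>

text \<open>The record operations are those of the complex numbers and only the carrier is smaller.
  Sums in \<open>K\<close> thereby turn into ordinary sums, and membership in \<open>K\<close> is
  all that has to be checked.\<close>

locale complex_subfield =
  fixes K :: "complex ring"
  assumes field_K: "field K"
    and ops [simp]: "monoid.mult K = (*)" "monoid.one K = 1" "ring.zero K = 0" "ring.add K = (+)"
begin

sublocale K: field K by (rule field_K)

lemma add_closed [intro]: "x \<in> carrier K \<Longrightarrow> y \<in> carrier K \<Longrightarrow> x + y \<in> carrier K"
  and mult_closed [intro]: "x \<in> carrier K \<Longrightarrow> y \<in> carrier K \<Longrightarrow> x * y \<in> carrier K"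
  and zero_closed [intro, simp]: "0 \<in> carrier K" and one_closed [intro, simp]: "1 \<in> carrier K"
  using K.add.m_closed[of x y] K.m_closed[of x y] K.zero_closed K.one_closed by simp_all

lemma a_inv_eq: "x \<in> carrier K \<Longrightarrow> \<ominus>\<^bsub>K\<^esub> x = - x"
  using K.l_neg[of x] by (simp add: add_eq_0_iff2)

lemma uminus_closed [intro]: "x \<in> carrier K \<Longrightarrow> - x \<in> carrier K"
  using K.a_inv_closed[of x] by (simp add: a_inv_eq)

lemma diff_closed [intro]: "x \<in> carrier K \<Longrightarrow> y \<in> carrier K \<Longrightarrow> x - y \<in> carrier K"
  using add_closed[of x "- y"] by auto

lemma m_inv_eq: assumes "x \<in> carrier K" "x \<noteq> 0" shows "inv\<^bsub>K\<^esub> x = inverse x"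
proof -
  have "x \<in> Units K" using assms by (simp add: K.field_Units)
  from K.Units_l_inv[OF this] show ?thesis using assms by (simp add: field_simps)
qed

lemma inverse_closed [intro]: "x \<in> carrier K \<Longrightarrow> inverse x \<in> carrier K"
proof (cases "x = 0")
  case False
  assume x: "x \<in> carrier K"
  hence "x \<in> Units K" using False by (simp add: K.field_Units)
  from K.Units_inv_closed[OF this] show ?thesis using x False by (simp add: m_inv_eq)
qed simp

lemma divide_closed [intro]: "x \<in> carrier K \<Longrightarrow> y \<in> carrier K \<Longrightarrow> x / y \<in> carrier K"
  by (auto simp: divide_inverse)

lemma sum_closed [intro]: "(\<And>x. x \<in> A \<Longrightarrow> f x \<in> carrier K) \<Longrightarrow> sum f A \<in> carrier K"
  by (induction A rule: infinite_finite_induct) auto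

lemma of_nat_closed [intro, simp]: "of_nat k \<in> carrier K"
  by (induction k) auto

lemma numeral_closed [intro, simp]: "numeral k \<in> carrier K"
  using of_nat_closed[of "numeral k"] by simp

lemma power_closed [intro]: "x \<in> carrier K \<Longrightarrow> x ^ k \<in> carrier K"
  by (induction k) auto

lemma finsum_eq: "finite A \<Longrightarrow> (\<And>x. x \<in> A \<Longrightarrow> f x \<in> carrier K) \<Longrightarrow> finsum K f A = sum f A"
  by (induction A rule: finite_induct) (auto simp: K.finsum_insert Pi_def)

section \<open>Convolution of finitely supported functions on words\<close>

abbreviation supp :: "('s \<Rightarrow> complex) \<Rightarrow> 's set" where "supp f \<equiv> {u. f u \<noteq> 0}"

lemma free_mem: "f \<in> carrier (free_algebra K S) \<longleftrightarrow>
    range f \<subseteq> carrier K \<and> finite (supp f) \<and> supp f \<subseteq> lists S"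
  by (simp add: free_algebra_def)

definition conv :: "('s list \<Rightarrow> complex) \<Rightarrow> ('s list \<Rightarrow> complex) \<Rightarrow> 's list \<Rightarrow> complex"
  where "conv f g u = (\<Sum>j\<le>length u. f (take j u) * g (drop j u))"

lemma free_ops:
  "\<one>\<^bsub>free_algebra K S\<^esub> = (\<lambda>u. if u = [] then 1 else 0)"
  "\<zero>\<^bsub>free_algebra K S\<^esub> = (\<lambda>u. 0)"
  "f \<oplus>\<^bsub>free_algebra K S\<^esub> g = (\<lambda>u. f u + g u)"
  "a \<odot>\<^bsub>free_algebra K S\<^esub> f = (\<lambda>u. a * f u)"
  by (simp_all add: free_algebra_def fun_eq_iff)

lemma free_mult:
  assumes "f \<in> carrier (free_algebra K S)" "g \<in> carrier (free_algebra K S)"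
  shows "f \<otimes>\<^bsub>free_algebra K S\<^esub> g = conv f g"
  using assms by (auto simp: free_algebra_def conv_def fun_eq_iff intro!: finsum_eq mult_closed)

lemma conv_assoc: "conv (conv f g) h = conv f (conv g h)"
proof
  fix u
  have "conv (conv f g) h u = (\<Sum>j\<le>length u. \<Sum>i\<le>j. f (take i u) * g (drop i (take j u)) * h (drop j u))"
    unfolding conv_def sum_distrib_right
    by (intro sum.cong refl) (auto simp: min_def intro!: sum.cong)
  also have "\<dots> = (\<Sum>(j, i)\<in>(SIGMA j:{..length u}. {..j}). f (take i u) * g (drop i (take j u)) * h (drop j u))"
    by (simp add: sum.Sigma)
  \<comment> \<open>Both sides cut the word twice. The cuts are recorded either as positions
    \<open>i \<le> j\<close> or as the first position with the distance \<open>k = j - i\<close> to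
    the second.\<close>
  also have "\<dots> = (\<Sum>(i, k)\<in>(SIGMA i:{..length u}. {..length u - i}). f (take i u) * g (take k (drop i u)) * h (drop (i + k) u))"
    by (rule sum.reindex_bij_witness[of _ "\<lambda>(i, k). (i + k, i)" "\<lambda>(j, i). (i, j - i)"])
      (auto simp: drop_take)
  also have "\<dots> = conv f (conv g h) u"
    by (simp add: conv_def sum.Sigma sum_distrib_left mult.assoc add.commute)
  finally show "conv (conv f g) h u = conv f (conv g h) u" .
qed

lemma supp_conv: "supp (conv f g) \<subseteq> (\<lambda>(v, w). v @ w) ` (supp f \<times> supp g)"
proof
  fix u assume "u \<in> supp (conv f g)"
  then obtain j where "f (take j u) * g (drop j u) \<noteq> 0"
    unfolding conv_def using sum.neutral by (metis (mono_tags, lifting) mem_Collect_eq)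
  thus "u \<in> (\<lambda>(v, w). v @ w) ` (supp f \<times> supp g)"
    by (intro image_eqI[of _ _ "(take j u, drop j u)"]) auto
qed

lemma conv_unit: "conv (\<lambda>u. if u = [] then 1 else 0) f = f" "conv f (\<lambda>u. if u = [] then 1 else 0) = f"
proof -
  show "conv (\<lambda>u. if u = [] then 1 else 0) f = f"
  proof
    fix u
    have "conv (\<lambda>u. if u = [] then 1 else 0) f u = (\<Sum>j\<le>length u. if j = 0 then f u else 0)"
      unfolding conv_def by (intro sum.cong) auto
    thus "conv (\<lambda>u. if u = [] then 1 else 0) f u = f u" by simp
  qed
  show "conv f (\<lambda>u. if u = [] then 1 else 0) = f"
  proof
    fix u
    have "conv f (\<lambda>u. if u = [] then 1 else 0) u = (\<Sum>j\<le>length u. if j = length u then f u else 0)"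
      unfolding conv_def by (intro sum.cong) auto
    thus "conv f (\<lambda>u. if u = [] then 1 else 0) u = f u" by simp
  qed
qed

lemma conv_closed:
  assumes "f \<in> carrier (free_algebra K S)" "g \<in> carrier (free_algebra K S)"
  shows "conv f g \<in> carrier (free_algebra K S)"
proof -
  have "finite (supp (conv f g))"
    by (rule finite_subset[OF supp_conv]) (use assms in \<open>auto simp: free_mem\<close>)
  moreover have "supp (conv f g) \<subseteq> lists S"
    using supp_conv[of f g] assms by (fastforce simp: free_mem)
  moreover have "range (conv f g) \<subseteq> carrier K"
    using assms by (auto simp: free_mem conv_def intro!: sum_closed mult_closed)
  ultimately show ?thesis by (simp add: free_mem)
qed

lemma free_add_closed:
  assumes "f \<in> carrier (free_algebra K S)" "g \<in> carrier (free_algebra K S)"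
  shows "(\<lambda>u. f u + g u) \<in> carrier (free_algebra K S)"
proof -
  have "supp (\<lambda>u. f u + g u) \<subseteq> supp f \<union> supp g" by auto
  moreover have "finite (supp f \<union> supp g)" "supp f \<union> supp g \<subseteq> lists S" using assms by (auto simp: free_mem)
  moreover have "f u + g u \<in> carrier K" for u using assms by (intro add_closed) (auto simp: free_mem)
  ultimately show ?thesis unfolding free_mem by (meson finite_subset image_subsetI subset_trans)
qed

lemma free_smult_closed:
  assumes "f \<in> carrier (free_algebra K S)" "a \<in> carrier K"
  shows "(\<lambda>u. a * f u) \<in> carrier (free_algebra K S)"
  using assms by (auto simp: free_mem intro: finite_subset[of _ "supp f"])

lemma conv_distrib:
  "conv (\<lambda>u. f u + g u) h = (\<lambda>u. conv f h u + conv g h u)"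
  "conv h (\<lambda>u. f u + g u) = (\<lambda>u. conv h f u + conv h g u)"
  "conv (\<lambda>u. a * f u) h = (\<lambda>u. a * conv f h u)"
  "conv h (\<lambda>u. a * f u) = (\<lambda>u. a * conv h f u)"
  by (simp_all add: fun_eq_iff conv_def distrib_left distrib_right sum.distrib sum_distrib_left mult_ac)

lemma free_one_closed: "(\<lambda>u. if u = [] then 1 else 0) \<in> carrier (free_algebra K S)"
  by (auto simp: free_mem)

lemma free_k_algebra: "k_algebra K (free_algebra K S)"
proof (rule k_algebraI)
  show "field K" by (rule field_K)
  fix f assume f: "f \<in> carrier (free_algebra K S)"
  show "\<exists>g\<in>carrier (free_algebra K S). g \<oplus>\<^bsub>free_algebra K S\<^esub> f = \<zero>\<^bsub>free_algebra K S\<^esub>"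
    by (rule bexI[of _ "\<lambda>u. (- 1) * f u"]) (use f free_smult_closed[of f S "-1"] uminus_closed in \<open>auto simp: free_ops\<close>)
next
  show "\<one>\<^bsub>free_algebra K S\<^esub> \<in> carrier (free_algebra K S)" "\<zero>\<^bsub>free_algebra K S\<^esub> \<in> carrier (free_algebra K S)"
    by (auto simp: free_mem free_ops)
qed (auto simp: free_ops free_mult conv_closed free_add_closed free_smult_closed conv_assoc conv_unit
    conv_distrib free_one_closed algebra_simps)

text \<open>The functional on the free algebra with values \<open>E\<close> on words. Homomorphisms
  to matrices are assembled from one such functional for each entry.\<close>

definition lin_ext :: "('s list \<Rightarrow> complex) \<Rightarrow> ('s list \<Rightarrow> complex) \<Rightarrow> complex"
  where "lin_ext E f = (\<Sum>u\<in>supp f. f u * E u)"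

lemma lin_ext_superset: "finite Z \<Longrightarrow> supp f \<subseteq> Z \<Longrightarrow> lin_ext E f = (\<Sum>u\<in>Z. f u * E u)"
  unfolding lin_ext_def by (rule sum.mono_neutral_left) auto

lemma lin_ext_add:
  assumes "finite (supp f)" "finite (supp g)"
  shows "lin_ext E (\<lambda>u. f u + g u) = lin_ext E f + lin_ext E g"
proof -
  let ?Z = "supp f \<union> supp g"
  have "finite ?Z" using assms by simp
  hence "lin_ext E (\<lambda>u. f u + g u) = (\<Sum>u\<in>?Z. (f u + g u) * E u)"
    "lin_ext E f = (\<Sum>u\<in>?Z. f u * E u)" "lin_ext E g = (\<Sum>u\<in>?Z. g u * E u)"
    by (auto intro!: lin_ext_superset)
  thus ?thesis by (simp add: distrib_right sum.distrib)
qed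

lemma lin_ext_smult: "lin_ext E (\<lambda>u. a * f u) = a * lin_ext E f"
  by (cases "a = 0") (simp_all add: lin_ext_def sum_distrib_left mult.assoc)

lemma lin_ext_single: "lin_ext E (\<lambda>u. if u = v then a else 0) = a * E v"
  by (subst lin_ext_superset[of "{v}"]) auto

lemma lin_ext_conv:
  assumes "finite (supp f)" "finite (supp g)"
  shows "lin_ext E (conv f g) = (\<Sum>v\<in>supp f. \<Sum>w\<in>supp g. f v * g w * E (v @ w))"
proof -
  define Z where "Z = (\<lambda>(v, w). v @ w) ` (supp f \<times> supp g)"
  have fin: "finite Z" using assms by (simp add: Z_def)
  have Z: "v @ w \<in> Z" if "f v \<noteq> 0" "g w \<noteq> 0" for v w
    unfolding Z_def using that by (intro image_eqI[of _ _ "(v, w)"]) auto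
  have supp: "supp (conv f g) \<subseteq> Z" unfolding Z_def by (rule supp_conv)
  \<comment> \<open>The cuts of words at which the product vanishes. Outside them, cutting is a
    bijection onto the pairs of words in the two supports.\<close>
  let ?D = "{(u, j). u \<in> Z \<and> j \<le> length u \<and> (f (take j u) = 0 \<or> g (drop j u) = 0)}"
  have "lin_ext E (conv f g) = (\<Sum>u\<in>Z. \<Sum>j\<le>length u. f (take j u) * g (drop j u) * E u)"
    by (subst lin_ext_superset[OF fin supp]) (simp add: conv_def sum_distrib_right)
  also have "\<dots> = (\<Sum>(u, j)\<in>(SIGMA u:Z. {..length u}). f (take j u) * g (drop j u) * E u)"
    using fin by (subst sum.Sigma) auto
  also have "\<dots> = (\<Sum>(v, w)\<in>supp f \<times> supp g. f v * g w * E (v @ w))"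
  proof (rule sum.reindex_bij_witness_not_neutral[where S' = ?D and T' = "{}" and i = "\<lambda>(v, w). (v @ w, length v)"
        and j = "\<lambda>(u, j). (take j u, drop j u)"])
    show "finite ?D" by (rule finite_subset[of _ "SIGMA u:Z. {..length u}"]) (use fin in auto)
  qed (auto simp: Z)
  also have "\<dots> = (\<Sum>v\<in>supp f. \<Sum>w\<in>supp g. f v * g w * E (v @ w))"
    by (subst sum.cartesian_product) simp
  finally show ?thesis .
qed

end

section \<open>Homomorphisms from the Clifford algebra\<close>

text \<open>All complex matrices, regarded as an algebra over the smaller field: images of odd
  Clifford elements may involve a square root outside \<open>K\<close>, and only the even part will
  land in the rational matrices.\<close>

definition mat_algebra :: "nat \<Rightarrow> (complex, complex mat) module" where
  "mat_algebra N = \<lparr>carrier = carrier_mat N N, monoid.mult = (*), one = 1\<^sub>m N, zero = 0\<^sub>m N N,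
    add = (+), smult = (\<cdot>\<^sub>m)\<rparr>"

lemma mat_algebra_sel [simp]:
  "carrier (mat_algebra N) = carrier_mat N N" "monoid.mult (mat_algebra N) = (*)" "monoid.one (mat_algebra N) = 1\<^sub>m N"
  "ring.zero (mat_algebra N) = 0\<^sub>m N N" "ring.add (mat_algebra N) = (+)" "module.smult (mat_algebra N) = (\<cdot>\<^sub>m)"
  by (simp_all add: mat_algebra_def)

lemma (in complex_subfield) mat_k_algebra: "k_algebra K (mat_algebra N)"
proof (rule k_algebraI)
  show "field K" by (rule field_K)
  fix M :: "complex mat" assume "M \<in> carrier (mat_algebra N)"
  thus "\<exists>M'\<in>carrier (mat_algebra N). M' \<oplus>\<^bsub>mat_algebra N\<^esub> M = \<zero>\<^bsub>mat_algebra N\<^esub>"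
    by (intro bexI[of _ "- M"]) auto
next
  fix a b :: complex and M :: "complex mat"
  show "(a \<otimes>\<^bsub>K\<^esub> b) \<odot>\<^bsub>mat_algebra N\<^esub> M = a \<odot>\<^bsub>mat_algebra N\<^esub> (b \<odot>\<^bsub>mat_algebra N\<^esub> M)"
    "\<one>\<^bsub>K\<^esub> \<odot>\<^bsub>mat_algebra N\<^esub> M = M"
    by (auto intro!: eq_matI)
qed (auto simp: assoc_add_mat[of _ N N] comm_add_mat[of _ N N] assoc_mult_mat[of _ N N _ N _ N]
    add_mult_distrib_mat[of _ N N _ _ N] mult_add_distrib_mat[of _ N N _ N]
    add_smult_distrib_left_mat[of _ N N] add_smult_distrib_right_mat[of _ N N]
    mult_smult_assoc_mat[of _ N N _ N] mult_smult_distrib[of _ N N _ N])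

context complex_subfield
begin

definition ev :: "('s \<Rightarrow> complex mat) \<Rightarrow> nat \<Rightarrow> 's list \<Rightarrow> complex mat"
  where "ev \<phi> N u = foldr (\<lambda>w M. \<phi> w * M) u (1\<^sub>m N)"

definition free_lift :: "('s \<Rightarrow> complex mat) \<Rightarrow> nat \<Rightarrow> ('s list \<Rightarrow> complex) \<Rightarrow> complex mat"
  where "free_lift \<phi> N f = Matrix.mat N N (\<lambda>(r, s). lin_ext (\<lambda>u. ev \<phi> N u $$ (r, s)) f)"

context
  fixes \<phi> :: "'s \<Rightarrow> complex mat" and N :: nat
  assumes \<phi>: "\<And>w. \<phi> w \<in> carrier_mat N N"
begin

lemma ev_closed: "ev \<phi> N u \<in> carrier_mat N N"
  unfolding ev_def by (induction u) (auto intro!: mult_carrier_mat[OF \<phi>])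

lemma ev_append: "ev \<phi> N (u @ v) = ev \<phi> N u * ev \<phi> N v"
proof (induction u)
  case Nil
  show ?case using ev_closed[of v] by (simp add: ev_def)
next
  case (Cons w u)
  have "ev \<phi> N (w # x) = \<phi> w * ev \<phi> N x" for x by (simp add: ev_def)
  with Cons show ?case using assoc_mult_mat[OF \<phi> ev_closed ev_closed] by simp
qed

lemma free_lift_hom: "k_algebra_hom K (free_algebra K S) (mat_algebra N) (free_lift \<phi> N)"
proof -
  have mult: "free_lift \<phi> N (conv f g) = free_lift \<phi> N f * free_lift \<phi> N g"
    if fin: "finite (supp f)" "finite (supp g)" for f g
  proof (rule eq_matI)
    fix r s assume "r < dim_row (free_lift \<phi> N f * free_lift \<phi> N g)" "s < dim_col (free_lift \<phi> N f * free_lift \<phi> N g)"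
    hence rs: "r < N" "s < N" by (auto simp: free_lift_def)
    have app: "ev \<phi> N (v @ w) $$ (r, s) = (\<Sum>k<N. ev \<phi> N v $$ (r, k) * ev \<phi> N w $$ (k, s))" for v w
      using rs carrier_matD[OF ev_closed[of v]] carrier_matD[OF ev_closed[of w]]
      by (simp add: ev_append scalar_prod_def atLeast0LessThan)
    have "(free_lift \<phi> N f * free_lift \<phi> N g) $$ (r, s) =
      (\<Sum>k<N. lin_ext (\<lambda>u. ev \<phi> N u $$ (r, k)) f * lin_ext (\<lambda>u. ev \<phi> N u $$ (k, s)) g)"
      using rs by (simp add: free_lift_def scalar_prod_def atLeast0LessThan)
    also have "\<dots> = (\<Sum>k<N. \<Sum>v\<in>supp f. \<Sum>w\<in>supp g. f v * g w * (ev \<phi> N v $$ (r, k) * ev \<phi> N w $$ (k, s)))"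
      by (simp add: lin_ext_def sum_product mult_ac)
    also have "\<dots> = (\<Sum>v\<in>supp f. \<Sum>w\<in>supp g. \<Sum>k<N. f v * g w * (ev \<phi> N v $$ (r, k) * ev \<phi> N w $$ (k, s)))"
      by (subst sum.swap, rule sum.cong[OF refl], rule sum.swap)
    also have "\<dots> = lin_ext (\<lambda>u. ev \<phi> N u $$ (r, s)) (conv f g)"
      unfolding lin_ext_conv[OF fin] app by (simp add: sum_distrib_left)
    finally show "free_lift \<phi> N (conv f g) $$ (r, s) = (free_lift \<phi> N f * free_lift \<phi> N g) $$ (r, s)"
      using rs by (simp add: free_lift_def)
  qed (auto simp: free_lift_def)
  show ?thesis
    unfolding k_algebra_hom_def
  proof (intro conjI ballI)
    show "free_lift \<phi> N \<one>\<^bsub>free_algebra K S\<^esub> = \<one>\<^bsub>mat_algebra N\<^esub>"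
      by (rule eq_matI) (auto simp: free_lift_def free_ops lin_ext_single ev_def)
    show "free_lift \<phi> N \<zero>\<^bsub>free_algebra K S\<^esub> = \<zero>\<^bsub>mat_algebra N\<^esub>"
      by (rule eq_matI) (auto simp: free_lift_def free_ops lin_ext_def)
  next
    fix f g assume fg: "f \<in> carrier (free_algebra K S)" "g \<in> carrier (free_algebra K S)"
    thus "free_lift \<phi> N (f \<otimes>\<^bsub>free_algebra K S\<^esub> g) = free_lift \<phi> N f \<otimes>\<^bsub>mat_algebra N\<^esub> free_lift \<phi> N g"
      using mult[of f g] by (simp add: free_mult) (auto simp: free_mem)
    show "free_lift \<phi> N (f \<oplus>\<^bsub>free_algebra K S\<^esub> g) = free_lift \<phi> N f \<oplus>\<^bsub>mat_algebra N\<^esub> free_lift \<phi> N g"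
      using fg by (intro eq_matI) (auto simp: free_lift_def free_ops lin_ext_add free_mem)
  next
    fix a f show "free_lift \<phi> N (a \<odot>\<^bsub>free_algebra K S\<^esub> f) = a \<odot>\<^bsub>mat_algebra N\<^esub> free_lift \<phi> N f"
      by (rule eq_matI) (auto simp: free_lift_def free_ops lin_ext_smult)
  qed (auto simp: free_lift_def)
qed

lemma free_lift_gen: "free_lift \<phi> N (free_gen K w) = \<phi> w"
proof -
  have "free_gen K w = (\<lambda>u. if u = [w] then 1 else 0)" by (simp add: free_gen_def fun_eq_iff)
  thus ?thesis using \<phi>[of w] by (intro eq_matI) (auto simp: free_lift_def lin_ext_single ev_def)
qed

end
end

lemma (in k_algebra) square_add:
  assumes "x \<in> carrier A" "y \<in> carrier A"
  shows "(x \<oplus>\<^bsub>A\<^esub> y) \<otimes>\<^bsub>A\<^esub> (x \<oplus>\<^bsub>A\<^esub> y) =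
    (x \<otimes>\<^bsub>A\<^esub> x \<oplus>\<^bsub>A\<^esub> y \<otimes>\<^bsub>A\<^esub> y) \<oplus>\<^bsub>A\<^esub> (x \<otimes>\<^bsub>A\<^esub> y \<oplus>\<^bsub>A\<^esub> y \<otimes>\<^bsub>A\<^esub> x)"
  using assms by (simp add: A.l_distr A.r_distr M.a_ac)

locale quadratic_space = complex_subfield K + W: vectorspace K W
  for K and W :: "(complex, 'w) module" +
  fixes F :: "'w \<Rightarrow> 'w \<Rightarrow> complex"
  assumes F_closed: "v \<in> carrier W \<Longrightarrow> w \<in> carrier W \<Longrightarrow> F v w \<in> carrier K"
    and F_sym: "v \<in> carrier W \<Longrightarrow> w \<in> carrier W \<Longrightarrow> F v w = F w v"
    and F_add: "u \<in> carrier W \<Longrightarrow> v \<in> carrier W \<Longrightarrow> w \<in> carrier W \<Longrightarrow> F (u \<oplus>\<^bsub>W\<^esub> v) w = F u w + F v w"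
    and F_smult: "a \<in> carrier K \<Longrightarrow> v \<in> carrier W \<Longrightarrow> w \<in> carrier W \<Longrightarrow> F (a \<odot>\<^bsub>W\<^esub> v) w = a * F v w"
begin

section \<open>The Clifford algebra as an iterated quotient of the free algebra\<close>

abbreviation "FA \<equiv> free_algebra K (carrier W)"
abbreviation "TA \<equiv> tensor_algebra K W"
abbreviation "CA \<equiv> clifford_algebra K W F"
abbreviation "fg \<equiv> free_gen K"

definition lin_rels where "lin_rels =
      {fg (v \<oplus>\<^bsub>W\<^esub> w) \<ominus>\<^bsub>FA\<^esub> (fg v \<oplus>\<^bsub>FA\<^esub> fg w) |v w. v \<in> carrier W \<and> w \<in> carrier W} \<union>
       {fg (a \<odot>\<^bsub>W\<^esub> w) \<ominus>\<^bsub>FA\<^esub> a \<odot>\<^bsub>FA\<^esub> fg w |a w. a \<in> carrier K \<and> w \<in> carrier W}"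

definition cliff_rels where "cliff_rels =
  {tensor_proj K W (fg w) \<otimes>\<^bsub>TA\<^esub> tensor_proj K W (fg w) \<ominus>\<^bsub>TA\<^esub> (F w w / 2) \<odot>\<^bsub>TA\<^esub> \<one>\<^bsub>TA\<^esub> |w. w \<in> carrier W}"

definition cl where "cl f = clifford_ideal K W F +>\<^bsub>TA\<^esub> tensor_proj K W f"

sublocale FA: k_algebra K FA by (rule free_k_algebra)

lemma fg_closed: "w \<in> carrier W \<Longrightarrow> fg w \<in> carrier FA"
  by (auto simp: free_mem free_gen_def)

lemma linearity_ideal_eq: "linearity_ideal K W = Idl\<^bsub>FA\<^esub> lin_rels"
  by (simp add: linearity_ideal_def lin_rels_def Let_def)

lemma lin_rels_closed: "lin_rels \<subseteq> carrier FA"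
  by (auto simp: lin_rels_def fg_closed)

lemma linearity_ideal: "ideal (linearity_ideal K W) FA"
  unfolding linearity_ideal_eq by (rule FA.A.genideal_ideal[OF lin_rels_closed])

sublocale TA: k_algebra K TA
  unfolding tensor_algebra_def by (rule FA.quotient_k_algebra(1)[OF linearity_ideal])

lemma tensor_proj_hom: "k_algebra_hom K FA TA (tensor_proj K W)"
  unfolding tensor_algebra_def tensor_proj_def[abs_def] by (rule FA.quotient_k_algebra(2)[OF linearity_ideal])

lemmas tensor_projD = k_algebra_homD[OF tensor_proj_hom]

lemma cliff_rels_closed: "cliff_rels \<subseteq> carrier TA"
  by (auto simp: cliff_rels_def tensor_projD fg_closed F_closed divide_closed)

lemma clifford_ideal_eq: "clifford_ideal K W F = Idl\<^bsub>TA\<^esub> cliff_rels"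
proof -
  have "inv\<^bsub>K\<^esub> (\<one>\<^bsub>K\<^esub> \<oplus>\<^bsub>K\<^esub> \<one>\<^bsub>K\<^esub>) \<otimes>\<^bsub>K\<^esub> F w w = F w w / 2" for w
  proof -
    have "inv\<^bsub>K\<^esub> 2 = inverse (2::complex)" by (rule m_inv_eq) auto
    thus ?thesis by simp
  qed
  thus ?thesis unfolding clifford_ideal_def cliff_rels_def Let_def by (simp only:)
qed

lemma clifford_ideal: "ideal (clifford_ideal K W F) TA"
  unfolding clifford_ideal_eq by (rule TA.A.genideal_ideal[OF cliff_rels_closed])

sublocale CA: k_algebra K CA
  unfolding clifford_algebra_def by (rule TA.quotient_k_algebra(1)[OF clifford_ideal])

lemma clifford_proj_hom: "k_algebra_hom K TA CA (\<lambda>x. clifford_ideal K W F +>\<^bsub>TA\<^esub> x)"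
  unfolding clifford_algebra_def by (rule TA.quotient_k_algebra(2)[OF clifford_ideal])

lemmas clifford_projD = k_algebra_homD[OF clifford_proj_hom]

lemma cl_hom: "k_algebra_hom K FA CA cl"
  unfolding k_algebra_hom_def cl_def by (auto simp: tensor_projD clifford_projD)

lemmas clD = k_algebra_homD[OF cl_hom]

section \<open>Clifford relations between images of vectors\<close>

definition gen where "gen w = cl (fg w)"

lemma gen_closed: "w \<in> carrier W \<Longrightarrow> gen w \<in> carrier CA"
  by (simp add: gen_def clD fg_closed)

lemma tensor_gen_eq:
  assumes "fg x \<ominus>\<^bsub>FA\<^esub> y \<in> lin_rels" "x \<in> carrier W" "y \<in> carrier FA"
  shows "tensor_proj K W (fg x) = tensor_proj K W y"
proof -
  have "fg x \<ominus>\<^bsub>FA\<^esub> y \<in> linearity_ideal K W"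
    unfolding linearity_ideal_eq using assms FA.A.genideal_self[OF lin_rels_closed] by blast
  thus ?thesis unfolding tensor_proj_def
    using FA.coset_eq_iff[OF linearity_ideal fg_closed assms(3)] assms by blast
qed

lemma gen_add:
  assumes "v \<in> carrier W" "w \<in> carrier W" shows "gen (v \<oplus>\<^bsub>W\<^esub> w) = gen v \<oplus>\<^bsub>CA\<^esub> gen w"
proof -
  have "tensor_proj K W (fg (v \<oplus>\<^bsub>W\<^esub> w)) = tensor_proj K W (fg v \<oplus>\<^bsub>FA\<^esub> fg w)"
    by (rule tensor_gen_eq) (use assms in \<open>auto simp: fg_closed lin_rels_def\<close>)
  hence "gen (v \<oplus>\<^bsub>W\<^esub> w) = cl (fg v \<oplus>\<^bsub>FA\<^esub> fg w)" by (simp add: gen_def cl_def)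
  thus ?thesis using assms by (simp add: clD fg_closed gen_def)
qed

lemma gen_smult:
  assumes "a \<in> carrier K" "w \<in> carrier W" shows "gen (a \<odot>\<^bsub>W\<^esub> w) = a \<odot>\<^bsub>CA\<^esub> gen w"
proof -
  have "tensor_proj K W (fg (a \<odot>\<^bsub>W\<^esub> w)) = tensor_proj K W (a \<odot>\<^bsub>FA\<^esub> fg w)"
    by (rule tensor_gen_eq) (use assms in \<open>auto simp: fg_closed lin_rels_def\<close>)
  hence "gen (a \<odot>\<^bsub>W\<^esub> w) = cl (a \<odot>\<^bsub>FA\<^esub> fg w)" by (simp add: gen_def cl_def)
  thus ?thesis using assms by (simp add: clD fg_closed gen_def)
qed

lemma gen_square:
  assumes w: "w \<in> carrier W" shows "gen w \<otimes>\<^bsub>CA\<^esub> gen w = (F w w / 2) \<odot>\<^bsub>CA\<^esub> \<one>\<^bsub>CA\<^esub>"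
proof -
  let ?p = "tensor_proj K W (fg w)"
  have p: "?p \<in> carrier TA" using w by (simp add: tensor_projD fg_closed)
  have F2: "F w w / 2 \<in> carrier K" using w by (auto simp: F_closed)
  have mem: "?p \<otimes>\<^bsub>TA\<^esub> ?p \<ominus>\<^bsub>TA\<^esub> (F w w / 2) \<odot>\<^bsub>TA\<^esub> \<one>\<^bsub>TA\<^esub> \<in> clifford_ideal K W F"
    unfolding clifford_ideal_eq using TA.A.genideal_self[OF cliff_rels_closed] w
    by (auto simp: cliff_rels_def)
  have "clifford_ideal K W F +>\<^bsub>TA\<^esub> (?p \<otimes>\<^bsub>TA\<^esub> ?p) = clifford_ideal K W F +>\<^bsub>TA\<^esub> ((F w w / 2) \<odot>\<^bsub>TA\<^esub> \<one>\<^bsub>TA\<^esub>)"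
    by (rule TA.coset_eq_iff[OF clifford_ideal, THEN iffD2, OF _ _ mem]) (use p F2 in simp_all)
  thus ?thesis using p F2 by (simp add: clifford_projD gen_def cl_def)
qed

text \<open>Polarisation: for orthogonal vectors the square of the sum is the sum of the squares, so
  the mixed products cancel.\<close>

lemma gen_polar:
  assumes v: "v \<in> carrier W" and w: "w \<in> carrier W" and 0: "F v w = 0"
  shows "gen v \<otimes>\<^bsub>CA\<^esub> gen w = \<ominus>\<^bsub>CA\<^esub> (gen w \<otimes>\<^bsub>CA\<^esub> gen v)"
proof -
  let ?s = "\<lambda>a. a \<odot>\<^bsub>CA\<^esub> \<one>\<^bsub>CA\<^esub>"
  note c = gen_closed[OF v] gen_closed[OF w]
  have K: "F v v / 2 \<in> carrier K" "F w w / 2 \<in> carrier K" using v w by (auto simp: F_closed)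
  have F1: "F w v = 0" using 0 F_sym v w by simp
  have "F (v \<oplus>\<^bsub>W\<^esub> w) (v \<oplus>\<^bsub>W\<^esub> w) = F v v + F w w"
    using v w F1 0 F_sym[of v "v \<oplus>\<^bsub>W\<^esub> w"] F_sym[of w "v \<oplus>\<^bsub>W\<^esub> w"] by (simp add: F_add)
  hence "gen (v \<oplus>\<^bsub>W\<^esub> w) \<otimes>\<^bsub>CA\<^esub> gen (v \<oplus>\<^bsub>W\<^esub> w) = ?s (F v v / 2) \<oplus>\<^bsub>CA\<^esub> ?s (F w w / 2)"
    using v w K CA.smult_l_distr[of "F v v / 2" "F w w / 2"] by (simp add: gen_square add_divide_distrib)
  also have "gen (v \<oplus>\<^bsub>W\<^esub> w) \<otimes>\<^bsub>CA\<^esub> gen (v \<oplus>\<^bsub>W\<^esub> w) =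
     (?s (F v v / 2) \<oplus>\<^bsub>CA\<^esub> ?s (F w w / 2)) \<oplus>\<^bsub>CA\<^esub> (gen v \<otimes>\<^bsub>CA\<^esub> gen w \<oplus>\<^bsub>CA\<^esub> gen w \<otimes>\<^bsub>CA\<^esub> gen v)"
    unfolding gen_add[OF v w] CA.square_add[OF c] gen_square[OF v] gen_square[OF w] ..
  finally have "gen v \<otimes>\<^bsub>CA\<^esub> gen w \<oplus>\<^bsub>CA\<^esub> gen w \<otimes>\<^bsub>CA\<^esub> gen v = \<zero>\<^bsub>CA\<^esub>"
    using c K by (simp add: CA.M.add.r_cancel_one)
  thus ?thesis using c by (simp add: CA.M.minus_equality)
qed

text \<open>The universal property, through the two quotients in turn: linearity of
  \<open>\<phi>\<close> kills the relations of the tensor algebra, the condition on squares those of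
  the Clifford algebra.\<close>

lemma clifford_lift:
  assumes \<phi>: "\<And>w. \<phi> w \<in> carrier_mat N N"
    and add: "\<And>v w. v \<in> carrier W \<Longrightarrow> w \<in> carrier W \<Longrightarrow> \<phi> (v \<oplus>\<^bsub>W\<^esub> w) = \<phi> v + \<phi> w"
    and smult: "\<And>a w. a \<in> carrier K \<Longrightarrow> w \<in> carrier W \<Longrightarrow> \<phi> (a \<odot>\<^bsub>W\<^esub> w) = a \<cdot>\<^sub>m \<phi> w"
    and square: "\<And>w. w \<in> carrier W \<Longrightarrow> \<phi> w * \<phi> w = (F w w / 2) \<cdot>\<^sub>m 1\<^sub>m N"
  shows "\<exists>\<Phi>. k_algebra_hom K CA (mat_algebra N) \<Phi> \<and> (\<forall>w\<in>carrier W. \<Phi> (gen w) = \<phi> w)"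
proof -
  interpret M: k_algebra K "mat_algebra N" by (rule mat_k_algebra)
  note h = free_lift_hom[where S = "carrier W", OF \<phi>]
  \<comment> \<open>The relations are differences, whereas \<open>k_algebra_hom\<close> speaks of
    sums and scalar multiples; a negative is therefore treated as the multiple by -1.\<close>
  have minus: "g (x \<ominus>\<^bsub>A\<^esub> y) = g x + - g y" "g y \<in> carrier_mat N N"
    if "k_algebra K A" "k_algebra_hom K A (mat_algebra N) g" "x \<in> carrier A" "y \<in> carrier A" for A :: "(complex, 'z) module" and g x y
  proof -
    interpret A: k_algebra K A by fact
    note gD = k_algebra_homD[OF that(2)]
    show gy: "g y \<in> carrier_mat N N" using gD(1) that by simp
    have "\<ominus>\<^bsub>A\<^esub> y = (\<ominus>\<^bsub>K\<^esub> \<one>\<^bsub>K\<^esub>) \<odot>\<^bsub>A\<^esub> y" using that A.smult_l_minus[of "\<one>\<^bsub>K\<^esub>" y] A.smult_one[of y] by simp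
    hence "g (\<ominus>\<^bsub>A\<^esub> y) = (- 1) \<cdot>\<^sub>m g y" using gD(6)[of "-1" y] that by (simp add: a_inv_eq uminus_closed)
    thus "g (x \<ominus>\<^bsub>A\<^esub> y) = g x + - g y" using gD(4)[of x "\<ominus>\<^bsub>A\<^esub> y"] that gy
      by (simp add: A.M.minus_eq) (auto intro!: eq_matI)
  qed
  have add_uminus_0: "A + - A = 0\<^sub>m N N" if "A \<in> carrier_mat N N" for A :: "complex mat"
    using that by (auto intro!: eq_matI)
  have "free_lift \<phi> N s = \<zero>\<^bsub>mat_algebra N\<^esub>" if "s \<in> lin_rels" for s
  proof -
    from that consider (add) v w where "s = fg (v \<oplus>\<^bsub>W\<^esub> w) \<ominus>\<^bsub>FA\<^esub> (fg v \<oplus>\<^bsub>FA\<^esub> fg w)" "v \<in> carrier W" "w \<in> carrier W"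
      | (smult) a w where "s = fg (a \<odot>\<^bsub>W\<^esub> w) \<ominus>\<^bsub>FA\<^esub> a \<odot>\<^bsub>FA\<^esub> fg w" "a \<in> carrier K" "w \<in> carrier W"
      unfolding lin_rels_def by blast
    thus ?thesis
    proof cases
      case add
      hence "free_lift \<phi> N s = \<phi> (v \<oplus>\<^bsub>W\<^esub> w) + - (\<phi> v + \<phi> w)"
        using k_algebra_homD(4)[OF h, of "fg v" "fg w"]
        by (simp add: minus[OF free_k_algebra h] fg_closed free_lift_gen[OF \<phi>])
      thus ?thesis using add \<phi> assms(2)[of v w] by (simp add: add_uminus_0)
    next
      case smult
      hence "free_lift \<phi> N s = \<phi> (a \<odot>\<^bsub>W\<^esub> w) + - (a \<cdot>\<^sub>m \<phi> w)"
        using k_algebra_homD(6)[OF h, of a "fg w"]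
        by (simp add: minus[OF free_k_algebra h] fg_closed free_lift_gen[OF \<phi>])
      thus ?thesis using smult \<phi> assms(3)[of a w] by (simp add: add_uminus_0)
    qed
  qed
  from FA.quotient_lift[OF mat_k_algebra h lin_rels_closed this]
  obtain h1 where h1: "k_algebra_hom K TA (mat_algebra N) h1"
    and h1_eq: "\<And>x. x \<in> carrier FA \<Longrightarrow> h1 (tensor_proj K W x) = free_lift \<phi> N x"
    unfolding tensor_algebra_def tensor_proj_def linearity_ideal_eq by blast
  have h1_gen: "h1 (tensor_proj K W (fg w)) = \<phi> w" if "w \<in> carrier W" for w
    using that by (simp add: h1_eq fg_closed free_lift_gen[OF \<phi>])
  have "h1 s = \<zero>\<^bsub>mat_algebra N\<^esub>" if s: "s \<in> cliff_rels" for s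
  proof -
    obtain w where w: "s = tensor_proj K W (fg w) \<otimes>\<^bsub>TA\<^esub> tensor_proj K W (fg w) \<ominus>\<^bsub>TA\<^esub> (F w w / 2) \<odot>\<^bsub>TA\<^esub> \<one>\<^bsub>TA\<^esub>"
      "w \<in> carrier W" using s unfolding cliff_rels_def by blast
    have F2: "F w w / 2 \<in> carrier K" using w by (auto simp: F_closed)
    have p: "tensor_proj K W (fg w) \<in> carrier TA" using w by (simp add: tensor_projD fg_closed)
    have "h1 s = \<phi> w * \<phi> w + - ((F w w / 2) \<cdot>\<^sub>m 1\<^sub>m N)"
      using w p F2 k_algebra_homD(5)[OF h1 p p] k_algebra_homD(6)[OF h1 F2, of "\<one>\<^bsub>TA\<^esub>"] k_algebra_homD(2)[OF h1]
      by (simp add: minus[OF TA.k_algebra_axioms h1] h1_gen)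
    thus ?thesis using w square by (simp add: add_uminus_0)
  qed
  from TA.quotient_lift[OF mat_k_algebra h1 cliff_rels_closed this]
  obtain h2 where h2: "k_algebra_hom K CA (mat_algebra N) h2"
    and h2_eq: "\<And>x. x \<in> carrier TA \<Longrightarrow> h2 (clifford_ideal K W F +>\<^bsub>TA\<^esub> x) = h1 x"
    unfolding clifford_algebra_def clifford_ideal_eq by blast
  have "h2 (gen w) = \<phi> w" if "w \<in> carrier W" for w
    using that by (simp add: gen_def cl_def h2_eq tensor_projD fg_closed h1_gen)
  with h2 show ?thesis by blast
qed

end

section \<open>Monomials in anticommuting elements\<close>

lemma even_card_sym_diff:
  assumes "finite S" "finite T"
  shows "even (card (sym_diff S T)) \<longleftrightarrow> (even (card S) \<longleftrightarrow> even (card T))"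
proof -
  have "card (sym_diff S T) = card (S - T) + card (T - S)"
    using assms by (intro card_Un_disjoint) auto
  moreover have "card S = card (S - T) + card (S \<inter> T)" "card T = card (T - S) + card (S \<inter> T)"
    using assms card_Diff_subset_Int[of S T] card_Diff_subset_Int[of T S] card_mono[of S "S \<inter> T"] card_mono[of T "S \<inter> T"]
    by (auto simp: Int_commute)
  ultimately show ?thesis by auto
qed

definition parity_subsets :: "nat \<Rightarrow> bool \<Rightarrow> nat set set"
  where "parity_subsets p par = {S. S \<subseteq> {..<p} \<and> even (card S) = par}"

lemma finite_parity_subsets [simp]: "finite (parity_subsets p par)"
  by (rule finite_subset[of _ "Pow {..<p}"]) (auto simp: parity_subsets_def)

text \<open>An even subset is determined by its part below \<open>p\<close>, since parity decides
  whether \<open>p\<close> belongs to it.\<close>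

lemma card_even_subsets: "card (parity_subsets (Suc p) True) = 2 ^ p"
proof -
  let ?f = "\<lambda>T. if even (card T) then T else insert p T"
  have "bij_betw (\<lambda>S. S - {p}) (parity_subsets (Suc p) True) (Pow {..<p})"
  proof (rule bij_betw_byWitness[where f' = ?f])
    show "\<forall>S\<in>parity_subsets (Suc p) True. ?f (S - {p}) = S"
    proof
      fix S assume "S \<in> parity_subsets (Suc p) True"
      hence "finite S" "even (card S)" by (auto simp: parity_subsets_def finite_subset)
      moreover from this have "odd (card (S - {p}))" if "p \<in> S"
        using that by (metis card.remove even_Suc)
      ultimately show "?f (S - {p}) = S"
        by (cases "p \<in> S") (simp_all add: insert_absorb del: card_Diff_insert)
    qed
    show "\<forall>T\<in>Pow {..<p}. ?f T - {p} = T" by auto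
    show "(\<lambda>S. S - {p}) ` parity_subsets (Suc p) True \<subseteq> Pow {..<p}"
      by (auto simp: parity_subsets_def less_Suc_eq)
    show "?f ` Pow {..<p} \<subseteq> parity_subsets (Suc p) True"
    proof
      fix S assume "S \<in> ?f ` Pow {..<p}"
      then obtain T where T: "T \<subseteq> {..<p}" "S = ?f T" by auto
      hence "finite T" "p \<notin> T" by (auto simp: finite_subset)
      thus "S \<in> parity_subsets (Suc p) True" using T by (auto simp: parity_subsets_def)
    qed
  qed
  from bij_betw_same_card[OF this] show ?thesis by (simp add: card_Pow)
qed

text \<open>Interpreted twice, for the basis vectors in the Clifford algebra and for the matrices
  representing them, so that the same calculus of monomials is available on both sides of the
  homomorphism.\<close>

locale anticommuting_family = k_algebra K A
  for K :: "('k, 'r) ring_scheme" and A :: "('k, 'a, 'm) module_scheme" +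
  fixes x :: "nat \<Rightarrow> 'a" and p :: nat and a :: "nat \<Rightarrow> 'k"
  assumes x_closed: "j < p \<Longrightarrow> x j \<in> carrier A"
    and a_closed: "j < p \<Longrightarrow> a j \<in> carrier K" and a_nonzero: "j < p \<Longrightarrow> a j \<noteq> \<zero>\<^bsub>K\<^esub>"
    and anticomm: "i < p \<Longrightarrow> j < p \<Longrightarrow> i \<noteq> j \<Longrightarrow> x i \<otimes>\<^bsub>A\<^esub> x j = \<ominus>\<^bsub>A\<^esub> (x j \<otimes>\<^bsub>A\<^esub> x i)"
    and square: "j < p \<Longrightarrow> x j \<otimes>\<^bsub>A\<^esub> x j = a j \<odot>\<^bsub>A\<^esub> \<one>\<^bsub>A\<^esub>"
begin

definition monom_list where "monom_list xs = foldr (\<lambda>j y. x j \<otimes>\<^bsub>A\<^esub> y) xs \<one>\<^bsub>A\<^esub>"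
definition monom where "monom S = monom_list (sorted_list_of_set S)"

lemma monom_list_simps [simp]:
  "monom_list [] = \<one>\<^bsub>A\<^esub>" "monom_list (j # xs) = x j \<otimes>\<^bsub>A\<^esub> monom_list xs"
  by (simp_all add: monom_list_def)

lemma monom_list_closed: "set xs \<subseteq> {..<p} \<Longrightarrow> monom_list xs \<in> carrier A"
  by (induction xs) (auto simp: x_closed)

lemma monom_closed: "S \<subseteq> {..<p} \<Longrightarrow> monom S \<in> carrier A"
  unfolding monom_def by (rule monom_list_closed) (auto simp: finite_subset)

lemma monom_empty [simp]: "monom {} = \<one>\<^bsub>A\<^esub>" by (simp add: monom_def)

text \<open>Insertion into a sorted product: passing a smaller index costs a sign, and meeting
  \<open>j\<close> itself replaces two factors by the nonzero scalar \<open>a j\<close>. Products of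
  monomials are thus monomials up to a nonzero scalar, with index sets combining by symmetric
  difference.\<close>

lemma mult_monom_list_sorted:
  assumes "sorted_wrt (<) xs" "set xs \<subseteq> {..<p}" "j < p"
  shows "\<exists>b ys. b \<in> carrier K \<and> b \<noteq> \<zero>\<^bsub>K\<^esub> \<and> sorted_wrt (<) ys \<and> set ys = sym_diff (set xs) {j} \<and>
    x j \<otimes>\<^bsub>A\<^esub> monom_list xs = b \<odot>\<^bsub>A\<^esub> monom_list ys"
  using assms
proof (induction xs)
  case Nil
  thus ?case using x_closed by (intro exI[of _ "\<one>\<^bsub>K\<^esub>"] exI[of _ "[j]"]) auto
next
  case (Cons i xs)
  have ip: "i < p" and xsp: "set xs \<subseteq> {..<p}" and srt: "sorted_wrt (<) xs" "\<forall>k\<in>set xs. i < k"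
    using Cons.prems by auto
  note c = x_closed[OF ip] x_closed[OF \<open>j < p\<close>] monom_list_closed[OF xsp]
  consider "j < i" | "j = i" | "i < j" by linarith
  thus ?case
  proof cases
    case 1
    thus ?thesis using Cons.prems c srt
      by (intro exI[of _ "\<one>\<^bsub>K\<^esub>"] exI[of _ "j # i # xs"]) auto
  next
    case 2
    have "x i \<otimes>\<^bsub>A\<^esub> (x i \<otimes>\<^bsub>A\<^esub> monom_list xs) = a i \<odot>\<^bsub>A\<^esub> monom_list xs"
      using c ip by (simp add: square smult_mult_left a_closed flip: A.m_assoc)
    thus ?thesis using 2 srt ip a_closed a_nonzero
      by (intro exI[of _ "a i"] exI[of _ xs]) auto
  next
    case 3
    obtain b ys where b: "b \<in> carrier K" "b \<noteq> \<zero>\<^bsub>K\<^esub>" "sorted_wrt (<) ys" "set ys = sym_diff (set xs) {j}"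
      "x j \<otimes>\<^bsub>A\<^esub> monom_list xs = b \<odot>\<^bsub>A\<^esub> monom_list ys"
      using Cons.IH[OF srt(1) xsp \<open>j < p\<close>] by blast
    have ysp: "set ys \<subseteq> {..<p}" using b(4) xsp \<open>j < p\<close> by auto
    note c' = monom_list_closed[OF ysp]
    have "x j \<otimes>\<^bsub>A\<^esub> (x i \<otimes>\<^bsub>A\<^esub> monom_list xs) = (x j \<otimes>\<^bsub>A\<^esub> x i) \<otimes>\<^bsub>A\<^esub> monom_list xs"
      using c by (simp add: A.m_assoc)
    also have "\<dots> = \<ominus>\<^bsub>A\<^esub> (x i \<otimes>\<^bsub>A\<^esub> (x j \<otimes>\<^bsub>A\<^esub> monom_list xs))"
      using c 3 ip \<open>j < p\<close> by (simp add: anticomm[of j i] A.l_minus A.m_assoc)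
    also have "\<dots> = (\<ominus>\<^bsub>K\<^esub> b) \<odot>\<^bsub>A\<^esub> monom_list (i # ys)"
      using c c' b by (simp add: smult_mult_right smult_l_minus)
    finally have eq: "x j \<otimes>\<^bsub>A\<^esub> monom_list (i # xs) = (\<ominus>\<^bsub>K\<^esub> b) \<odot>\<^bsub>A\<^esub> monom_list (i # ys)" by simp
    have "\<ominus>\<^bsub>K\<^esub> b \<noteq> \<zero>\<^bsub>K\<^esub>" using b by (simp add: add.inv_eq_1_iff)
    moreover have "sorted_wrt (<) (i # ys)" using b srt 3 by auto
    moreover have "set (i # ys) = sym_diff (set (i # xs)) {j}" using b 3 srt by auto
    moreover have "\<ominus>\<^bsub>K\<^esub> b \<in> carrier K" using b by simp
    ultimately show ?thesis using eq by blast
  qed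
qed

lemma mult_monom:
  assumes S: "S \<subseteq> {..<p}" and j: "j < p"
  shows "\<exists>b. b \<in> carrier K \<and> b \<noteq> \<zero>\<^bsub>K\<^esub> \<and> x j \<otimes>\<^bsub>A\<^esub> monom S = b \<odot>\<^bsub>A\<^esub> monom (sym_diff S {j})"
proof -
  have fin: "finite S" using S by (rule finite_subset) simp
  have "sorted_wrt (<) (sorted_list_of_set S)" "set (sorted_list_of_set S) \<subseteq> {..<p}" using fin S by auto
  from mult_monom_list_sorted[OF this j] obtain b ys where b: "b \<in> carrier K" "b \<noteq> \<zero>\<^bsub>K\<^esub>"
    "sorted_wrt (<) ys" "set ys = sym_diff S {j}" "x j \<otimes>\<^bsub>A\<^esub> monom S = b \<odot>\<^bsub>A\<^esub> monom_list ys"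
    using fin by (auto simp: monom_def)
  have "ys = sorted_list_of_set (sym_diff S {j})"
    using b(3,4) by (metis sorted_list_of_set.idem_if_sorted_distinct strict_sorted_iff)
  thus ?thesis using b by (auto simp: monom_def)
qed

lemma monom_list_mult_monom:
  assumes "T \<subseteq> {..<p}" "set xs \<subseteq> {..<p}" "distinct xs"
  shows "\<exists>b. b \<in> carrier K \<and> b \<noteq> \<zero>\<^bsub>K\<^esub> \<and> monom_list xs \<otimes>\<^bsub>A\<^esub> monom T = b \<odot>\<^bsub>A\<^esub> monom (sym_diff (set xs) T)"
  using assms(2,3)
proof (induction xs)
  case Nil
  show ?case using monom_closed[OF assms(1)] by (intro exI[of _ "\<one>\<^bsub>K\<^esub>"]) auto
next
  case (Cons j xs)
  then obtain b where b: "b \<in> carrier K" "b \<noteq> \<zero>\<^bsub>K\<^esub>"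
    "monom_list xs \<otimes>\<^bsub>A\<^esub> monom T = b \<odot>\<^bsub>A\<^esub> monom (sym_diff (set xs) T)" by auto
  have j: "j < p" and U: "sym_diff (set xs) T \<subseteq> {..<p}" using Cons.prems assms by auto
  from mult_monom[OF U j] obtain b' where b': "b' \<in> carrier K" "b' \<noteq> \<zero>\<^bsub>K\<^esub>"
    "x j \<otimes>\<^bsub>A\<^esub> monom (sym_diff (set xs) T) = b' \<odot>\<^bsub>A\<^esub> monom (sym_diff (sym_diff (set xs) T) {j})" by blast
  have eq: "sym_diff (sym_diff (set xs) T) {j} = sym_diff (set (j # xs)) T" using Cons.prems by auto
  have "sym_diff (set (j # xs)) T \<subseteq> {..<p}" using Cons.prems assms by auto
  note c = monom_closed[OF assms(1)] monom_closed[OF U] monom_closed[OF this] x_closed[OF j]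
  have "monom_list (j # xs) \<otimes>\<^bsub>A\<^esub> monom T = x j \<otimes>\<^bsub>A\<^esub> (monom_list xs \<otimes>\<^bsub>A\<^esub> monom T)"
    using c monom_list_closed[of xs] Cons.prems by (simp add: A.m_assoc)
  also have "\<dots> = (b \<otimes>\<^bsub>K\<^esub> b') \<odot>\<^bsub>A\<^esub> monom (sym_diff (set (j # xs)) T)"
    using b b' c unfolding eq by (simp add: smult_mult_right smult_assoc1)
  finally show ?case using b b' by (metis m_closed integral)
qed

lemma monom_mult:
  assumes "S \<subseteq> {..<p}" "T \<subseteq> {..<p}"
  shows "\<exists>b. b \<in> carrier K \<and> b \<noteq> \<zero>\<^bsub>K\<^esub> \<and> monom S \<otimes>\<^bsub>A\<^esub> monom T = b \<odot>\<^bsub>A\<^esub> monom (sym_diff S T)"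
proof -
  have "finite S" using assms by (auto intro: finite_subset)
  thus ?thesis using monom_list_mult_monom[of T "sorted_list_of_set S"] assms by (simp add: monom_def)
qed

lemma commute_monom_list:
  assumes "set xs \<subseteq> {..<p}" "j < p"
  shows "x j \<otimes>\<^bsub>A\<^esub> monom_list xs = (if even (length (filter (\<lambda>i. i \<noteq> j) xs)) then monom_list xs \<otimes>\<^bsub>A\<^esub> x j
    else \<ominus>\<^bsub>A\<^esub> (monom_list xs \<otimes>\<^bsub>A\<^esub> x j))"
  using assms(1)
proof (induction xs)
  case Nil
  thus ?case using x_closed[OF assms(2)] by simp
next
  case (Cons i xs)
  have i: "i < p" and xs: "set xs \<subseteq> {..<p}" using Cons.prems by auto
  note c = x_closed[OF i] x_closed[OF assms(2)] monom_list_closed[OF xs]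
  have 1: "x j \<otimes>\<^bsub>A\<^esub> monom_list (i # xs) = (x j \<otimes>\<^bsub>A\<^esub> x i) \<otimes>\<^bsub>A\<^esub> monom_list xs" using c by (simp add: A.m_assoc)
  have 2: "x i \<otimes>\<^bsub>A\<^esub> (x j \<otimes>\<^bsub>A\<^esub> monom_list xs) = (if even (length (filter (\<lambda>i. i \<noteq> j) xs)) then monom_list (i # xs) \<otimes>\<^bsub>A\<^esub> x j
    else \<ominus>\<^bsub>A\<^esub> (monom_list (i # xs) \<otimes>\<^bsub>A\<^esub> x j))"
    using Cons.IH[OF xs] c by (simp add: A.m_assoc A.r_minus)
  show ?case
  proof (cases "i = j")
    case True
    thus ?thesis using 2 by simp
  next
    case False
    have "x j \<otimes>\<^bsub>A\<^esub> monom_list (i # xs) = \<ominus>\<^bsub>A\<^esub> (x i \<otimes>\<^bsub>A\<^esub> (x j \<otimes>\<^bsub>A\<^esub> monom_list xs))"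
      unfolding 1 using c False i assms(2) by (simp add: anticomm[of j i] A.l_minus A.m_assoc)
    thus ?thesis unfolding 2 using False c by simp
  qed
qed

text \<open>On its way through the monomial \<open>x j\<close> meets one equal factor and
  \<open>card S - 1\<close> others, an odd number of sign changes.\<close>

lemma anticommute_monom:
  assumes S: "S \<subseteq> {..<p}" "even (card S)" "j \<in> S"
  shows "x j \<otimes>\<^bsub>A\<^esub> monom S = \<ominus>\<^bsub>A\<^esub> (monom S \<otimes>\<^bsub>A\<^esub> x j)"
proof -
  have fin: "finite S" using S by (auto intro: finite_subset)
  let ?xs = "sorted_list_of_set S"
  have "length (filter (\<lambda>i. i \<noteq> j) ?xs) = card (S - {j})"
    using fin distinct_card[of "filter (\<lambda>i. i \<noteq> j) ?xs"] by (simp add: set_diff_eq)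
  hence "odd (length (filter (\<lambda>i. i \<noteq> j) ?xs))" using S fin by (simp add: card_gt_0_iff) auto
  thus ?thesis using commute_monom_list[of ?xs j] S fin by (auto simp: monom_def)
qed

section \<open>Spans of the monomials of one parity\<close>

definition monom_span where "monom_span par =
  {\<Oplus>\<^bsub>A\<^esub>S\<in>parity_subsets p par. c S \<odot>\<^bsub>A\<^esub> monom S |c. c \<in> parity_subsets p par \<rightarrow> carrier K}"

lemma parity_monom_closed: "S \<in> parity_subsets p par \<Longrightarrow> monom S \<in> carrier A"
  by (auto simp: parity_subsets_def intro: monom_closed)

lemma monom_span_closed: "d \<in> monom_span par \<Longrightarrow> d \<in> carrier A"
  by (auto simp: monom_span_def parity_monom_closed intro!: M.finsum_closed)

lemma monom_span_add: assumes "d \<in> monom_span par" "d' \<in> monom_span par" shows "d \<oplus>\<^bsub>A\<^esub> d' \<in> monom_span par"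
proof -
  obtain c c' where c: "d = (\<Oplus>\<^bsub>A\<^esub>S\<in>parity_subsets p par. c S \<odot>\<^bsub>A\<^esub> monom S)" "c \<in> parity_subsets p par \<rightarrow> carrier K"
    "d' = (\<Oplus>\<^bsub>A\<^esub>S\<in>parity_subsets p par. c' S \<odot>\<^bsub>A\<^esub> monom S)" "c' \<in> parity_subsets p par \<rightarrow> carrier K"
    using assms by (auto simp: monom_span_def)
  have "d \<oplus>\<^bsub>A\<^esub> d' = (\<Oplus>\<^bsub>A\<^esub>S\<in>parity_subsets p par. c S \<odot>\<^bsub>A\<^esub> monom S \<oplus>\<^bsub>A\<^esub> c' S \<odot>\<^bsub>A\<^esub> monom S)"
    unfolding c(1,3) by (rule M.finsum_addf[symmetric]) (use c parity_monom_closed in auto)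
  also have "\<dots> = (\<Oplus>\<^bsub>A\<^esub>S\<in>parity_subsets p par. (c S \<oplus>\<^bsub>K\<^esub> c' S) \<odot>\<^bsub>A\<^esub> monom S)"
    by (rule M.finsum_cong') (use c parity_monom_closed in \<open>auto simp: smult_l_distr Pi_def\<close>)
  finally show ?thesis unfolding monom_span_def using c by (intro CollectI exI[of _ "\<lambda>S. c S \<oplus>\<^bsub>K\<^esub> c' S"]) auto
qed

lemma monom_span_smult_monom:
  assumes b: "b \<in> carrier K" and S: "S \<in> parity_subsets p par"
  shows "b \<odot>\<^bsub>A\<^esub> monom S \<in> monom_span par"
proof -
  have "b \<odot>\<^bsub>A\<^esub> monom S = (\<Oplus>\<^bsub>A\<^esub>T\<in>parity_subsets p par. if S = T then b \<odot>\<^bsub>A\<^esub> monom T else \<zero>\<^bsub>A\<^esub>)"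
    by (rule M.finsum_singleton[symmetric]) (use S b parity_monom_closed in auto)
  also have "\<dots> = (\<Oplus>\<^bsub>A\<^esub>T\<in>parity_subsets p par. (if S = T then b else \<zero>\<^bsub>K\<^esub>) \<odot>\<^bsub>A\<^esub> monom T)"
    by (rule M.finsum_cong') (use b parity_monom_closed in auto)
  finally show ?thesis unfolding monom_span_def using b by (intro CollectI exI[of _ "\<lambda>T. if S = T then b else \<zero>\<^bsub>K\<^esub>"]) auto
qed

lemma monom_span_zero: "\<zero>\<^bsub>A\<^esub> \<in> monom_span par"
proof -
  have "(\<Oplus>\<^bsub>A\<^esub>S\<in>parity_subsets p par. \<zero>\<^bsub>K\<^esub> \<odot>\<^bsub>A\<^esub> monom S) = \<zero>\<^bsub>A\<^esub>"
    by (rule M.add.finprod_one_eqI) (use parity_monom_closed in auto)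
  thus ?thesis unfolding monom_span_def by (intro CollectI exI[of _ "\<lambda>_. \<zero>\<^bsub>K\<^esub>"]) auto
qed

lemma monom_span_finsum:
  assumes "finite I" "\<And>i. i \<in> I \<Longrightarrow> f i \<in> monom_span par" shows "(\<Oplus>\<^bsub>A\<^esub>i\<in>I. f i) \<in> monom_span par"
  using assms
proof (induction I rule: finite_induct)
  case (insert i I)
  thus ?case by (subst M.finsum_insert) (auto intro: monom_span_add monom_span_closed)
qed (simp add: monom_span_zero)

lemma monom_span_smult: assumes "d \<in> monom_span par" "b \<in> carrier K" shows "b \<odot>\<^bsub>A\<^esub> d \<in> monom_span par"
proof -
  obtain c where c: "d = (\<Oplus>\<^bsub>A\<^esub>S\<in>parity_subsets p par. c S \<odot>\<^bsub>A\<^esub> monom S)" "c \<in> parity_subsets p par \<rightarrow> carrier K"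
    using assms by (auto simp: monom_span_def)
  have "b \<odot>\<^bsub>A\<^esub> d = (\<Oplus>\<^bsub>A\<^esub>S\<in>parity_subsets p par. b \<odot>\<^bsub>A\<^esub> (c S \<odot>\<^bsub>A\<^esub> monom S))"
    unfolding c(1) by (rule finsum_smult) (use assms c parity_monom_closed in auto)
  also have "\<dots> \<in> monom_span par"
  proof (rule monom_span_finsum)
    fix S assume S: "S \<in> parity_subsets p par"
    hence "c S \<in> carrier K" using c by auto
    thus "b \<odot>\<^bsub>A\<^esub> (c S \<odot>\<^bsub>A\<^esub> monom S) \<in> monom_span par"
      using monom_span_smult_monom[of "b \<otimes>\<^bsub>K\<^esub> c S" S par] S assms parity_monom_closed[OF S] by (simp add: smult_assoc1)
  qed simp
  finally show ?thesis .
qed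

lemma mult_monom_span:
  assumes "d \<in> monom_span par" "j < p" shows "x j \<otimes>\<^bsub>A\<^esub> d \<in> monom_span (\<not> par)"
proof -
  obtain c where c: "d = (\<Oplus>\<^bsub>A\<^esub>S\<in>parity_subsets p par. c S \<odot>\<^bsub>A\<^esub> monom S)" "c \<in> parity_subsets p par \<rightarrow> carrier K"
    using assms by (auto simp: monom_span_def)
  have "x j \<otimes>\<^bsub>A\<^esub> d = (\<Oplus>\<^bsub>A\<^esub>S\<in>parity_subsets p par. x j \<otimes>\<^bsub>A\<^esub> (c S \<odot>\<^bsub>A\<^esub> monom S))"
    unfolding c(1) by (rule A.finsum_rdistr) (use assms c parity_monom_closed x_closed in auto)
  also have "\<dots> \<in> monom_span (\<not> par)"
  proof (rule monom_span_finsum)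
    fix S assume S: "S \<in> parity_subsets p par"
    hence cS: "c S \<in> carrier K" using c by auto
    have Sp: "S \<subseteq> {..<p}" and fin: "finite S" using S by (auto simp: parity_subsets_def intro: finite_subset)
    obtain b where b: "b \<in> carrier K" "x j \<otimes>\<^bsub>A\<^esub> monom S = b \<odot>\<^bsub>A\<^esub> monom (sym_diff S {j})"
      using mult_monom[OF Sp assms(2)] by blast
    have T: "sym_diff S {j} \<in> parity_subsets p (\<not> par)"
      using S assms(2) even_card_sym_diff[OF fin, of "{j}"] unfolding parity_subsets_def by auto
    have "x j \<otimes>\<^bsub>A\<^esub> (c S \<odot>\<^bsub>A\<^esub> monom S) = (c S \<otimes>\<^bsub>K\<^esub> b) \<odot>\<^bsub>A\<^esub> monom (sym_diff S {j})"
      using b cS x_closed[OF assms(2)] parity_monom_closed[OF S] parity_monom_closed[OF T]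
      by (simp add: smult_mult_right smult_assoc1)
    thus "x j \<otimes>\<^bsub>A\<^esub> (c S \<odot>\<^bsub>A\<^esub> monom S) \<in> monom_span (\<not> par)"
      using monom_span_smult_monom[OF _ T] b cS by simp
  qed simp
  finally show ?thesis .
qed

end

section \<open>Completeness of the monomials in matrix algebras\<close>

definition mtrace :: "complex mat \<Rightarrow> complex" where "mtrace M = (\<Sum>i<dim_row M. M $$ (i, i))"

lemma mtrace_mult:
  assumes "A \<in> carrier_mat N N" "B \<in> carrier_mat N N"
  shows "mtrace (A * B) = (\<Sum>i<N. \<Sum>k<N. A $$ (i, k) * B $$ (k, i))"
  using assms carrier_matD[OF assms(1)] carrier_matD[OF assms(2)]
  by (simp add: mtrace_def scalar_prod_def atLeast0LessThan)

lemma mtrace_comm: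
  assumes "A \<in> carrier_mat N N" "B \<in> carrier_mat N N"
  shows "mtrace (A * B) = mtrace (B * A)"
  unfolding mtrace_mult[OF assms] mtrace_mult[OF assms(2,1)] by (subst sum.swap) (simp add: mult.commute)

lemma mtrace_smult: "mtrace (b \<cdot>\<^sub>m A) = b * mtrace A" if "A \<in> carrier_mat N N"
  using that by (simp add: mtrace_def sum_distrib_left)

lemma mtrace_uminus: "mtrace (- A) = - mtrace A" if "A \<in> carrier_mat N N"
  using that by (simp add: mtrace_def sum_negf)

lemma sum_div_mod: "(\<Sum>k<N * N. f (k div N) (k mod N)) = (\<Sum>i<N. \<Sum>j<N. f i j :: complex)" for N :: nat
proof -
  have "(\<Sum>k<N * N. f (k div N) (k mod N)) = (\<Sum>(i, j)\<in>{..<N} \<times> {..<N}. f i j)"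
  proof (rule sum.reindex_bij_witness[of _ "\<lambda>(i, j). i * N + j" "\<lambda>k. (k div N, k mod N)"])
    fix k assume "k \<in> {..<N * N}"
    thus "(k div N, k mod N) \<in> {..<N} \<times> {..<N}"
      by (cases "N = 0") (auto simp: less_mult_imp_div_less)
  next
    fix ij assume ij: "ij \<in> {..<N} \<times> {..<N}"
    then obtain i j where "ij = (i, j)" "i < N" "j < N" by auto
    moreover have "i * N + j < Suc i * N" using \<open>j < N\<close> by simp
    moreover have "Suc i * N \<le> N * N" using \<open>i < N\<close> by (intro mult_right_mono) auto
    ultimately show "(case ij of (i, j) \<Rightarrow> i * N + j) \<in> {..<N * N}"
      "((case ij of (i, j) \<Rightarrow> i * N + j) div N, (case ij of (i, j) \<Rightarrow> i * N + j) mod N) = ij" by auto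
  qed auto
  thus ?thesis by (simp add: sum.cartesian_product)
qed

text \<open>The equation \<open>N * N = 2 ^ (p - 1)\<close> says that the even monomials are as many
  as the matrix entries. Rationality is asked of products of two matrices only, which leaves room
  for a common irrational factor.\<close>

locale gamma_system = complex_subfield K for K +
  fixes \<Gamma> :: "nat \<Rightarrow> complex mat" and N p :: nat and a :: "nat \<Rightarrow> complex"
  assumes N: "N > 0" and p: "N * N = 2 ^ (p - 1)" "p > 0"
    and gamma_closed: "j < p \<Longrightarrow> \<Gamma> j \<in> carrier_mat N N"
    and a_closed: "j < p \<Longrightarrow> a j \<in> carrier K" and a_nonzero: "j < p \<Longrightarrow> a j \<noteq> 0"
    and gamma_anticomm: "i < p \<Longrightarrow> j < p \<Longrightarrow> i \<noteq> j \<Longrightarrow> \<Gamma> i * \<Gamma> j = - (\<Gamma> j * \<Gamma> i)"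
    and gamma_square: "j < p \<Longrightarrow> \<Gamma> j * \<Gamma> j = a j \<cdot>\<^sub>m 1\<^sub>m N"
    and gamma_rational: "i < p \<Longrightarrow> j < p \<Longrightarrow> r < N \<Longrightarrow> s < N \<Longrightarrow> (\<Gamma> i * \<Gamma> j) $$ (r, s) \<in> carrier K"
begin

interpretation MA: k_algebra K "mat_algebra N" by (rule mat_k_algebra)

lemma mat_a_inv: "M \<in> carrier_mat N N \<Longrightarrow> \<ominus>\<^bsub>mat_algebra N\<^esub> M = - M"
  by (rule MA.M.minus_equality) auto

sublocale G: anticommuting_family K "mat_algebra N" \<Gamma> p a
proof unfold_locales
  fix i j assume ij: "i < p" "j < p" "i \<noteq> j"
  have "\<Gamma> j * \<Gamma> i \<in> carrier_mat N N" using ij by (intro mult_carrier_mat[OF gamma_closed gamma_closed])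
  thus "\<Gamma> i \<otimes>\<^bsub>mat_algebra N\<^esub> \<Gamma> j = \<ominus>\<^bsub>mat_algebra N\<^esub> (\<Gamma> j \<otimes>\<^bsub>mat_algebra N\<^esub> \<Gamma> i)"
    using gamma_anticomm[OF ij] by (simp add: mat_a_inv)
qed (simp_all add: gamma_closed a_closed a_nonzero gamma_square)

abbreviation "Ev \<equiv> parity_subsets p True"

lemma gm_closed: "S \<in> Ev \<Longrightarrow> G.monom S \<in> carrier_mat N N"
  using G.monom_closed[of S] by (auto simp: parity_subsets_def)

text \<open>Take \<open>j\<close> in \<open>S\<close>. The monomial anticommutes with
  \<open>\<Gamma> j\<close>, so conjugating it by \<open>\<Gamma> j\<close> changes its sign, while
  the trace is invariant under conjugation.\<close>

lemma mtrace_monom: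
  assumes S: "S \<in> Ev" and "S \<noteq> {}" shows "mtrace (G.monom S) = 0"
proof -
  obtain j where j: "j \<in> S" using assms by auto
  have jp: "j < p" and S': "S \<subseteq> {..<p}" "even (card S)" using S j by (auto simp: parity_subsets_def)
  let ?g = "\<Gamma> j" and ?m = "G.monom S"
  note c = gamma_closed[OF jp] gm_closed[OF S]
  have "?g * ?m = - (?m * ?g)"
    using G.anticommute_monom[OF S' j] mat_a_inv[OF mult_carrier_mat[OF c(2,1)]] by simp
  hence "(?g * ?m) * ?g = - ((?m * ?g) * ?g)" using c by simp
  also have "(?m * ?g) * ?g = a j \<cdot>\<^sub>m ?m"
    using c by (simp add: assoc_mult_mat[OF c(2,1,1)] gamma_square[OF jp] mult_smult_distrib[OF c(2) one_carrier_mat])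
  finally have "mtrace ((?g * ?m) * ?g) = - (a j * mtrace ?m)"
    using c by (simp add: mtrace_uminus[of _ N] mtrace_smult[of _ N])
  moreover have "mtrace ((?g * ?m) * ?g) = mtrace (?g * (?g * ?m))"
    using c by (intro mtrace_comm[of _ N]) auto
  moreover have "?g * (?g * ?m) = a j \<cdot>\<^sub>m ?m"
    using c by (simp add: gamma_square[OF jp] mult_smult_assoc_mat[OF one_carrier_mat c(2)] flip: assoc_mult_mat[OF c(1,1,2)])
  ultimately have "a j * mtrace ?m = - (a j * mtrace ?m)" using c by (simp add: mtrace_smult[of _ N])
  thus ?thesis using a_nonzero[OF jp] by simp
qed

text \<open>The product is a nonzero multiple of the monomial of the symmetric difference, whose
  trace vanishes unless this set is empty. The even monomials are therefore an orthogonal system of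
  anisotropic vectors for the trace form.\<close>

lemma gram:
  assumes S: "S \<in> Ev" and T: "T \<in> Ev"
  shows "mtrace (G.monom S * G.monom T) = 0 \<longleftrightarrow> S \<noteq> T"
proof -
  have S': "S \<subseteq> {..<p}" "T \<subseteq> {..<p}" "finite S" "finite T"
    using S T by (auto simp: parity_subsets_def intro: finite_subset)
  obtain b where b: "b \<noteq> 0" "G.monom S * G.monom T = b \<cdot>\<^sub>m G.monom (sym_diff S T)"
    using G.monom_mult[OF S'(1,2)] by auto
  have U: "sym_diff S T \<in> Ev"
    using S T even_card_sym_diff[OF S'(3,4)] by (auto simp: parity_subsets_def)
  have eq: "mtrace (G.monom S * G.monom T) = b * mtrace (G.monom (sym_diff S T))"
    using gm_closed[OF U] by (simp add: b mtrace_smult[of _ N])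
  show ?thesis
  proof (cases "S = T")
    case True
    have "mtrace (1\<^sub>m N) = of_nat N" by (simp add: mtrace_def)
    thus ?thesis using eq True b N by simp
  next
    case False
    hence "sym_diff S T \<noteq> {}" by auto
    thus ?thesis using eq mtrace_monom[OF U] False by simp
  qed
qed

text \<open>Factors are removed in pairs, because \<open>gamma_rational\<close> concerns products of
  two.\<close>

lemma monom_list_rational:
  "set xs \<subseteq> {..<p} \<Longrightarrow> even (length xs) \<Longrightarrow> r < N \<Longrightarrow> s < N \<Longrightarrow> G.monom_list xs $$ (r, s) \<in> carrier K"
proof (induction "length xs div 2" arbitrary: xs r s)
  case 0
  hence "xs = []" by (auto simp: div_eq_0_iff)
  thus ?case using 0 by simp
next
  case (Suc k)
  then obtain i j ys where xs: "xs = i # j # ys"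
    by (cases xs rule: remdups_adj.cases) auto
  have ij: "i < p" "j < p" and ys: "set ys \<subseteq> {..<p}" using Suc.prems xs by auto
  note c = gamma_closed[OF ij(1)] gamma_closed[OF ij(2)] G.monom_list_closed[OF ys, simplified]
  have "G.monom_list xs = (\<Gamma> i * \<Gamma> j) * G.monom_list ys"
    using c by (simp add: xs assoc_mult_mat[OF c])
  hence "G.monom_list xs $$ (r, s) = (\<Sum>k<N. (\<Gamma> i * \<Gamma> j) $$ (r, k) * G.monom_list ys $$ (k, s))"
    using carrier_matD[OF c(1)] carrier_matD[OF c(2)] carrier_matD[OF c(3)] Suc.prems
    by (simp add: index_mult_mat(1)[of r "\<Gamma> i * \<Gamma> j"] scalar_prod_def atLeast0LessThan del: index_mult_mat(1))
  also have "\<dots> \<in> carrier K"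
    using Suc.prems ij ys Suc.hyps xs by (auto intro!: sum_closed mult_closed gamma_rational)
  finally show ?case .
qed

lemma gm_rational: "S \<in> Ev \<Longrightarrow> r < N \<Longrightarrow> s < N \<Longrightarrow> G.monom S $$ (r, s) \<in> carrier K"
  unfolding G.monom_def by (rule monom_list_rational) (auto simp: parity_subsets_def finite_subset)

text \<open>The Fourier coefficient with respect to the trace form; the denominator is nonzero on
  \<open>Ev\<close> by \<open>gram\<close>.\<close>

definition coef where "coef S M = mtrace (G.monom S * M) / mtrace (G.monom S * G.monom S)"

lemma coef_rational:
  assumes S: "S \<in> Ev" and M: "M \<in> carrier_mat N N" "\<And>r s. r < N \<Longrightarrow> s < N \<Longrightarrow> M $$ (r, s) \<in> carrier K"
  shows "coef S M \<in> carrier K"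
  unfolding coef_def mtrace_mult[OF gm_closed[OF S] M(1)] mtrace_mult[OF gm_closed[OF S] gm_closed[OF S]]
  by (intro divide_closed sum_closed mult_closed) (use M gm_rational[OF S] in auto)

lemma coef_lincomb:
  assumes M: "M \<in> carrier_mat N N" and T: "T \<in> Ev"
    and eq: "\<And>r s. r < N \<Longrightarrow> s < N \<Longrightarrow> M $$ (r, s) = (\<Sum>S\<in>Ev. c S * G.monom S $$ (r, s))"
  shows "coef T M = c T"
proof -
  have "mtrace (G.monom T * M) = (\<Sum>i<N. \<Sum>k<N. \<Sum>S\<in>Ev. c S * (G.monom T $$ (i, k) * G.monom S $$ (k, i)))"
    unfolding mtrace_mult[OF gm_closed[OF T] M] by (intro sum.cong refl) (simp add: eq sum_distrib_left mult_ac)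
  also have "\<dots> = (\<Sum>i<N. \<Sum>S\<in>Ev. \<Sum>k<N. c S * (G.monom T $$ (i, k) * G.monom S $$ (k, i)))"
    by (rule sum.cong[OF refl], rule sum.swap)
  also have "\<dots> = (\<Sum>S\<in>Ev. \<Sum>i<N. \<Sum>k<N. c S * (G.monom T $$ (i, k) * G.monom S $$ (k, i)))"
    by (rule sum.swap)
  also have "\<dots> = (\<Sum>S\<in>Ev. c S * mtrace (G.monom T * G.monom S))"
    by (intro sum.cong refl) (simp add: mtrace_mult[OF gm_closed[OF T] gm_closed] sum_distrib_left)
  also have "\<dots> = (\<Sum>S\<in>Ev. if S = T then c T * mtrace (G.monom T * G.monom T) else 0)"
    by (intro sum.cong refl) (use gram[OF T] in auto)
  also have "\<dots> = c T * mtrace (G.monom T * G.monom T)" using T by simp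
  finally show ?thesis using gram[OF T T] by (simp add: coef_def)
qed

text \<open>The monomials are as many as the matrix entries, so orthogonality for the trace form,
  which says that a square matrix has a left inverse, also yields completeness.\<close>

lemma gm_complete:
  assumes M: "M \<in> carrier_mat N N" and rs: "r < N" "s < N"
  shows "M $$ (r, s) = (\<Sum>S\<in>Ev. coef S M * G.monom S $$ (r, s))"
proof -
  let ?n = "N * N"
  have "card Ev = ?n" using card_even_subsets[of "p - 1"] p by simp
  then obtain h where h: "bij_betw h {..<?n} Ev"
    using ex_bij_betw_nat_finite[of Ev] by (auto simp: atLeast0LessThan)
  have hE: "h i \<in> Ev" if "i < ?n" for i using h that by (auto simp: bij_betw_def)
  have h_inj: "h i = h j \<longleftrightarrow> i = j" if "i < ?n" "j < ?n" for i j
    using h that by (auto simp: bij_betw_def inj_on_def)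
  define P where "P = Matrix.mat ?n ?n (\<lambda>(i, k). G.monom (h i) $$ (k div N, k mod N))"
  \<comment> \<open>The trace of a product pairs the entry \<open>(r, s)\<close> with
    \<open>(s, r)\<close>, so row and column of the flattened index are exchanged here.\<close>
  define Q where "Q = Matrix.mat ?n ?n (\<lambda>(k, i). G.monom (h i) $$ (k mod N, k div N) / mtrace (G.monom (h i) * G.monom (h i)))"
  have "P * Q = 1\<^sub>m ?n"
  proof (rule eq_matI)
    fix i j assume "i < dim_row (1\<^sub>m ?n)" "j < dim_col (1\<^sub>m ?n)"
    hence ij: "i < ?n" "j < ?n" by auto
    have "(P * Q) $$ (i, j) = (\<Sum>k<?n. G.monom (h i) $$ (k div N, k mod N) * G.monom (h j) $$ (k mod N, k div N)) / mtrace (G.monom (h j) * G.monom (h j))"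
      using ij by (simp add: P_def Q_def scalar_prod_def atLeast0LessThan sum_divide_distrib)
    also have "\<dots> = mtrace (G.monom (h i) * G.monom (h j)) / mtrace (G.monom (h j) * G.monom (h j))"
      by (subst sum_div_mod) (simp add: mtrace_mult[OF gm_closed[OF hE[OF ij(1)]] gm_closed[OF hE[OF ij(2)]]])
    also have "\<dots> = 1\<^sub>m ?n $$ (i, j)"
      using gram[OF hE[OF ij(1)] hE[OF ij(2)]] gram[OF hE[OF ij(2)] hE[OF ij(2)]] ij h_inj[OF ij] by auto
    finally show "(P * Q) $$ (i, j) = 1\<^sub>m ?n $$ (i, j)" .
  qed (auto simp: P_def Q_def)
  hence QP: "Q * P = 1\<^sub>m ?n"
    by (rule mat_mult_left_right_inverse[rotated 2]) (auto simp: P_def Q_def)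
  define l where "l = r * N + s"
  have "l < Suc r * N" using rs by (simp add: l_def)
  moreover have "Suc r * N \<le> ?n" using rs by (intro mult_le_mono1) simp
  ultimately have l: "l < ?n" "l div N = r" "l mod N = s" using rs by (auto simp: l_def)
  have delta: "(\<Sum>i<?n. Q $$ (k, i) * P $$ (i, l)) = (if k = l then 1 else 0)" if "k < ?n" for k
  proof -
    have "(\<Sum>i<?n. Q $$ (k, i) * P $$ (i, l)) = (Q * P) $$ (k, l)"
      using that l by (simp add: P_def Q_def scalar_prod_def atLeast0LessThan)
    thus ?thesis using that l by (simp add: QP)
  qed
  have coef_h: "coef (h i) M = (\<Sum>k<?n. Q $$ (k, i) * M $$ (k div N, k mod N))" if i: "i < ?n" for i
  proof -
    have "coef (h i) M = (\<Sum>k<?n. G.monom (h i) $$ (k mod N, k div N) * M $$ (k div N, k mod N)) / mtrace (G.monom (h i) * G.monom (h i))"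
      unfolding coef_def mtrace_comm[OF gm_closed[OF hE[OF i]] M] mtrace_mult[OF M gm_closed[OF hE[OF i]]]
      by (subst sum_div_mod) (simp add: mult.commute)
    thus ?thesis using i by (simp add: Q_def sum_divide_distrib)
  qed
  have "(\<Sum>S\<in>Ev. coef S M * G.monom S $$ (r, s)) = (\<Sum>i<?n. coef (h i) M * G.monom (h i) $$ (r, s))"
    using sum.reindex_bij_betw[OF h, of "\<lambda>S. coef S M * G.monom S $$ (r, s)"] by simp
  also have "\<dots> = (\<Sum>i<?n. \<Sum>k<?n. M $$ (k div N, k mod N) * (Q $$ (k, i) * P $$ (i, l)))"
  proof (intro sum.cong refl)
    fix i assume "i \<in> {..<?n}"
    hence i: "i < ?n" by simp
    have "G.monom (h i) $$ (r, s) = P $$ (i, l)" using i l by (simp add: P_def)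
    thus "coef (h i) M * G.monom (h i) $$ (r, s) = (\<Sum>k<?n. M $$ (k div N, k mod N) * (Q $$ (k, i) * P $$ (i, l)))"
      by (simp add: coef_h[OF i] sum_distrib_left sum_distrib_right mult_ac)
  qed
  also have "\<dots> = (\<Sum>k<?n. M $$ (k div N, k mod N) * (\<Sum>i<?n. Q $$ (k, i) * P $$ (i, l)))"
    by (subst sum.swap) (simp add: sum_distrib_left)
  also have "\<dots> = (\<Sum>k<?n. if k = l then M $$ (r, s) else 0)"
    by (intro sum.cong refl) (auto simp: delta l)
  also have "\<dots> = M $$ (r, s)" using l by simp
  finally show ?thesis ..
qed

end

section \<open>The even Clifford algebra as a matrix algebra\<close>

lemma k_algebra_hom_finsum:
  assumes A: "k_algebra K A" and h: "k_algebra_hom K A (mat_algebra N) h"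
    and I: "finite I" "\<And>i. i \<in> I \<Longrightarrow> f i \<in> carrier A" and rs: "r < N" "s < N"
  shows "h (\<Oplus>\<^bsub>A\<^esub>i\<in>I. f i) $$ (r, s) = (\<Sum>i\<in>I. h (f i) $$ (r, s))"
  using I
proof (induction I rule: finite_induct)
  interpret A: k_algebra K A by fact
  note hD = k_algebra_homD[OF h]
  {
    case empty
    show ?case using rs by (simp add: hD)
  next
    case (insert i I)
    have c: "f i \<in> carrier A" "(\<Oplus>\<^bsub>A\<^esub>i\<in>I. f i) \<in> carrier A" using insert by (auto intro!: A.M.finsum_closed)
    have "(\<Oplus>\<^bsub>A\<^esub>i\<in>insert i I. f i) = f i \<oplus>\<^bsub>A\<^esub> (\<Oplus>\<^bsub>A\<^esub>i\<in>I. f i)"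
      using insert by (intro A.M.finsum_insert) auto
    hence "h (\<Oplus>\<^bsub>A\<^esub>i\<in>insert i I. f i) = h (f i) + h (\<Oplus>\<^bsub>A\<^esub>i\<in>I. f i)" using c by (simp add: hD)
    moreover have "h (\<Oplus>\<^bsub>A\<^esub>i\<in>I. f i) \<in> carrier_mat N N" using hD(1)[OF c(2)] by simp
    ultimately show ?case using rs insert by simp
  }
qed

definition (in complex_subfield) rational_mats :: "nat \<Rightarrow> complex mat set" where
  "rational_mats N = {M \<in> carrier_mat N N. \<forall>r<N. \<forall>s<N. M $$ (r, s) \<in> carrier K}"

lemma (in quadratic_space) F_finsum:
  assumes "finite I" "\<And>i. i \<in> I \<Longrightarrow> f i \<in> carrier W" "w \<in> carrier W"
  shows "F (\<Oplus>\<^bsub>W\<^esub>i\<in>I. f i) w = (\<Sum>i\<in>I. F (f i) w)"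
  using assms
proof (induction I rule: finite_induct)
  case empty
  have "F \<zero>\<^bsub>W\<^esub> w = F \<zero>\<^bsub>W\<^esub> w + F \<zero>\<^bsub>W\<^esub> w" using F_add[of "\<zero>\<^bsub>W\<^esub>" "\<zero>\<^bsub>W\<^esub>" w] empty by simp
  thus ?case by simp
next
  case (insert i I)
  have "(\<Oplus>\<^bsub>W\<^esub>i\<in>insert i I. f i) = f i \<oplus>\<^bsub>W\<^esub> (\<Oplus>\<^bsub>W\<^esub>i\<in>I. f i)"
    using insert by (intro W.M.finsum_insert) auto
  moreover have "(\<Oplus>\<^bsub>W\<^esub>i\<in>I. f i) \<in> carrier W" using insert by (auto intro!: W.M.finsum_closed)
  ultimately show ?case using insert by (simp add: F_add)
qed

text \<open>The matrix \<open>\<Gamma> j\<close> represents the orthogonal basis vector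
  \<open>e j\<close>. The factor one half in its square is the one in the Clifford relation.\<close>

locale clifford_rep = quadratic_space K W F + gamma_system K \<Gamma> N p "\<lambda>j. F (e j) (e j) / 2"
  for K and W :: "(complex, 'w) module" and F \<Gamma> N p and e :: "nat \<Rightarrow> 'w" +
  assumes e_closed: "j < p \<Longrightarrow> e j \<in> carrier W"
    and orthogonal: "i < p \<Longrightarrow> j < p \<Longrightarrow> i \<noteq> j \<Longrightarrow> F (e i) (e j) = 0"
    and expand: "w \<in> carrier W \<Longrightarrow> w = (\<Oplus>\<^bsub>W\<^esub>j\<in>{..<p}. (F w (e j) / F (e j) (e j)) \<odot>\<^bsub>W\<^esub> e j)"
begin

definition x where "x w j = F w (e j) / F (e j) (e j)"

lemma x_closed: "w \<in> carrier W \<Longrightarrow> j < p \<Longrightarrow> x w j \<in> carrier K"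
  by (auto simp: x_def F_closed e_closed)

lemma F_diag: assumes w: "w \<in> carrier W" shows "F w w = (\<Sum>j<p. x w j * x w j * F (e j) (e j))"
proof -
  have "F w w = F (\<Oplus>\<^bsub>W\<^esub>j\<in>{..<p}. x w j \<odot>\<^bsub>W\<^esub> e j) w" using expand[OF w] by (simp flip: x_def)
  also have "\<dots> = (\<Sum>j<p. F (x w j \<odot>\<^bsub>W\<^esub> e j) w)"
    by (rule F_finsum) (use w x_closed e_closed in auto)
  also have "\<dots> = (\<Sum>j<p. x w j * x w j * F (e j) (e j))"
  proof (intro sum.cong refl)
    fix j assume "j \<in> {..<p}"
    hence j: "j < p" by simp
    have "F (e j) w = x w j * F (e j) (e j)" using a_nonzero[OF j] F_sym[OF w e_closed[OF j]] by (simp add: x_def)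
    thus "F (x w j \<odot>\<^bsub>W\<^esub> e j) w = x w j * x w j * F (e j) (e j)"
      using w j by (simp add: F_smult x_closed e_closed)
  qed
  finally show ?thesis .
qed

definition \<phi> where "\<phi> w = Matrix.mat N N (\<lambda>(r, s). \<Sum>j<p. x w j * \<Gamma> j $$ (r, s))"

lemma \<phi>_square:
  assumes w: "w \<in> carrier W" shows "\<phi> w * \<phi> w = (F w w / 2) \<cdot>\<^sub>m 1\<^sub>m N"
proof (rule eq_matI)
  fix r s assume "r < dim_row ((F w w / 2) \<cdot>\<^sub>m 1\<^sub>m N)" "s < dim_col ((F w w / 2) \<cdot>\<^sub>m 1\<^sub>m N)"
  hence rs: "r < N" "s < N" by auto
  have prod: "(\<Gamma> i * \<Gamma> j) $$ (r, s) = (\<Sum>k<N. \<Gamma> i $$ (r, k) * \<Gamma> j $$ (k, s))" if "i < p" "j < p" for i j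
    using rs carrier_matD[OF gamma_closed[OF that(1)]] carrier_matD[OF gamma_closed[OF that(2)]]
    by (simp add: scalar_prod_def atLeast0LessThan)
  define T where "T = (\<Sum>i<p. \<Sum>j<p. x w i * x w j * (\<Gamma> i * \<Gamma> j) $$ (r, s))"
  have "(\<phi> w * \<phi> w) $$ (r, s) = (\<Sum>k<N. \<Sum>i<p. \<Sum>j<p. x w i * x w j * (\<Gamma> i $$ (r, k) * \<Gamma> j $$ (k, s)))"
    using rs by (simp add: \<phi>_def scalar_prod_def atLeast0LessThan, unfold sum_product, simp add: mult_ac)
  also have "\<dots> = (\<Sum>i<p. \<Sum>k<N. \<Sum>j<p. x w i * x w j * (\<Gamma> i $$ (r, k) * \<Gamma> j $$ (k, s)))"
    by (rule sum.swap)
  also have "\<dots> = (\<Sum>i<p. \<Sum>j<p. \<Sum>k<N. x w i * x w j * (\<Gamma> i $$ (r, k) * \<Gamma> j $$ (k, s)))"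
    by (rule sum.cong[OF refl], rule sum.swap)
  also have "\<dots> = T" unfolding T_def by (intro sum.cong refl) (simp add: prod sum_distrib_left)
  finally have 1: "(\<phi> w * \<phi> w) $$ (r, s) = T" .
  have "T = (\<Sum>i<p. \<Sum>j<p. x w i * x w j * (\<Gamma> j * \<Gamma> i) $$ (r, s))"
    unfolding T_def by (subst sum.swap) (simp add: mult_ac)
  \<comment> \<open>Adding the double sum to its transpose brings each product together with its
    reverse: off the diagonal they cancel, and on the diagonal twice the square gives
    \<open>F (e i) (e i)\<close>.\<close>
  hence "T + T = (\<Sum>i<p. \<Sum>j<p. x w i * x w j * ((\<Gamma> i * \<Gamma> j) $$ (r, s) + (\<Gamma> j * \<Gamma> i) $$ (r, s)))"
    by (simp add: T_def sum.distrib distrib_left)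
  also have "\<dots> = (\<Sum>i<p. \<Sum>j<p. if i = j then x w i * x w i * F (e i) (e i) * (if r = s then 1 else 0) else 0)"
  proof (intro sum.cong refl)
    fix i j assume "i \<in> {..<p}" "j \<in> {..<p}"
    hence ij: "i < p" "j < p" by auto
    have c: "\<Gamma> j * \<Gamma> i \<in> carrier_mat N N" by (rule mult_carrier_mat[OF gamma_closed gamma_closed]) (use ij in auto)
    show "x w i * x w j * ((\<Gamma> i * \<Gamma> j) $$ (r, s) + (\<Gamma> j * \<Gamma> i) $$ (r, s)) =
      (if i = j then x w i * x w i * F (e i) (e i) * (if r = s then 1 else 0) else 0)"
    proof (cases "i = j")
      case True
      thus ?thesis using rs gamma_square[OF ij(1)] by simp
    next
      case False
      have "(\<Gamma> i * \<Gamma> j) $$ (r, s) = - (\<Gamma> j * \<Gamma> i) $$ (r, s)"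
        unfolding gamma_anticomm[OF ij False] by (rule index_uminus_mat(1)) (use rs carrier_matD[OF c] in auto)
      thus ?thesis using False by simp
    qed
  qed
  also have "\<dots> = F w w * (if r = s then 1 else 0)" by (simp add: F_diag[OF w] sum_distrib_right)
  finally have "T = F w w / 2 * (if r = s then 1 else 0)" by (auto simp: field_simps)
  thus "(\<phi> w * \<phi> w) $$ (r, s) = ((F w w / 2) \<cdot>\<^sub>m 1\<^sub>m N) $$ (r, s)" using 1 rs by simp
qed (auto simp: \<phi>_def)

lemma exists_rep: "\<exists>\<Phi>. k_algebra_hom K CA (mat_algebra N) \<Phi> \<and> (\<forall>w\<in>carrier W. \<Phi> (gen w) = \<phi> w)"
proof (rule clifford_lift)
  fix v w assume "v \<in> carrier W" "w \<in> carrier W"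
  thus "\<phi> (v \<oplus>\<^bsub>W\<^esub> w) = \<phi> v + \<phi> w"
    by (intro eq_matI) (auto simp: \<phi>_def x_def F_add e_closed add_divide_distrib distrib_right sum.distrib)
next
  fix a w assume "a \<in> carrier K" "w \<in> carrier W"
  thus "\<phi> (a \<odot>\<^bsub>W\<^esub> w) = a \<cdot>\<^sub>m \<phi> w"
    by (intro eq_matI) (auto simp: \<phi>_def x_def F_smult e_closed sum_distrib_left mult.assoc)
qed (auto simp: \<phi>_square, simp add: \<phi>_def)

lemma \<phi>_e: assumes j: "j < p" shows "\<phi> (e j) = \<Gamma> j"
proof (rule eq_matI)
  fix r s assume "r < dim_row (\<Gamma> j)" "s < dim_col (\<Gamma> j)"
  hence rs: "r < N" "s < N" using gamma_closed[OF j] by auto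
  have "x (e j) i = (if i = j then 1 else 0)" if "i < p" for i
    using that j a_nonzero[OF j] orthogonal[of j i] by (auto simp: x_def)
  hence "(\<Sum>i<p. x (e j) i * \<Gamma> i $$ (r, s)) = (\<Sum>i<p. if i = j then \<Gamma> j $$ (r, s) else 0)"
    by (intro sum.cong) auto
  thus "\<phi> (e j) $$ (r, s) = \<Gamma> j $$ (r, s)" using rs j by (simp add: \<phi>_def)
qed (use gamma_closed[OF j] in \<open>auto simp: \<phi>_def\<close>)

sublocale E: anticommuting_family K CA "\<lambda>j. gen (e j)" p "\<lambda>j. F (e j) (e j) / 2"
proof unfold_locales
  fix i j assume ij: "i < p" "j < p" "i \<noteq> j"
  thus "gen (e i) \<otimes>\<^bsub>CA\<^esub> gen (e j) = \<ominus>\<^bsub>CA\<^esub> (gen (e j) \<otimes>\<^bsub>CA\<^esub> gen (e i))"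
    by (intro gen_polar e_closed orthogonal)
qed (use a_closed a_nonzero in \<open>simp_all add: gen_closed e_closed gen_square\<close>)

lemma gen_finsum:
  assumes "finite I" "\<And>i. i \<in> I \<Longrightarrow> f i \<in> carrier W"
  shows "gen (\<Oplus>\<^bsub>W\<^esub>i\<in>I. f i) = (\<Oplus>\<^bsub>CA\<^esub>i\<in>I. gen (f i))"
  using assms
proof (induction I rule: finite_induct)
  case empty
  have "gen \<zero>\<^bsub>W\<^esub> = gen (\<zero>\<^bsub>K\<^esub> \<odot>\<^bsub>W\<^esub> \<zero>\<^bsub>W\<^esub>)" using W.smult_l_null[of "\<zero>\<^bsub>W\<^esub>"] by simp
  also have "\<dots> = \<zero>\<^bsub>CA\<^esub>" using gen_smult[of 0 "\<zero>\<^bsub>W\<^esub>"] CA.smult_l_null[OF gen_closed[of "\<zero>\<^bsub>W\<^esub>"]] by simp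
  finally show ?case by simp
next
  case (insert i I)
  have "(\<Oplus>\<^bsub>W\<^esub>i\<in>insert i I. f i) = f i \<oplus>\<^bsub>W\<^esub> (\<Oplus>\<^bsub>W\<^esub>i\<in>I. f i)"
    using insert by (intro W.M.finsum_insert) auto
  moreover have "(\<Oplus>\<^bsub>W\<^esub>i\<in>I. f i) \<in> carrier W" using insert by (auto intro!: W.M.finsum_closed)
  moreover have "(\<Oplus>\<^bsub>CA\<^esub>i\<in>insert i I. gen (f i)) = gen (f i) \<oplus>\<^bsub>CA\<^esub> (\<Oplus>\<^bsub>CA\<^esub>i\<in>I. gen (f i))"
    using insert by (intro CA.M.finsum_insert) (auto simp: gen_closed)
  ultimately show ?case using insert by (simp add: gen_add)
qed

lemma gen_mult_span:
  assumes w: "w \<in> carrier W" and d: "d \<in> E.monom_span par"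
  shows "gen w \<otimes>\<^bsub>CA\<^esub> d \<in> E.monom_span (\<not> par)"
proof -
  have c: "d \<in> carrier CA" using d by (rule E.monom_span_closed)
  have "gen w = gen (\<Oplus>\<^bsub>W\<^esub>j\<in>{..<p}. x w j \<odot>\<^bsub>W\<^esub> e j)" using expand[OF w] by (simp flip: x_def)
  also have "\<dots> = (\<Oplus>\<^bsub>CA\<^esub>j\<in>{..<p}. gen (x w j \<odot>\<^bsub>W\<^esub> e j))"
    by (rule gen_finsum) (use w in \<open>auto simp: x_closed e_closed\<close>)
  finally have "gen w \<otimes>\<^bsub>CA\<^esub> d = (\<Oplus>\<^bsub>CA\<^esub>j\<in>{..<p}. gen (x w j \<odot>\<^bsub>W\<^esub> e j) \<otimes>\<^bsub>CA\<^esub> d)"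
    using CA.A.finsum_ldistr[of "{..<p}" d "\<lambda>j. gen (x w j \<odot>\<^bsub>W\<^esub> e j)"] c w
    by (simp add: Pi_def gen_closed x_closed e_closed)
  also have "\<dots> \<in> E.monom_span (\<not> par)"
  proof (rule E.monom_span_finsum)
    fix j assume "j \<in> {..<p}"
    hence j: "j < p" by simp
    have "gen (x w j \<odot>\<^bsub>W\<^esub> e j) \<otimes>\<^bsub>CA\<^esub> d = x w j \<odot>\<^bsub>CA\<^esub> (gen (e j) \<otimes>\<^bsub>CA\<^esub> d)"
      using w j c by (simp add: gen_smult x_closed e_closed CA.smult_mult_left gen_closed)
    thus "gen (x w j \<odot>\<^bsub>W\<^esub> e j) \<otimes>\<^bsub>CA\<^esub> d \<in> E.monom_span (\<not> par)"
      using E.monom_span_smult[OF E.mult_monom_span[OF d j] x_closed[OF w j]] by simp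
  qed simp
  finally show ?thesis .
qed

section \<open>Even elements as combinations of even monomials\<close>

definition single :: "'w list \<Rightarrow> 'w list \<Rightarrow> complex" where "single u = (\<lambda>v. if v = u then 1 else 0)"

lemma single_closed: "set u \<subseteq> carrier W \<Longrightarrow> single u \<in> carrier FA"
  by (auto simp: single_def free_mem)

lemma single_Nil: "single [] = \<one>\<^bsub>FA\<^esub>" by (simp add: single_def free_ops)

lemma single_Cons:
  assumes "w \<in> carrier W" "set u \<subseteq> carrier W" shows "single (w # u) = fg w \<otimes>\<^bsub>FA\<^esub> single u"
proof -
  have "conv (fg w) (single u) v = single (w # u) v" for v
  proof -
    have "conv (fg w) (single u) v = (\<Sum>j\<le>length v. if j = 1 then single (w # u) v else 0)"
      unfolding conv_def
    proof (intro sum.cong refl)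
      fix j assume j: "j \<in> {..length v}"
      show "fg w (take j v) * single u (drop j v) = (if j = 1 then single (w # u) v else 0)"
      proof (cases v)
        case Nil
        thus ?thesis using j by (auto simp: free_gen_def)
      next
        case (Cons y v')
        show ?thesis using j unfolding Cons
          by (cases j) (auto simp: free_gen_def single_def take_Cons' drop_Cons')
      qed
    qed
    also have "\<dots> = single (w # u) v" by (cases v; cases u) (auto simp: single_def)
    finally show ?thesis .
  qed
  thus ?thesis using free_mult[OF fg_closed[OF assms(1)] single_closed[OF assms(2)]] by (simp add: fun_eq_iff)
qed

lemma cl_single_span: "set u \<subseteq> carrier W \<Longrightarrow> cl (single u) \<in> E.monom_span (even (length u))"
proof (induction u)
  case Nil
  have "{} \<in> parity_subsets p True" by (simp add: parity_subsets_def)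
  from E.monom_span_smult_monom[OF one_closed this] CA.smult_one[OF CA.A.one_closed]
  show ?case by (simp add: single_Nil clD)
next
  case (Cons w u)
  have "cl (single (w # u)) = gen w \<otimes>\<^bsub>CA\<^esub> cl (single u)"
    using Cons.prems single_closed[of u] by (simp add: single_Cons clD fg_closed gen_def)
  thus ?case using gen_mult_span[of w "cl (single u)"] Cons by simp
qed

text \<open>Words are removed from the support one at a time; the larger set \<open>Z\<close> keeps
  the induction independent of the exact support.\<close>

lemma cl_span:
  assumes "finite Z"
  shows "f \<in> carrier FA \<Longrightarrow> supp f \<subseteq> Z \<Longrightarrow> (\<And>u. f u \<noteq> 0 \<Longrightarrow> even (length u) = par) \<Longrightarrow> cl f \<in> E.monom_span par"
  using assms
proof (induction Z arbitrary: f rule: finite_induct)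
  case empty
  hence "f = \<zero>\<^bsub>FA\<^esub>" by (auto simp: free_ops fun_eq_iff)
  thus ?case by (simp add: clD E.monom_span_zero)
next
  case (insert u Z)
  show ?case
  proof (cases "f u = 0")
    case True
    hence "supp f \<subseteq> Z" using insert.prems by auto
    thus ?thesis using insert by blast
  next
    case False
    have u: "set u \<subseteq> carrier W" "f u \<in> carrier K" "even (length u) = par"
      using insert.prems False by (auto simp: free_mem subset_iff)
    define g where "g = f(u := 0)"
    have "supp g \<subseteq> supp f" by (auto simp: g_def)
    hence g: "g \<in> carrier FA" "supp g \<subseteq> Z" "\<And>v. g v \<noteq> 0 \<Longrightarrow> even (length v) = par"
      using insert.prems by (auto simp: free_mem g_def image_subset_iff intro: finite_subset split: if_splits)
    have "f = f u \<odot>\<^bsub>FA\<^esub> single u \<oplus>\<^bsub>FA\<^esub> g" by (auto simp: free_ops single_def g_def fun_eq_iff)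
    hence "cl f = f u \<odot>\<^bsub>CA\<^esub> cl (single u) \<oplus>\<^bsub>CA\<^esub> cl g"
      using u g single_closed[OF u(1)] by (metis clD(4,6) FA.smult_closed)
    thus ?thesis using insert.IH[OF g] cl_single_span[OF u(1)] u
      by (auto intro: E.monom_span_add E.monom_span_smult)
  qed
qed

abbreviation "C0 \<equiv> even_clifford_algebra K W F"

definition even_free where "even_free = {f \<in> carrier FA. \<forall>u. odd (length u) \<longrightarrow> f u = 0}"

lemma C0_carrier_image: "carrier C0 = cl ` even_free"
  by (simp add: even_clifford_algebra_def tensor_even_def image_image cl_def[abs_def] even_free_def)

text \<open>The even part is defined as an image of even tensors. Its description by monomials in an
  orthogonal basis is what supplies coefficients, though not yet their uniqueness.\<close>

lemma C0_carrier: "carrier C0 = E.monom_span True"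
proof
  show "carrier C0 \<subseteq> E.monom_span True"
  proof
    fix d assume "d \<in> carrier C0"
    then obtain f where f: "f \<in> carrier FA" "\<And>u. odd (length u) \<Longrightarrow> f u = 0" "d = cl f"
      by (auto simp: C0_carrier_image even_free_def)
    have "finite (supp f)" using f by (simp add: free_mem)
    from cl_span[OF this f(1)] f show "d \<in> E.monom_span True" by auto
  qed
  have add: "y \<oplus>\<^bsub>CA\<^esub> z \<in> cl ` even_free" if yz: "y \<in> cl ` even_free" "z \<in> cl ` even_free" for y z
  proof -
    obtain f g where "y = cl f" "z = cl g" "f \<in> even_free" "g \<in> even_free" using yz by blast
    hence "y \<oplus>\<^bsub>CA\<^esub> z = cl (f \<oplus>\<^bsub>FA\<^esub> g)" and "f \<oplus>\<^bsub>FA\<^esub> g \<in> even_free"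
      by (simp_all add: even_free_def clD) (auto simp: free_ops intro: free_add_closed)
    thus ?thesis by blast
  qed
  have smult: "b \<odot>\<^bsub>CA\<^esub> y \<in> cl ` even_free" if b: "b \<in> carrier K" and y: "y \<in> cl ` even_free" for b y
  proof -
    obtain f where "y = cl f" "f \<in> even_free" using y by blast
    hence "b \<odot>\<^bsub>CA\<^esub> y = cl (b \<odot>\<^bsub>FA\<^esub> f)" and "b \<odot>\<^bsub>FA\<^esub> f \<in> even_free"
      using b by (simp_all add: even_free_def clD) (auto simp: free_ops intro: free_smult_closed)
    thus ?thesis by blast
  qed
  have zero: "\<zero>\<^bsub>CA\<^esub> \<in> cl ` even_free"
    by (rule image_eqI[where f = cl, OF clD(3)[symmetric]]) (use FA.M.zero_closed in \<open>auto simp: even_free_def free_ops\<close>)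
  have list: "E.monom_list xs = cl (single (map e xs)) \<and> set (map e xs) \<subseteq> carrier W" if "set xs \<subseteq> {..<p}" for xs
    using that
  proof (induction xs)
    case Nil
    show ?case by (simp add: single_Nil clD)
  next
    case (Cons j xs)
    thus ?case using single_closed[of "map e xs"] by (simp add: single_Cons e_closed clD fg_closed flip: gen_def)
  qed
  have monom: "E.monom S \<in> cl ` even_free" if S: "S \<in> parity_subsets p True" for S
  proof -
    have S': "finite S" "S \<subseteq> {..<p}" "even (card S)" using S by (auto simp: parity_subsets_def intro: finite_subset)
    let ?u = "map e (sorted_list_of_set S)"
    have *: "E.monom S = cl (single ?u)" "set ?u \<subseteq> carrier W"
      using list[of "sorted_list_of_set S"] S' by (auto simp: E.monom_def)
    have "length ?u = card S" by simp
    hence "single ?u \<in> even_free" using single_closed[OF *(2)] S' by (auto simp: even_free_def single_def)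
    thus ?thesis using * by blast
  qed
  have fin: "(\<Oplus>\<^bsub>CA\<^esub>S\<in>I. c S \<odot>\<^bsub>CA\<^esub> E.monom S) \<in> cl ` even_free"
    if "finite I" "I \<subseteq> parity_subsets p True" "c \<in> I \<rightarrow> carrier K" for I c
    using that
  proof (induction I rule: finite_induct)
    case (insert S I)
    have "(\<Oplus>\<^bsub>CA\<^esub>S\<in>insert S I. c S \<odot>\<^bsub>CA\<^esub> E.monom S) = c S \<odot>\<^bsub>CA\<^esub> E.monom S \<oplus>\<^bsub>CA\<^esub> (\<Oplus>\<^bsub>CA\<^esub>S\<in>I. c S \<odot>\<^bsub>CA\<^esub> E.monom S)"
      using insert by (intro CA.M.finsum_insert) (auto intro!: CA.smult_closed E.parity_monom_closed)
    thus ?case using insert by (auto intro!: add smult monom)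
  qed (simp add: zero)
  show "E.monom_span True \<subseteq> carrier C0"
    unfolding C0_carrier_image E.monom_span_def using fin[OF finite_parity_subsets] by blast
qed

lemma C0_k_algebra: "k_algebra K C0"
  unfolding even_clifford_algebra_def
proof (rule k_algebra_subalgebra[OF CA.k_algebra_axioms])
  let ?D = "(\<lambda>t. clifford_ideal K W F +>\<^bsub>TA\<^esub> t) ` tensor_even K W"
  \<comment> \<open>Two descriptions of the same set: as an image of even words it is closed under
    products, as a span it is closed under sums and scalars.\<close>
  have D: "?D = cl ` even_free" using C0_carrier_image by (simp add: even_clifford_algebra_def)
  have D': "?D = E.monom_span True" using C0_carrier by (simp add: even_clifford_algebra_def)
  show "?D \<subseteq> carrier CA" unfolding D' using E.monom_span_closed by blast
  show "\<zero>\<^bsub>CA\<^esub> \<in> ?D" unfolding D' by (rule E.monom_span_zero)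
  show "\<one>\<^bsub>CA\<^esub> \<in> ?D" unfolding D by (rule image_eqI[where f = cl, OF clD(2)[symmetric]]) (auto simp: even_free_def free_ops free_one_closed)
  show "y \<oplus>\<^bsub>CA\<^esub> z \<in> ?D" if "y \<in> ?D" "z \<in> ?D" for y z using that unfolding D' by (rule E.monom_span_add)
  show "b \<odot>\<^bsub>CA\<^esub> y \<in> ?D" if "b \<in> carrier K" "y \<in> ?D" for b y using that(2,1) unfolding D' by (rule E.monom_span_smult)
  show "y \<otimes>\<^bsub>CA\<^esub> z \<in> ?D" if yz: "y \<in> ?D" "z \<in> ?D" for y z
  proof -
    obtain f g where fg: "y = cl f" "z = cl g" "f \<in> even_free" "g \<in> even_free" using yz unfolding D by blast
    have "conv f g u = 0" if "odd (length u)" for u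
      unfolding conv_def
    proof (rule sum.neutral, rule ballI)
      fix j assume "j \<in> {..length u}"
      hence "odd (length (take j u)) \<or> odd (length (drop j u))" using that by (auto simp: min_def)
      thus "f (take j u) * g (drop j u) = 0" using fg by (auto simp: even_free_def)
    qed
    hence "conv f g \<in> even_free" using fg by (auto simp: even_free_def conv_closed)
    moreover have "y \<otimes>\<^bsub>CA\<^esub> z = cl (conv f g)"
      using fg clD(5)[of f g] free_mult[of f "carrier W" g] by (simp add: even_free_def)
    ultimately show ?thesis unfolding D by blast
  qed
qed

text \<open>Monomials go to monomials. The trace form recovers the coefficients from the image,
  which gives injectivity and with it the independence of the monomials in the Clifford algebra.
  Completeness with coefficients in \<open>K\<close> shows that every rational matrix is
  reached.\<close>

lemma even_clifford_iso:
  "\<exists>\<Phi>. k_algebra_hom K C0 (mat_algebra N) \<Phi> \<and> bij_betw \<Phi> (carrier C0) (rational_mats N)"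
proof -
  obtain \<Phi> where \<Phi>: "k_algebra_hom K CA (mat_algebra N) \<Phi>" and \<Phi>_gen: "\<And>w. w \<in> carrier W \<Longrightarrow> \<Phi> (gen w) = \<phi> w"
    using exists_rep by blast
  note hD = k_algebra_homD[OF \<Phi>]
  have list: "\<Phi> (E.monom_list xs) = G.monom_list xs" if "set xs \<subseteq> {..<p}" for xs
    using that
  proof (induction xs)
    case (Cons j xs)
    thus ?case using E.monom_list_closed[of xs] by (simp add: hD gen_closed e_closed \<Phi>_gen \<phi>_e)
  qed (simp add: hD)
  have monom: "\<Phi> (E.monom S) = G.monom S" if "S \<in> Ev" for S
  proof -
    have "finite S" "S \<subseteq> {..<p}" using that by (auto simp: parity_subsets_def intro: finite_subset)
    thus ?thesis using list[of "sorted_list_of_set S"] by (simp add: E.monom_def G.monom_def)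
  qed
  have span: "\<Phi> (\<Oplus>\<^bsub>CA\<^esub>S\<in>Ev. c S \<odot>\<^bsub>CA\<^esub> E.monom S) $$ (r, s) = (\<Sum>S\<in>Ev. c S * G.monom S $$ (r, s))"
    if c: "c \<in> Ev \<rightarrow> carrier K" and rs: "r < N" "s < N" for c r s
  proof -
    have "\<Phi> (\<Oplus>\<^bsub>CA\<^esub>S\<in>Ev. c S \<odot>\<^bsub>CA\<^esub> E.monom S) $$ (r, s) = (\<Sum>S\<in>Ev. \<Phi> (c S \<odot>\<^bsub>CA\<^esub> E.monom S) $$ (r, s))"
      by (rule k_algebra_hom_finsum[OF CA.k_algebra_axioms \<Phi> finite_parity_subsets _ rs])
        (use c in \<open>auto intro!: CA.smult_closed E.parity_monom_closed\<close>)
    also have "\<dots> = (\<Sum>S\<in>Ev. c S * G.monom S $$ (r, s))"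
    proof (intro sum.cong refl)
      fix S assume S: "S \<in> Ev"
      have "c S \<in> carrier K" using c S by auto
      thus "\<Phi> (c S \<odot>\<^bsub>CA\<^esub> E.monom S) $$ (r, s) = c S * G.monom S $$ (r, s)"
        using hD(6)[of "c S" "E.monom S"] E.parity_monom_closed[OF S] monom[OF S] gm_closed[OF S] rs by auto
    qed
    finally show ?thesis .
  qed
  have closed: "\<Phi> d \<in> carrier_mat N N" if "d \<in> E.monom_span True" for d
    using hD(1)[OF E.monom_span_closed[OF that]] by simp
  have coef: "coef T (\<Phi> (\<Oplus>\<^bsub>CA\<^esub>S\<in>Ev. c S \<odot>\<^bsub>CA\<^esub> E.monom S)) = c T" if c: "c \<in> Ev \<rightarrow> carrier K" and T: "T \<in> Ev" for c T
    by (rule coef_lincomb[OF closed T span[OF c]]) (use c in \<open>auto simp: E.monom_span_def\<close>)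
  have "inj_on \<Phi> (carrier C0)"
    unfolding C0_carrier
  proof (rule inj_onI)
    fix d d' assume d: "d \<in> E.monom_span True" "d' \<in> E.monom_span True" and eq: "\<Phi> d = \<Phi> d'"
    obtain c c' where c: "d = (\<Oplus>\<^bsub>CA\<^esub>S\<in>Ev. c S \<odot>\<^bsub>CA\<^esub> E.monom S)" "c \<in> Ev \<rightarrow> carrier K"
      "d' = (\<Oplus>\<^bsub>CA\<^esub>S\<in>Ev. c' S \<odot>\<^bsub>CA\<^esub> E.monom S)" "c' \<in> Ev \<rightarrow> carrier K"
      using d unfolding E.monom_span_def by blast
    have "c T = c' T" if T: "T \<in> Ev" for T using coef[OF c(2) T] coef[OF c(4) T] eq c(1,3) by simp
    thus "d = d'" unfolding c(1,3)
      by (intro CA.M.finsum_cong') (use c in \<open>auto intro!: CA.smult_closed E.parity_monom_closed\<close>)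
  qed
  moreover have "\<Phi> ` carrier C0 = rational_mats N"
  proof
    show "\<Phi> ` carrier C0 \<subseteq> rational_mats N"
    proof
      fix M assume "M \<in> \<Phi> ` carrier C0"
      then obtain d where d: "M = \<Phi> d" "d \<in> E.monom_span True" by (auto simp: C0_carrier)
      obtain c where c: "d = (\<Oplus>\<^bsub>CA\<^esub>S\<in>Ev. c S \<odot>\<^bsub>CA\<^esub> E.monom S)" "c \<in> Ev \<rightarrow> carrier K"
        using d unfolding E.monom_span_def by blast
      have "M $$ (r, s) \<in> carrier K" if "r < N" "s < N" for r s
        unfolding d(1) c(1) span[OF c(2) that]
        by (intro sum_closed mult_closed) (use c that gm_rational in auto)
      thus "M \<in> rational_mats N" using closed[OF d(2)] d by (simp add: rational_mats_def)
    qed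
    show "rational_mats N \<subseteq> \<Phi> ` carrier C0"
    proof
      fix M assume M: "M \<in> rational_mats N"
      define c where "c S = coef S M" for S
      have c: "c \<in> Ev \<rightarrow> carrier K" using M by (auto simp: c_def rational_mats_def intro!: coef_rational)
      let ?d = "\<Oplus>\<^bsub>CA\<^esub>S\<in>Ev. c S \<odot>\<^bsub>CA\<^esub> E.monom S"
      have d: "?d \<in> E.monom_span True" using c unfolding E.monom_span_def by blast
      have "M = \<Phi> ?d"
      proof (rule eq_matI)
        fix r s assume "r < dim_row (\<Phi> ?d)" "s < dim_col (\<Phi> ?d)"
        hence rs: "r < N" "s < N" using closed[OF d] by auto
        have "M $$ (r, s) = (\<Sum>S\<in>Ev. c S * G.monom S $$ (r, s))"
          unfolding c_def using M by (intro gm_complete rs) (simp add: rational_mats_def)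
        thus "M $$ (r, s) = \<Phi> ?d $$ (r, s)" by (simp only: span[OF c rs])
      qed (use M closed[OF d] in \<open>auto simp: rational_mats_def\<close>)
      thus "M \<in> \<Phi> ` carrier C0" using d by (auto simp: C0_carrier)
    qed
  qed
  ultimately have "bij_betw \<Phi> (carrier C0) (rational_mats N)" by (simp add: bij_betw_def)
  moreover have "k_algebra_hom K C0 (mat_algebra N) \<Phi>"
  proof -
    have "carrier C0 \<subseteq> carrier CA" using C0_carrier E.monom_span_closed by blast
    thus ?thesis using \<Phi> unfolding k_algebra_hom_def even_clifford_algebra_def by (auto simp: Pi_def subset_iff)
  qed
  ultimately show ?thesis by blast
qed

end

section \<open>Anticommuting matrices from the octonions\<close>

definition kron :: "complex mat \<Rightarrow> complex mat \<Rightarrow> complex mat" where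
  "kron A B = Matrix.mat (dim_row A * dim_row B) (dim_col A * dim_col B)
    (\<lambda>(i, j). A $$ (i div dim_row B, j div dim_col B) * B $$ (i mod dim_row B, j mod dim_col B))"

lemma kron_closed: "A \<in> carrier_mat m m \<Longrightarrow> B \<in> carrier_mat n n \<Longrightarrow> kron A B \<in> carrier_mat (m * n) (m * n)"
  by (auto simp: kron_def)

lemma kron_index:
  assumes "A \<in> carrier_mat m m" "B \<in> carrier_mat n n" "i < m * n" "j < m * n"
  shows "kron A B $$ (i, j) = A $$ (i div n, j div n) * B $$ (i mod n, j mod n)"
  using assms by (auto simp: kron_def)

lemma kron_mult:
  assumes A: "A \<in> carrier_mat m m" "C \<in> carrier_mat m m" and B: "B \<in> carrier_mat n n" "D \<in> carrier_mat n n"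
  shows "kron A B * kron C D = kron (A * C) (B * D)"
proof (rule eq_matI)
  fix i j assume "i < dim_row (kron (A * C) (B * D))" "j < dim_col (kron (A * C) (B * D))"
  hence ij: "i < m * n" "j < m * n" using A B by (auto simp: kron_def)
  hence n: "n > 0" by (cases n) auto
  have dm: "i div n < m" "j div n < m" "i mod n < n" "j mod n < n" using ij n by (auto simp: less_mult_imp_div_less)
  note AB = kron_closed[OF A(1) B(1)] kron_closed[OF A(2) B(2)]
  have "(kron A B * kron C D) $$ (i, j) = (\<Sum>k<m * n. kron A B $$ (i, k) * kron C D $$ (k, j))"
    using ij carrier_matD[OF AB(1)] carrier_matD[OF AB(2)] by (simp add: scalar_prod_def atLeast0LessThan)
  also have "\<dots> = (\<Sum>k<m * n. (A $$ (i div n, k div n) * C $$ (k div n, j div n)) * (B $$ (i mod n, k mod n) * D $$ (k mod n, j mod n)))"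
    by (intro sum.cong refl) (use ij in \<open>simp add: kron_index[OF A(1) B(1)] kron_index[OF A(2) B(2)] mult_ac\<close>)
  also have "\<dots> = (\<Sum>(k, l)\<in>{..<m} \<times> {..<n}. (A $$ (i div n, k) * C $$ (k, j div n)) * (B $$ (i mod n, l) * D $$ (l, j mod n)))"
  proof (rule sum.reindex_bij_witness[of _ "\<lambda>(k, l). k * n + l" "\<lambda>k. (k div n, k mod n)"])
    fix kl assume kl: "kl \<in> {..<m} \<times> {..<n}"
    then obtain k l where "kl = (k, l)" "k < m" "l < n" by auto
    moreover have "k * n + l < Suc k * n" using \<open>l < n\<close> by simp
    moreover have "Suc k * n \<le> m * n" using \<open>k < m\<close> by (intro mult_le_mono1) simp
    ultimately show "(case kl of (k, l) \<Rightarrow> k * n + l) \<in> {..<m * n}"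
      "((case kl of (k, l) \<Rightarrow> k * n + l) div n, (case kl of (k, l) \<Rightarrow> k * n + l) mod n) = kl" by auto
  qed (use n in \<open>auto simp: less_mult_imp_div_less\<close>)
  also have "\<dots> = (\<Sum>k<m. A $$ (i div n, k) * C $$ (k, j div n)) * (\<Sum>l<n. B $$ (i mod n, l) * D $$ (l, j mod n))"
    unfolding sum_product by (simp add: sum.cartesian_product)
  also have "\<dots> = (A * C) $$ (i div n, j div n) * (B * D) $$ (i mod n, j mod n)"
    using dm A B carrier_matD[OF A(1)] carrier_matD[OF A(2)] carrier_matD[OF B(1)] carrier_matD[OF B(2)]
    by (simp add: scalar_prod_def atLeast0LessThan)
  also have "\<dots> = kron (A * C) (B * D) $$ (i, j)"
    by (rule kron_index[symmetric]) (use A B ij in auto)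
  finally show "(kron A B * kron C D) $$ (i, j) = kron (A * C) (B * D) $$ (i, j)" .
qed (use A B in \<open>auto simp: kron_def\<close>)

lemma kron_smult:
  assumes A: "A \<in> carrier_mat m m" and B: "B \<in> carrier_mat n n"
  shows "kron (b \<cdot>\<^sub>m A) B = b \<cdot>\<^sub>m kron A B" "kron A (b \<cdot>\<^sub>m B) = b \<cdot>\<^sub>m kron A B"
proof -
  have A': "b \<cdot>\<^sub>m A \<in> carrier_mat m m" and B': "b \<cdot>\<^sub>m B \<in> carrier_mat n n" using A B by auto
  have dm: "i div n < m" "i mod n < n" if "i < m * n" for i
    using that by (cases n; auto simp: less_mult_imp_div_less)+
  have d: "dim_row A = m" "dim_col A = m" "dim_row B = n" "dim_col B = n" using A B by auto
  show "kron (b \<cdot>\<^sub>m A) B = b \<cdot>\<^sub>m kron A B"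
  proof (rule eq_matI)
    fix i j assume "i < dim_row (b \<cdot>\<^sub>m kron A B)" "j < dim_col (b \<cdot>\<^sub>m kron A B)"
    hence ij: "i < m * n" "j < m * n" by (simp_all add: kron_def d)
    show "kron (b \<cdot>\<^sub>m A) B $$ (i, j) = (b \<cdot>\<^sub>m kron A B) $$ (i, j)"
      using ij dm[OF ij(1)] dm[OF ij(2)] d carrier_matD[OF kron_closed[OF A B]]
      by (simp add: kron_index[OF A' B ij] kron_index[OF A B ij])
  qed (simp_all add: kron_def)
  show "kron A (b \<cdot>\<^sub>m B) = b \<cdot>\<^sub>m kron A B"
  proof (rule eq_matI)
    fix i j assume "i < dim_row (b \<cdot>\<^sub>m kron A B)" "j < dim_col (b \<cdot>\<^sub>m kron A B)"
    hence ij: "i < m * n" "j < m * n" by (simp_all add: kron_def d)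
    show "kron A (b \<cdot>\<^sub>m B) $$ (i, j) = (b \<cdot>\<^sub>m kron A B) $$ (i, j)"
      using ij dm[OF ij(1)] dm[OF ij(2)] d carrier_matD[OF kron_closed[OF A B]]
      by (simp add: kron_index[OF A B' ij] kron_index[OF A B ij])
  qed (simp_all add: kron_def)
qed

lemma kron_one: "kron (1\<^sub>m m) (1\<^sub>m n) = 1\<^sub>m (m * n)"
proof (rule eq_matI)
  fix i j assume "i < dim_row (1\<^sub>m (m * n))" "j < dim_col (1\<^sub>m (m * n))"
  hence ij: "i < m * n" "j < m * n" by auto
  hence n: "n > 0" by (cases n) auto
  have "i = j \<longleftrightarrow> i div n = j div n \<and> i mod n = j mod n" by (metis div_mult_mod_eq)
  thus "kron (1\<^sub>m m) (1\<^sub>m n) $$ (i, j) = 1\<^sub>m (m * n) $$ (i, j)"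
    using ij n kron_index[OF one_carrier_mat one_carrier_mat ij] by (auto simp: less_mult_imp_div_less)
qed (auto simp: kron_def)

lemma kron_entries:
  assumes A: "A \<in> carrier_mat m m" and B: "B \<in> carrier_mat n n"
    and F: "\<And>x y. x \<in> F \<Longrightarrow> y \<in> F \<Longrightarrow> x * y \<in> F"
    and "\<forall>r<m. \<forall>s<m. A $$ (r, s) \<in> F" "\<forall>r<n. \<forall>s<n. B $$ (r, s) \<in> F"
  shows "\<forall>r<m*n. \<forall>s<m*n. kron A B $$ (r, s) \<in> F"
proof (intro allI impI)
  fix i j assume ij: "i < m * n" "j < m * n"
  hence "n > 0" by (cases n) auto
  thus "kron A B $$ (i, j) \<in> F"
    unfolding kron_index[OF A B ij] using ij assms(4,5) by (intro F) (auto simp: less_mult_imp_div_less)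
qed

text \<open>Generators with square \<open>k\<close> together with an involution \<open>Om\<close>
  that anticommutes with all of them. \<open>Om\<close> provides the signs in tensor products and
  finally represents the one basis vector outside the blocks of eight.\<close>

definition chiral_system :: "complex set \<Rightarrow> complex \<Rightarrow> nat \<Rightarrow> nat \<Rightarrow> complex mat \<Rightarrow> (nat \<Rightarrow> complex mat) \<Rightarrow> bool" where
  "chiral_system F k N p Om et \<longleftrightarrow>
    Om \<in> carrier_mat N N \<and> Om * Om = 1\<^sub>m N \<and> (\<forall>r<N. \<forall>s<N. Om $$ (r, s) \<in> F) \<and>
    (\<forall>j<p. et j \<in> carrier_mat N N \<and> et j * et j = k \<cdot>\<^sub>m 1\<^sub>m N \<and> et j * Om = (-1) \<cdot>\<^sub>m (Om * et j) \<and>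
      (\<forall>r<N. \<forall>s<N. et j $$ (r, s) \<in> F)) \<and>
    (\<forall>i<p. \<forall>j<p. i \<noteq> j \<longrightarrow> et i * et j = (-1) \<cdot>\<^sub>m (et j * et i))"

text \<open>The graded tensor product in matrix form: \<open>Om\<close> in the first factor makes
  generators of the two systems anticommute, and its square being 1 leaves the squares of the second
  system unchanged.\<close>

lemma chiral_system_kron:
  assumes sys: "chiral_system F k N p Om et" "chiral_system F k N' p' Om' et'"
    and F: "0 \<in> F" "1 \<in> F" "\<And>x y. x \<in> F \<Longrightarrow> y \<in> F \<Longrightarrow> x * y \<in> F"
  shows "chiral_system F k (N * N') (p + p') (kron Om Om')
    (\<lambda>j. if j < p then kron (et j) (1\<^sub>m N') else kron Om (et' (j - p)))"
proof -
  have Om: "Om \<in> carrier_mat N N" "Om * Om = 1\<^sub>m N" "\<forall>r<N. \<forall>s<N. Om $$ (r, s) \<in> F"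
    and Om': "Om' \<in> carrier_mat N' N'" "Om' * Om' = 1\<^sub>m N'" "\<forall>r<N'. \<forall>s<N'. Om' $$ (r, s) \<in> F"
    using sys by (auto simp: chiral_system_def)
  have et: "et j \<in> carrier_mat N N" "et j * et j = k \<cdot>\<^sub>m 1\<^sub>m N" "et j * Om = (-1) \<cdot>\<^sub>m (Om * et j)"
    "\<forall>r<N. \<forall>s<N. et j $$ (r, s) \<in> F" if "j < p" for j using sys(1) that by (auto simp: chiral_system_def)
  have et': "et' j \<in> carrier_mat N' N'" "et' j * et' j = k \<cdot>\<^sub>m 1\<^sub>m N'" "et' j * Om' = (-1) \<cdot>\<^sub>m (Om' * et' j)"
    "\<forall>r<N'. \<forall>s<N'. et' j $$ (r, s) \<in> F" if "j < p'" for j using sys(2) that by (auto simp: chiral_system_def)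
  have anti: "et i * et j = (-1) \<cdot>\<^sub>m (et j * et i)" if "i < p" "j < p" "i \<noteq> j" for i j
    using sys(1) that unfolding chiral_system_def by blast
  have anti': "et' i * et' j = (-1) \<cdot>\<^sub>m (et' j * et' i)" if "i < p'" "j < p'" "i \<noteq> j" for i j
    using sys(2) that unfolding chiral_system_def by blast
  have one: "\<forall>r<N'. \<forall>s<N'. 1\<^sub>m N' $$ (r, s) \<in> F" using F by simp
  have o: "1\<^sub>m N' \<in> carrier_mat N' N'" by simp
  show ?thesis
    unfolding chiral_system_def
  proof (intro conjI allI impI, goal_cases)
    case 1 show ?case by (rule kron_closed[OF Om(1) Om'(1)])
  next
    case 2 show ?case by (simp add: kron_mult[OF Om(1,1) Om'(1,1)] Om Om' kron_one)
  next
    case (3 r s) thus ?case using kron_entries[OF Om(1) Om'(1) F(3) Om(3) Om'(3)] by simp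
  next
    case (4 j) thus ?case using kron_closed[OF et(1) o, of j] kron_closed[OF Om(1) et'(1), of "j - p"] by auto
  next
    case (5 j)
    show ?case
    proof (cases "j < p")
      case True
      thus ?thesis using kron_mult[OF et(1)[OF True] et(1)[OF True] o o] et(2)[OF True]
        by (simp add: kron_smult[OF one_carrier_mat one_carrier_mat] kron_one)
    next
      case False
      hence j: "j - p < p'" using 5 by auto
      show ?thesis using False kron_mult[OF Om(1,1) et'(1)[OF j] et'(1)[OF j]] et'(2)[OF j] Om(2)
        by (simp add: kron_smult[OF one_carrier_mat one_carrier_mat] kron_one)
    qed
  next
    case (6 j)
    show ?case
    proof (cases "j < p")
      case True
      show ?thesis using True kron_mult[OF et(1)[OF True] Om(1) o Om'(1)] kron_mult[OF Om(1) et(1)[OF True] Om'(1) o] Om'(1)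
          kron_smult(1)[OF mult_carrier_mat[OF Om(1) et(1)[OF True]] Om'(1)] by (simp add: et(3)[OF True])
    next
      case False
      hence j: "j - p < p'" using 6 by auto
      show ?thesis using False kron_mult[OF Om(1,1) et'(1)[OF j] Om'(1)] kron_mult[OF Om(1,1) Om'(1) et'(1)[OF j]]
          kron_smult(2)[OF one_carrier_mat mult_carrier_mat[OF Om'(1) et'(1)[OF j]]] by (simp add: et'(3)[OF j] Om(2))
    qed
  next
    case (7 j r s)
    show ?case
    proof (cases "j < p")
      case True
      thus ?thesis using 7 kron_entries[OF et(1)[OF True] o F(3) et(4)[OF True] one] by auto
    next
      case False
      hence j: "j - p < p'" using 7 by auto
      thus ?thesis using 7 False kron_entries[OF Om(1) et'(1)[OF j] F(3) Om(3) et'(4)[OF j]] by auto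
    qed
  next
    case (8 i j)
    have mixed: "kron (et i) (1\<^sub>m N') * kron Om (et' j) = (-1) \<cdot>\<^sub>m (kron Om (et' j) * kron (et i) (1\<^sub>m N'))"
      "kron Om (et' j) * kron (et i) (1\<^sub>m N') = (-1) \<cdot>\<^sub>m (kron (et i) (1\<^sub>m N') * kron Om (et' j))"
      if i: "i < p" and j: "j < p'" for i j
    proof -
      show *: "kron (et i) (1\<^sub>m N') * kron Om (et' j) = (-1) \<cdot>\<^sub>m (kron Om (et' j) * kron (et i) (1\<^sub>m N'))"
        using kron_mult[OF et(1)[OF i] Om(1) o et'(1)[OF j]] kron_mult[OF Om(1) et(1)[OF i] et'(1)[OF j] o] et'(1)[OF j]
          kron_smult(1)[OF mult_carrier_mat[OF Om(1) et(1)[OF i]] et'(1)[OF j]] by (simp add: et(3)[OF i])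
      show "kron Om (et' j) * kron (et i) (1\<^sub>m N') = (-1) \<cdot>\<^sub>m (kron (et i) (1\<^sub>m N') * kron Om (et' j))"
        unfolding * by (rule eq_matI) auto
    qed
    consider "i < p" "j < p" | "i < p" "\<not> j < p" | "\<not> i < p" "j < p" | "\<not> i < p" "\<not> j < p" by blast
    thus ?case
    proof cases
      case 1
      thus ?thesis using kron_mult[OF et(1) et(1) o o, of i j] kron_mult[OF et(1) et(1) o o, of j i]
          kron_smult(1)[of "et j * et i" N "1\<^sub>m N'" N' "-1"] mult_carrier_mat[OF et(1) et(1), of j i] anti[of i j] 8 by simp
    next
      case 2 thus ?thesis using mixed(1)[of i "j - p"] 8 by simp
    next
      case 3 thus ?thesis using mixed(2)[of j "i - p"] 8 by simp
    next
      case 4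
      hence ij: "i - p < p'" "j - p < p'" "i - p \<noteq> j - p" using 8 by auto
      thus ?thesis using 4 kron_mult[OF Om(1,1) et'(1)[OF ij(1)] et'(1)[OF ij(2)]] kron_mult[OF Om(1,1) et'(1)[OF ij(2)] et'(1)[OF ij(1)]]
          kron_smult(2)[of "1\<^sub>m N" N "et' (j - p) * et' (i - p)" N' "-1"] mult_carrier_mat[OF et'(1)[OF ij(2)] et'(1)[OF ij(1)]]
          anti'[OF ij] Om(2) by simp
    qed
  qed
qed

section \<open>Two by two blocks and their fourfold tensor products\<close>

definition m2 :: "'a::comm_ring_1 \<Rightarrow> 'a \<Rightarrow> 'a \<Rightarrow> 'a \<Rightarrow> 'a mat" where
  "m2 a b c d = Matrix.mat 2 2 (\<lambda>(i, j). if i = 0 then (if j = 0 then a else b) else (if j = 0 then c else d))"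

lemma m2_closed: "m2 a b c d \<in> carrier_mat 2 2" by (simp add: m2_def)

lemma m2_mult: "m2 a b c d * m2 a' b' c' d' = m2 (a * a' + b * c') (a * b' + b * d') (c * a' + d * c') (c * b' + d * d')"
  by (rule eq_matI) (auto simp: m2_def scalar_prod_def numeral_2_eq_2)

lemma m2_smult: "x \<cdot>\<^sub>m m2 a b c d = m2 (x * a) (x * b) (x * c) (x * d)"
  by (rule eq_matI) (auto simp: m2_def)

lemma m2_entries: "a \<in> F \<Longrightarrow> b \<in> F \<Longrightarrow> c \<in> F \<Longrightarrow> d \<in> F \<Longrightarrow> \<forall>r<2. \<forall>s<2. m2 a b c d $$ (r, s) \<in> F"
  by (auto simp: m2_def)

lemma m2_one: "1\<^sub>m 2 = m2 1 0 0 1"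
  by (rule eq_matI) (auto simp: m2_def)

definition t4 :: "complex mat \<Rightarrow> complex mat \<Rightarrow> complex mat \<Rightarrow> complex mat \<Rightarrow> complex mat" where
  "t4 A B C D = kron A (kron B (kron C D))"

lemma t4_closed:
  assumes "A \<in> carrier_mat 2 2" "B \<in> carrier_mat 2 2" "C \<in> carrier_mat 2 2" "D \<in> carrier_mat 2 2"
  shows "kron C D \<in> carrier_mat 4 4" "kron B (kron C D) \<in> carrier_mat 8 8" "t4 A B C D \<in> carrier_mat 16 16"
proof -
  show 1: "kron C D \<in> carrier_mat 4 4" using kron_closed[OF assms(3,4)] by simp
  show 2: "kron B (kron C D) \<in> carrier_mat 8 8" using kron_closed[OF assms(2) 1] by simp
  show "t4 A B C D \<in> carrier_mat 16 16" using kron_closed[OF assms(1) 2] by (simp add: t4_def)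
qed

lemma t4_mult:
  assumes "A \<in> carrier_mat 2 2" "B \<in> carrier_mat 2 2" "C \<in> carrier_mat 2 2" "D \<in> carrier_mat 2 2"
    "A' \<in> carrier_mat 2 2" "B' \<in> carrier_mat 2 2" "C' \<in> carrier_mat 2 2" "D' \<in> carrier_mat 2 2"
  shows "t4 A B C D * t4 A' B' C' D' = t4 (A * A') (B * B') (C * C') (D * D')"
  unfolding t4_def
  using kron_mult[OF assms(1,5) t4_closed(2)[OF assms(1-4)] t4_closed(2)[OF assms(5-8)]]
    kron_mult[OF assms(2,6) t4_closed(1)[OF assms(1-4)] t4_closed(1)[OF assms(5-8)]]
    kron_mult[OF assms(3,7,4,8)] by simp

lemma t4_smult:
  assumes "A \<in> carrier_mat 2 2" "B \<in> carrier_mat 2 2" "C \<in> carrier_mat 2 2" "D \<in> carrier_mat 2 2"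
  shows "t4 (b \<cdot>\<^sub>m A) B C D = b \<cdot>\<^sub>m t4 A B C D" "t4 A (b \<cdot>\<^sub>m B) C D = b \<cdot>\<^sub>m t4 A B C D"
    "t4 A B (b \<cdot>\<^sub>m C) D = b \<cdot>\<^sub>m t4 A B C D" "t4 A B C (b \<cdot>\<^sub>m D) = b \<cdot>\<^sub>m t4 A B C D"
  using t4_closed[OF assms] assms
  by (simp_all add: t4_def kron_smult[of _ 2 _ 2] kron_smult[of _ 2 _ 4] kron_smult[of _ 2 _ 8])

lemma t4_one: "t4 (1\<^sub>m 2) (1\<^sub>m 2) (1\<^sub>m 2) (1\<^sub>m 2) = 1\<^sub>m 16"
  by (simp add: t4_def kron_one)

lemma t4_entries:
  assumes F: "\<And>x y. x \<in> F \<Longrightarrow> y \<in> F \<Longrightarrow> x * y \<in> F"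
    and cl: "A \<in> carrier_mat 2 2" "B \<in> carrier_mat 2 2" "C \<in> carrier_mat 2 2" "D \<in> carrier_mat 2 2"
    and ent: "\<forall>r<2. \<forall>s<2. A $$ (r, s) \<in> F" "\<forall>r<2. \<forall>s<2. B $$ (r, s) \<in> F"
      "\<forall>r<2. \<forall>s<2. C $$ (r, s) \<in> F" "\<forall>r<2. \<forall>s<2. D $$ (r, s) \<in> F"
  shows "\<forall>r<16. \<forall>s<16. t4 A B C D $$ (r, s) \<in> F"
proof -
  have 1: "\<forall>r<4. \<forall>s<4. kron C D $$ (r, s) \<in> F" using kron_entries[OF cl(3,4) F ent(3,4)] by simp
  have 2: "\<forall>r<8. \<forall>s<8. kron B (kron C D) $$ (r, s) \<in> F"
    using kron_entries[OF cl(2) t4_closed(1)[OF cl] F ent(2) 1] by simp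
  show ?thesis using kron_entries[OF cl(1) t4_closed(2)[OF cl] F ent(1) 2] by (simp add: t4_def)
qed

definition I2 :: "complex mat" where "I2 = m2 1 0 0 1"
definition X2 :: "complex mat" where "X2 = m2 0 1 1 0"
definition Z2 :: "complex mat" where "Z2 = m2 1 0 0 (-1)"
definition Y2 :: "complex mat" where "Y2 = m2 0 (-1) 1 0"
text \<open>\<open>Xk k\<close> has square \<open>k\<close> and \<open>Yk k\<close> has square
  \<open>-k\<close>. Tensoring \<open>Yk k\<close> with a matrix of square -1 yields square
  \<open>k\<close> again, so \<open>k\<close> need not be a square in the field.\<close>

definition Xk :: "complex \<Rightarrow> complex mat" where "Xk k = m2 0 k 1 0"
definition Yk :: "complex \<Rightarrow> complex mat" where "Yk k = m2 0 (-k) 1 0"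

lemmas pauli_defs = I2_def X2_def Z2_def Y2_def Xk_def Yk_def

lemma pauli_closed [simp]:
  "I2 \<in> carrier_mat 2 2" "X2 \<in> carrier_mat 2 2" "Z2 \<in> carrier_mat 2 2" "Y2 \<in> carrier_mat 2 2"
  "Xk k \<in> carrier_mat 2 2" "Yk k \<in> carrier_mat 2 2"
  by (simp_all add: pauli_defs m2_closed)

lemma pauli_mult:
  "I2 * I2 = I2" "I2 * X2 = X2" "I2 * Y2 = Y2" "I2 * Z2 = Z2"
  "X2 * I2 = X2" "X2 * X2 = I2" "X2 * Y2 = (-1) \<cdot>\<^sub>m (Y2 * X2)" "X2 * Z2 = (-1) \<cdot>\<^sub>m (Z2 * X2)"
  "Y2 * I2 = Y2" "Y2 * Y2 = (-1) \<cdot>\<^sub>m I2" "Y2 * Z2 = (-1) \<cdot>\<^sub>m (Z2 * Y2)"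
  "Z2 * I2 = Z2" "Z2 * Z2 = I2"
  "Xk k * Xk k = k \<cdot>\<^sub>m I2" "Yk k * Yk k = (-k) \<cdot>\<^sub>m I2" "Xk k * Yk k = (-1) \<cdot>\<^sub>m (Yk k * Xk k)"
  "Xk k * Z2 = (-1) \<cdot>\<^sub>m (Z2 * Xk k)" "Yk k * Z2 = (-1) \<cdot>\<^sub>m (Z2 * Yk k)"
  by (simp_all add: pauli_defs m2_mult m2_smult)

text \<open>The matrices \<open>eta k j\<close>, \<open>j > 0\<close>, are \<open>Yk k\<close> tensored with the left multiplications by the seven
  imaginary octonion units, built from the commuting left and right actions of the quaternions.\<close>

definition eta :: "complex \<Rightarrow> nat \<Rightarrow> complex mat" where
  "eta k j = [t4 (Xk k) I2 I2 I2, t4 (Yk k) X2 I2 Y2, t4 (Yk k) X2 Y2 X2, t4 (Yk k) X2 Y2 Z2,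
    t4 (Yk k) Z2 Y2 I2, t4 (Yk k) Z2 X2 Y2, t4 (Yk k) Z2 Z2 Y2, t4 (Yk k) Y2 I2 I2] ! j"

lemma smult_smult_mat: "a \<cdot>\<^sub>m (b \<cdot>\<^sub>m A) = (a * b) \<cdot>\<^sub>m (A :: complex mat)"
  by (rule eq_matI) auto

lemma one_smult_mat: "1 \<cdot>\<^sub>m A = (A :: complex mat)"
  by (rule eq_matI) auto

text \<open>A finite check against the multiplication table of the blocks: two fourfold tensors
  anticommute when an odd number of their factors do and the remaining ones commute.\<close>

lemma chiral_system_eta:
  assumes F: "0 \<in> F" "1 \<in> F" "\<And>x y. x \<in> F \<Longrightarrow> y \<in> F \<Longrightarrow> x * y \<in> F" "\<And>x. x \<in> F \<Longrightarrow> - x \<in> F" "k \<in> F"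
  shows "chiral_system F k 16 8 (t4 Z2 I2 I2 I2) (eta k)"
proof -
  have cases8: "j = 0 \<or> j = 1 \<or> j = 2 \<or> j = 3 \<or> j = 4 \<or> j = 5 \<or> j = 6 \<or> j = 7" if "j < 8" for j :: nat
    using that by linarith
  have mc: "A * B \<in> carrier_mat 2 2" if "A \<in> carrier_mat 2 2" "B \<in> carrier_mat 2 2" for A B :: "complex mat"
    using that by simp
  have one: "t4 I2 I2 I2 I2 = 1\<^sub>m 16" using t4_one by (simp add: I2_def m2_one)
  note calc = eta_def t4_mult t4_smult pauli_mult smult_smult_mat one_smult_mat mc one
  have ent: "\<forall>r<2. \<forall>s<2. A $$ (r, s) \<in> F" if "A \<in> {I2, X2, Y2, Z2, Xk k, Yk k}" for A
    using that F by (auto simp: pauli_defs intro!: m2_entries[rule_format])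
  have cl: "A \<in> carrier_mat 2 2" if "A \<in> {I2, X2, Y2, Z2, Xk k, Yk k}" for A using that by auto
  have ent4: "\<forall>r<16. \<forall>s<16. t4 A B C D $$ (r, s) \<in> F"
    if "A \<in> {I2, X2, Y2, Z2, Xk k, Yk k}" "B \<in> {I2, X2, Y2, Z2, Xk k, Yk k}"
      "C \<in> {I2, X2, Y2, Z2, Xk k, Yk k}" "D \<in> {I2, X2, Y2, Z2, Xk k, Yk k}" for A B C D
    by (rule t4_entries[OF F(3) cl[OF that(1)] cl[OF that(2)] cl[OF that(3)] cl[OF that(4)]
          ent[OF that(1)] ent[OF that(2)] ent[OF that(3)] ent[OF that(4)]])
  have closed: "eta k j \<in> carrier_mat 16 16" if "j < 8" for j
    using cases8[OF that] by (elim disjE) (simp_all add: eta_def t4_closed)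
  have square: "eta k j * eta k j = k \<cdot>\<^sub>m 1\<^sub>m 16" if "j < 8" for j
    using cases8[OF that] by (elim disjE) (simp_all add: calc)
  have chir: "eta k j * t4 Z2 I2 I2 I2 = (-1) \<cdot>\<^sub>m (t4 Z2 I2 I2 I2 * eta k j)" if "j < 8" for j
    using cases8[OF that] by (elim disjE) (simp_all add: calc)
  have entries: "\<forall>r<16. \<forall>s<16. eta k j $$ (r, s) \<in> F" if "j < 8" for j
    using cases8[OF that] ent4 by (elim disjE) (simp_all add: eta_def)
  have less: "eta k i * eta k j = (-1) \<cdot>\<^sub>m (eta k j * eta k i)" if "i < 8" "j < 8" "i \<noteq> j" for i j
    using cases8[OF that(1)] cases8[OF that(2)] that(3) by (elim disjE) (simp_all add: calc)
  show ?thesis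
    unfolding chiral_system_def
  proof (intro conjI)
    show "t4 Z2 I2 I2 I2 * t4 Z2 I2 I2 I2 = 1\<^sub>m 16" by (simp add: calc)
  qed (use closed square chir entries less ent4[of Z2 I2 I2 I2] t4_closed(3)[of Z2 I2 I2 I2] in \<open>blast | simp\<close>)+
qed

lemma exists_chiral_system:
  assumes F: "0 \<in> F" "1 \<in> F" "\<And>x y. x \<in> F \<Longrightarrow> y \<in> F \<Longrightarrow> x * y \<in> F" "\<And>x. x \<in> F \<Longrightarrow> - x \<in> F" "k \<in> F"
  shows "\<exists>Om et. chiral_system F k (16 ^ m) (8 * m) Om et"
proof (induction m)
  case 0
  \<comment> \<open>There are no generators yet, so the family is arbitrary and the identity of size
    one serves as chirality.\<close>
  have "chiral_system F k 1 0 (1\<^sub>m 1) undefined" using F by (simp add: chiral_system_def)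
  thus ?case by auto
next
  case (Suc m)
  then obtain Om et where "chiral_system F k (16 ^ m) (8 * m) Om et" by blast
  from chiral_system_kron[OF chiral_system_eta[OF F] this F(1-3)] show ?case by auto
qed

section \<open>Algebras isomorphic to matrix algebras\<close>

context complex_subfield
begin

definition unit_mat :: "nat \<Rightarrow> nat \<Rightarrow> nat \<Rightarrow> complex mat" where
  "unit_mat N r s = Matrix.mat N N (\<lambda>(i, j). if i = r \<and> j = s then 1 else 0)"

lemma unit_mat_closed: "unit_mat N r s \<in> carrier_mat N N" "unit_mat N r s \<in> rational_mats N"
  by (auto simp: unit_mat_def rational_mats_def)

lemma mult_unit_mat:
  assumes M: "M \<in> carrier_mat N N" and "r < N" "s < N" "i < N" "j < N"
  shows "(M * unit_mat N r s) $$ (i, j) = (if j = s then M $$ (i, r) else 0)"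
    "(unit_mat N r s * M) $$ (i, j) = (if i = r then M $$ (s, j) else 0)"
  using assms carrier_matD[OF M]
  by (auto simp: unit_mat_def scalar_prod_def atLeast0LessThan if_distrib[of "(*) _"]
      if_distrib[of "\<lambda>x. x * _"] cong: if_cong)

text \<open>The classical argument for matrix rings over a field, pulled back along
  \<open>\<Phi>\<close>: matrix units span, only scalars commute with all of them, and a nonzero
  two-sided ideal contains 1.\<close>

lemma central_simple_of_matrix_iso:
  assumes A: "k_algebra K A" and N: "N > 0" and \<Phi>: "k_algebra_hom K A (mat_algebra N) \<Phi>"
    and bij: "bij_betw \<Phi> (carrier A) (rational_mats N)"
  shows "central_simple_algebra K A"
proof -
  interpret k_algebra K A by fact
  note hD = k_algebra_homD[OF \<Phi>]
  have inj: "y = z" if "y \<in> carrier A" "z \<in> carrier A" "\<Phi> y = \<Phi> z" for y z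
    using bij that by (auto simp: bij_betw_def inj_on_def)
  have cl: "\<Phi> y \<in> carrier_mat N N" if "y \<in> carrier A" for y using hD(1)[OF that] by simp
  have rat: "\<Phi> y $$ (r, s) \<in> carrier K" if "y \<in> carrier A" "r < N" "s < N" for y r s
    using bij that by (auto simp: bij_betw_def rational_mats_def)
  \<comment> \<open>Preimages of the matrix units, which are rational because 0 and 1 lie in
    \<open>K\<close>.\<close>
  define u where "u r s = inv_into (carrier A) \<Phi> (unit_mat N r s)" for r s
  have u: "u r s \<in> carrier A" "\<Phi> (u r s) = unit_mat N r s" for r s
    using bij unit_mat_closed(2)[of N r s] unfolding u_def bij_betw_def
    by (metis inv_into_into, metis f_inv_into_f)
  have finsum_closed: "(\<Oplus>\<^bsub>A\<^esub>i\<in>I. f i) \<in> H"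
    if "finite I" "\<And>i. i \<in> I \<Longrightarrow> f i \<in> H" "H \<subseteq> carrier A" "\<zero>\<^bsub>A\<^esub> \<in> H" "\<And>y z. y \<in> H \<Longrightarrow> z \<in> H \<Longrightarrow> y \<oplus>\<^bsub>A\<^esub> z \<in> H"
    for I :: "'z set" and f H
    using that(1,2)
  proof (induction I rule: finite_induct)
    case (insert i I)
    have "(\<Oplus>\<^bsub>A\<^esub>i\<in>insert i I. f i) = f i \<oplus>\<^bsub>A\<^esub> (\<Oplus>\<^bsub>A\<^esub>i\<in>I. f i)"
      using insert that(3) by (intro M.finsum_insert) auto
    thus ?case using insert that by auto
  qed (use that in simp)
  have "fin_dim"
  proof -
    define B where "B = (\<lambda>(r, s). u r s) ` ({..<N} \<times> {..<N})"
    have B: "finite B" "B \<subseteq> carrier A" using u by (auto simp: B_def)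
    interpret S: submodule K "span B" A by (rule span_is_submodule[OF B(2)])
    have "y \<in> span B" if y: "y \<in> carrier A" for y
    proof -
      define f where "f = (\<lambda>(r, s). \<Phi> y $$ (r, s) \<odot>\<^bsub>A\<^esub> u r s)"
      have fc: "f rs \<in> carrier A" if "rs \<in> {..<N} \<times> {..<N}" for rs
        using that rat[OF y] u by (auto simp: f_def)
      have "y = (\<Oplus>\<^bsub>A\<^esub>rs\<in>{..<N} \<times> {..<N}. f rs)"
      proof (rule inj[OF y])
        show c: "(\<Oplus>\<^bsub>A\<^esub>rs\<in>{..<N} \<times> {..<N}. f rs) \<in> carrier A" using fc by (intro M.finsum_closed) auto
        show "\<Phi> y = \<Phi> (\<Oplus>\<^bsub>A\<^esub>rs\<in>{..<N} \<times> {..<N}. f rs)"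
        proof (rule eq_matI)
          fix i j assume "i < dim_row (\<Phi> (\<Oplus>\<^bsub>A\<^esub>rs\<in>{..<N} \<times> {..<N}. f rs))" "j < dim_col (\<Phi> (\<Oplus>\<^bsub>A\<^esub>rs\<in>{..<N} \<times> {..<N}. f rs))"
          hence ij: "i < N" "j < N" using cl[OF c] by auto
          have "\<Phi> (\<Oplus>\<^bsub>A\<^esub>rs\<in>{..<N} \<times> {..<N}. f rs) $$ (i, j) = (\<Sum>rs\<in>{..<N} \<times> {..<N}. \<Phi> (f rs) $$ (i, j))"
            by (rule k_algebra_hom_finsum[OF A \<Phi> _ _ ij]) (use fc in auto)
          also have "\<dots> = (\<Sum>rs\<in>{..<N} \<times> {..<N}. if rs = (i, j) then \<Phi> y $$ (i, j) else 0)"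
          proof (intro sum.cong refl)
            fix rs assume "rs \<in> {..<N} \<times> {..<N}"
            then obtain r s where rs: "rs = (r, s)" "r < N" "s < N" by auto
            have "\<Phi> (f rs) = \<Phi> y $$ (r, s) \<cdot>\<^sub>m unit_mat N r s" using hD(6)[OF rat[OF y rs(2,3)] u(1)] u(2) by (simp add: f_def rs)
            thus "\<Phi> (f rs) $$ (i, j) = (if rs = (i, j) then \<Phi> y $$ (i, j) else 0)" using ij rs by (auto simp: unit_mat_def)
          qed
          also have "\<dots> = \<Phi> y $$ (i, j)" using ij by simp
          finally show "\<Phi> y $$ (i, j) = \<Phi> (\<Oplus>\<^bsub>A\<^esub>rs\<in>{..<N} \<times> {..<N}. f rs) $$ (i, j)" ..
        qed (use cl[OF c] cl[OF y] in auto)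
      qed
      also have "\<dots> \<in> span B"
      proof (rule finsum_closed[OF _ _ S.subset S.zero_closed S.m_closed])
        fix rs assume rs: "rs \<in> {..<N} \<times> {..<N}"
        have "u (fst rs) (snd rs) \<in> span B" using in_own_span[OF B(2)] rs by (force simp: B_def)
        thus "f rs \<in> span B" using rat[OF y] rs by (auto simp: f_def)
      qed auto
      finally show ?thesis .
    qed
    hence "span B = carrier A" using S.subset by blast
    thus ?thesis unfolding fin_dim_def using B by blast
  qed
  moreover have "\<exists>a\<in>carrier K. z = a \<odot>\<^bsub>A\<^esub> \<one>\<^bsub>A\<^esub>"
    if z: "z \<in> carrier A" and comm: "\<And>y. y \<in> carrier A \<Longrightarrow> z \<otimes>\<^bsub>A\<^esub> y = y \<otimes>\<^bsub>A\<^esub> z" for z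
  proof -
    let ?Z = "\<Phi> z"
    have entry: "?Z $$ (i, r) = (if i = r then ?Z $$ (s, s) else 0)" if irs: "i < N" "r < N" "s < N" for i r s
    proof -
      have "?Z * unit_mat N r s = unit_mat N r s * ?Z" using comm[OF u(1)] z u hD(5)[of z "u r s"] hD(5)[of "u r s" z] by simp
      from arg_cong[OF this, of "\<lambda>M. M $$ (i, s)"] show ?thesis using mult_unit_mat[OF cl[OF z]] irs by simp
    qed
    have a: "?Z $$ (0, 0) \<in> carrier K" using rat[OF z N N] .
    have "z = ?Z $$ (0, 0) \<odot>\<^bsub>A\<^esub> \<one>\<^bsub>A\<^esub>"
    proof (rule inj[OF z])
      show "\<Phi> z = \<Phi> (?Z $$ (0, 0) \<odot>\<^bsub>A\<^esub> \<one>\<^bsub>A\<^esub>)"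
      proof (rule eq_matI)
        fix i j assume "i < dim_row (\<Phi> (?Z $$ (0, 0) \<odot>\<^bsub>A\<^esub> \<one>\<^bsub>A\<^esub>))" "j < dim_col (\<Phi> (?Z $$ (0, 0) \<odot>\<^bsub>A\<^esub> \<one>\<^bsub>A\<^esub>))"
        hence ij: "i < N" "j < N" using hD(6)[OF a A.one_closed] hD(2) by auto
        show "?Z $$ (i, j) = \<Phi> (?Z $$ (0, 0) \<odot>\<^bsub>A\<^esub> \<one>\<^bsub>A\<^esub>) $$ (i, j)"
          unfolding hD(6)[OF a A.one_closed] hD(2) entry[OF ij N] using ij by simp
      qed (use cl[OF z] hD(6)[OF a A.one_closed] hD(2) in auto)
    qed (use a in simp)
    thus ?thesis using a by blast
  qed
  moreover have "\<one>\<^bsub>A\<^esub> \<noteq> \<zero>\<^bsub>A\<^esub>"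
  proof
    assume "\<one>\<^bsub>A\<^esub> = \<zero>\<^bsub>A\<^esub>"
    hence "1\<^sub>m N = (0\<^sub>m N N :: complex mat)" using hD(2,3) by simp
    from arg_cong[OF this, of "\<lambda>M. M $$ (0, 0)"] show False using N by simp
  qed
  moreover have "I = {\<zero>\<^bsub>A\<^esub>} \<or> I = carrier A" if I: "ideal I A" for I
  proof (rule disjCI)
    assume "I \<noteq> carrier A"
    interpret I: ideal I A by fact
    show "I = {\<zero>\<^bsub>A\<^esub>}"
    proof (rule ccontr)
      assume "I \<noteq> {\<zero>\<^bsub>A\<^esub>}"
      then obtain y where y: "y \<in> I" "y \<noteq> \<zero>\<^bsub>A\<^esub>" using I.additive_subgroup_axioms additive_subgroup.zero_closed by blast
      have yc: "y \<in> carrier A" using y I.a_subset by auto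
      have "\<Phi> y \<noteq> 0\<^sub>m N N" using inj[OF yc M.zero_closed] y hD(3) by auto
      then obtain i j where ij: "i < N" "j < N" "\<Phi> y $$ (i, j) \<noteq> 0" using cl[OF yc] by (metis carrier_matD eq_matI index_zero_mat)
      \<comment> \<open>A nonzero entry of \<open>y\<close> is isolated by matrix units on both
        sides, moved to the diagonal position \<open>k\<close> and normalised. The sum over
        \<open>k\<close> is 1.\<close>
      define f where "f k = inverse (\<Phi> y $$ (i, j)) \<odot>\<^bsub>A\<^esub> (u k i \<otimes>\<^bsub>A\<^esub> y \<otimes>\<^bsub>A\<^esub> u j k)" for k
      have inv: "inverse (\<Phi> y $$ (i, j)) \<in> carrier K" using rat[OF yc ij(1,2)] by (rule inverse_closed)
      have fI: "f k \<in> I" for k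
        unfolding f_def using y u by (intro smult_ideal[OF I inv] I.I_r_closed I.I_l_closed)
      have fc: "f k \<in> carrier A" for k using fI I.a_subset by auto
      have f: "\<Phi> (f k) $$ (r, s) = (if r = k \<and> s = k then 1 else 0)" if "k < N" "r < N" "s < N" for k r s
      proof -
        have c: "unit_mat N k i * \<Phi> y \<in> carrier_mat N N" using cl[OF yc] unit_mat_closed(1)[of N k i] by simp
        have "\<Phi> (f k) = inverse (\<Phi> y $$ (i, j)) \<cdot>\<^sub>m (unit_mat N k i * \<Phi> y * unit_mat N j k)"
          using u yc inv by (simp add: f_def hD)
        hence "\<Phi> (f k) $$ (r, s) = inverse (\<Phi> y $$ (i, j)) * (unit_mat N k i * \<Phi> y * unit_mat N j k) $$ (r, s)"
          using that carrier_matD[OF mult_carrier_mat[OF c unit_mat_closed(1)[of N j k]]] by simp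
        also have "\<dots> = (if r = k \<and> s = k then 1 else 0)"
          using that ij by (simp add: mult_unit_mat[OF c] mult_unit_mat[OF cl[OF yc]])
        finally show ?thesis .
      qed
      have sI: "(\<Oplus>\<^bsub>A\<^esub>k\<in>{..<N}. f k) \<in> I"
        by (rule finsum_closed) (use fI I.a_subset additive_subgroup.zero_closed[OF I.additive_subgroup_axioms] additive_subgroup.a_closed[OF I.additive_subgroup_axioms] in auto)
      have "(\<Oplus>\<^bsub>A\<^esub>k\<in>{..<N}. f k) = \<one>\<^bsub>A\<^esub>"
      proof (rule inj)
        show c: "(\<Oplus>\<^bsub>A\<^esub>k\<in>{..<N}. f k) \<in> carrier A" using sI I.a_subset by auto
        show "\<Phi> (\<Oplus>\<^bsub>A\<^esub>k\<in>{..<N}. f k) = \<Phi> \<one>\<^bsub>A\<^esub>"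
        proof (rule eq_matI)
          fix r s assume "r < dim_row (\<Phi> \<one>\<^bsub>A\<^esub>)" "s < dim_col (\<Phi> \<one>\<^bsub>A\<^esub>)"
          hence rs: "r < N" "s < N" using hD(2) by auto
          have "\<Phi> (\<Oplus>\<^bsub>A\<^esub>k\<in>{..<N}. f k) $$ (r, s) = (\<Sum>k<N. \<Phi> (f k) $$ (r, s))"
            by (rule k_algebra_hom_finsum[OF A \<Phi> _ _ rs]) (use fc in auto)
          also have "\<dots> = (\<Sum>k<N. if k = r then (if r = s then 1 else 0) else 0)"
            by (intro sum.cong refl) (use f rs in auto)
          also have "\<dots> = \<Phi> \<one>\<^bsub>A\<^esub> $$ (r, s)" using rs hD(2) by simp
          finally show "\<Phi> (\<Oplus>\<^bsub>A\<^esub>k\<in>{..<N}. f k) $$ (r, s) = \<Phi> \<one>\<^bsub>A\<^esub> $$ (r, s)" .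
        qed (use cl[OF c] hD(2) in auto)
      qed simp
      hence "\<one>\<^bsub>A\<^esub> \<in> I" using sI by simp
      hence "I = carrier A" by (rule I.one_imp_carrier)
      thus False using \<open>I \<noteq> carrier A\<close> by contradiction
    qed
  qed
  ultimately show ?thesis
    by (intro central_simple_algebra.intro central_simple_algebra_axioms.intro vectorspace_axioms A.ring_axioms
        smult_mult_left smult_mult_right) auto
qed

section \<open>The base field as an algebra, and trivial Brauer classes\<close>

lemma base_algebra_sel [simp]:
  "carrier (base_algebra K) = carrier K" "monoid.mult (base_algebra K) = (*)" "monoid.one (base_algebra K) = 1"
  "ring.zero (base_algebra K) = 0" "ring.add (base_algebra K) = (+)" "module.smult (base_algebra K) = (*)"
  by (simp_all add: base_algebra_def)

lemma base_k_algebra: "k_algebra K (base_algebra K)"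
proof (rule k_algebraI)
  show "field K" by (rule field_K)
  fix a assume "a \<in> carrier (base_algebra K)"
  thus "\<exists>b\<in>carrier (base_algebra K). b \<oplus>\<^bsub>base_algebra K\<^esub> a = \<zero>\<^bsub>base_algebra K\<^esub>"
    by (intro bexI[of _ "- a"]) auto
qed (auto simp: algebra_simps)

lemma base_finsum:
  assumes "finite I" "\<And>i. i \<in> I \<Longrightarrow> f i \<in> carrier K"
  shows "finsum (base_algebra K) f I = sum f I"
proof -
  interpret B: k_algebra K "base_algebra K" by (rule base_k_algebra)
  show ?thesis using assms
    by (induction I rule: finite_induct) (auto simp: B.M.finsum_insert Pi_def)
qed

lemma base_central_simple: "central_simple_algebra K (base_algebra K)"
proof (rule central_simple_of_matrix_iso[OF base_k_algebra, of 1 "\<lambda>a. Matrix.mat 1 1 (\<lambda>_. a)"])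
  show "k_algebra_hom K (base_algebra K) (mat_algebra 1) (\<lambda>a. Matrix.mat 1 1 (\<lambda>_. a))"
    unfolding k_algebra_hom_def by (auto intro!: eq_matI simp: scalar_prod_def)
  show "bij_betw (\<lambda>a. Matrix.mat 1 1 (\<lambda>_. a)) (carrier (base_algebra K)) (rational_mats 1)"
    by (rule bij_betw_byWitness[where f' = "\<lambda>M. M $$ (0, 0)"]) (auto simp: rational_mats_def intro!: eq_matI)
qed simp

text \<open>Equivalence with the base field is witnessed by the sizes 1 and \<open>N\<close>: a one
  by one matrix over \<open>A\<close> is its entry at \<open>(0, 0)\<close>, whose image under
  \<open>\<Phi>\<close> is a matrix over \<open>K\<close>.\<close>

lemma brauer_trivial_of_matrix_iso:
  fixes A :: "(complex, 'a, 'm) module_scheme"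
  assumes A: "k_algebra K A" and N: "N > 0" and \<Phi>: "k_algebra_hom K A (mat_algebra N) \<Phi>"
    and bij: "bij_betw \<Phi> (carrier A) (rational_mats N)"
  shows "brauer_trivial K A"
proof -
  interpret k_algebra K A by fact
  note hD = k_algebra_homD[OF \<Phi>]
  let ?I = "{..<N} \<times> {..<N}"
  let ?L = "matrix_algebra 1 A" and ?R = "matrix_algebra N (base_algebra K)"
  define f where "f M = (\<lambda>(i, j)\<in>?I. \<Phi> (M (0, 0)) $$ (i, j))" for M :: "nat \<times> nat \<Rightarrow> 'a"
  have L: "M (0, 0) \<in> carrier A" if "M \<in> carrier ?L" for M
    using that by (auto simp: matrix_algebra_def PiE_def Pi_def)
  have cl: "\<Phi> y \<in> carrier_mat N N" if "y \<in> carrier A" for y using hD(1)[OF that] by simp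
  have rat: "\<Phi> y $$ (r, s) \<in> carrier K" if "y \<in> carrier A" "r < N" "s < N" for y r s
    using bij that by (auto simp: bij_betw_def rational_mats_def)
  have one: "{..<1} \<times> {..<1} = {(0::nat, 0::nat)}" by auto
  have add: "f (M \<oplus>\<^bsub>?L\<^esub> M') = f M \<oplus>\<^bsub>?R\<^esub> f M'" if M: "M \<in> carrier ?L" "M' \<in> carrier ?L" for M M'
    using L[OF M(1)] L[OF M(2)] cl[OF L[OF M(1)]] cl[OF L[OF M(2)]] by (auto simp: f_def matrix_algebra_def fun_eq_iff hD)
  have smult: "f (a \<odot>\<^bsub>?L\<^esub> M) = a \<odot>\<^bsub>?R\<^esub> f M" if a: "a \<in> carrier K" and M: "M \<in> carrier ?L" for a M
    using L[OF M] a cl[OF L[OF M]] by (auto simp: f_def matrix_algebra_def fun_eq_iff hD)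
  have mult: "f (M \<otimes>\<^bsub>?L\<^esub> M') = f M \<otimes>\<^bsub>?R\<^esub> f M'" if M: "M \<in> carrier ?L" "M' \<in> carrier ?L" for M M'
  proof
    fix ij
    have prod: "(M \<otimes>\<^bsub>?L\<^esub> M') (0, 0) = M (0, 0) \<otimes>\<^bsub>A\<^esub> M' (0, 0)"
      using L[OF M(1)] L[OF M(2)] by (simp add: matrix_algebra_def lessThan_Suc)
    show "f (M \<otimes>\<^bsub>?L\<^esub> M') ij = (f M \<otimes>\<^bsub>?R\<^esub> f M') ij"
    proof (cases "ij \<in> ?I")
      case True
      then obtain i j where ij: "ij = (i, j)" "i < N" "j < N" by auto
      have "(f M \<otimes>\<^bsub>?R\<^esub> f M') ij = (\<Sum>l<N. \<Phi> (M (0, 0)) $$ (i, l) * \<Phi> (M' (0, 0)) $$ (l, j))"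
        using ij rat[OF L[OF M(1)]] rat[OF L[OF M(2)]]
        by (simp add: matrix_algebra_def f_def) (subst base_finsum, auto)
      also have "\<dots> = (\<Phi> (M (0, 0)) * \<Phi> (M' (0, 0))) $$ (i, j)"
        using ij carrier_matD[OF cl[OF L[OF M(1)]]] carrier_matD[OF cl[OF L[OF M(2)]]] by (simp add: scalar_prod_def atLeast0LessThan)
      also have "\<dots> = f (M \<otimes>\<^bsub>?L\<^esub> M') ij" unfolding f_def prod using ij L[OF M(1)] L[OF M(2)] by (simp add: hD)
      finally show ?thesis ..
    qed (auto simp: f_def matrix_algebra_def)
  qed
  have fone: "f \<one>\<^bsub>?L\<^esub> = \<one>\<^bsub>?R\<^esub>"
    by (auto simp: f_def matrix_algebra_def fun_eq_iff hD)
  have fcl: "f M \<in> carrier ?R" if M: "M \<in> carrier ?L" for M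
    using rat[OF L[OF M]] by (auto simp: f_def matrix_algebra_def)
  have "bij_betw f (carrier ?L) (carrier ?R)"
  proof (rule bij_betw_imageI)
    show "inj_on f (carrier ?L)"
    proof (rule inj_onI)
      fix M M' assume M: "M \<in> carrier ?L" "M' \<in> carrier ?L" and eq: "f M = f M'"
      have "\<Phi> (M (0, 0)) = \<Phi> (M' (0, 0))"
      proof (rule eq_matI)
        fix i j assume "i < dim_row (\<Phi> (M' (0, 0)))" "j < dim_col (\<Phi> (M' (0, 0)))"
        hence "i < N" "j < N" using cl[OF L[OF M(2)]] by auto
        thus "\<Phi> (M (0, 0)) $$ (i, j) = \<Phi> (M' (0, 0)) $$ (i, j)" using fun_cong[OF eq, of "(i, j)"] by (simp add: f_def)
      qed (use cl[OF L[OF M(1)]] cl[OF L[OF M(2)]] in auto)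
      hence "M (0, 0) = M' (0, 0)" using bij L[OF M(1)] L[OF M(2)] by (auto simp: bij_betw_def inj_on_def)
      thus "M = M'" using M unfolding matrix_algebra_def one by (auto simp: PiE_iff extensional_def fun_eq_iff) (metis gr0I)
    qed
    show "f ` carrier ?L = carrier ?R"
    proof
      show "carrier ?R \<subseteq> f ` carrier ?L"
      proof
        fix G assume G: "G \<in> carrier ?R"
        let ?M = "Matrix.mat N N G"
        have "?M \<in> rational_mats N" using G by (auto simp: rational_mats_def matrix_algebra_def PiE_iff)
        then obtain y where y: "y \<in> carrier A" "\<Phi> y = ?M" using bij unfolding bij_betw_def by (metis imageE)
        let ?X = "\<lambda>p\<in>{..<1} \<times> {..<1}. y"
        have "?X \<in> carrier ?L" using y by (auto simp: matrix_algebra_def)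
        moreover have "f ?X = G" using y G by (auto simp: f_def fun_eq_iff matrix_algebra_def PiE_iff extensional_def)
        ultimately show "G \<in> f ` carrier ?L" by blast
      qed
    qed (use fcl in auto)
  qed
  hence "f \<in> ring_iso ?L ?R \<inter> LinearCombinations.module_hom K ?L ?R"
    using fcl add mult smult fone by (auto simp: ring_iso_def Ring.ring_hom_def LinearCombinations.module_hom_def)
  hence "algebra_isomorphic K ?L ?R" unfolding algebra_isomorphic_def by blast
  moreover have "0 < (1::nat)" by simp
  ultimately show ?thesis
    unfolding brauer_trivial_def brauer_equivalent_def
    using central_simple_of_matrix_iso[OF assms] base_central_simple N by blast
qed

end

section \<open>Coordinates and traces\<close>

locale complex_space = complex_subfield K + W: vectorspace K W
  for K and W :: "(complex, 'w) module"
begin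

definition co :: "'w set \<Rightarrow> 'w \<Rightarrow> 'w \<Rightarrow> complex" where
  "co B w = (THE a. a \<in> B \<rightarrow>\<^sub>E carrier K \<and> W.lincomb a B = w)"

context
  fixes B assumes fin: "finite B" and basis: "W.basis B"
begin

lemma basis_closed: "B \<subseteq> carrier W" using basis by (simp add: W.basis_def)

lemma co_ex1: "w \<in> carrier W \<Longrightarrow> \<exists>!a. a \<in> B \<rightarrow>\<^sub>E carrier K \<and> W.lincomb a B = w"
  using W.basis_criterion[OF fin basis_closed] basis by blast

lemma co: assumes "w \<in> carrier W" shows "co B w \<in> B \<rightarrow>\<^sub>E carrier K" "W.lincomb (co B w) B = w"
  using theI'[OF co_ex1[OF assms]] unfolding co_def by auto

lemma co_closed: "w \<in> carrier W \<Longrightarrow> b \<in> B \<Longrightarrow> co B w b \<in> carrier K"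
  using co(1) by auto

lemma co_expand: "w \<in> carrier W \<Longrightarrow> w = (\<Oplus>\<^bsub>W\<^esub>b\<in>B. co B w b \<odot>\<^bsub>W\<^esub> b)"
  using co(2) by (simp add: W.lincomb_def)

lemma co_unique:
  assumes a: "\<And>b. b \<in> B \<Longrightarrow> a b \<in> carrier K" and w: "w = (\<Oplus>\<^bsub>W\<^esub>b\<in>B. a b \<odot>\<^bsub>W\<^esub> b)" and b: "b \<in> B"
  shows "co B w b = a b"
proof -
  have "w \<in> carrier W" unfolding w using a basis_closed by (intro W.M.finsum_closed) auto
  have "restrict a B \<in> B \<rightarrow>\<^sub>E carrier K" using a by auto
  moreover have "W.lincomb (restrict a B) B = w"
    unfolding W.lincomb_def w by (rule W.M.finsum_cong') (use a basis_closed in auto)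
  ultimately have "co B w = restrict a B" using co_ex1[OF \<open>w \<in> carrier W\<close>] co[OF \<open>w \<in> carrier W\<close>] by blast
  thus ?thesis using b by simp
qed

lemma co_add: assumes "v \<in> carrier W" "w \<in> carrier W" "b \<in> B" shows "co B (v \<oplus>\<^bsub>W\<^esub> w) b = co B v b + co B w b"
proof (rule co_unique[OF _ _ assms(3)])
  have "v \<oplus>\<^bsub>W\<^esub> w = (\<Oplus>\<^bsub>W\<^esub>b\<in>B. co B v b \<odot>\<^bsub>W\<^esub> b) \<oplus>\<^bsub>W\<^esub> (\<Oplus>\<^bsub>W\<^esub>b\<in>B. co B w b \<odot>\<^bsub>W\<^esub> b)"
    using co_expand assms by metis
  also have "\<dots> = (\<Oplus>\<^bsub>W\<^esub>b\<in>B. co B v b \<odot>\<^bsub>W\<^esub> b \<oplus>\<^bsub>W\<^esub> co B w b \<odot>\<^bsub>W\<^esub> b)"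
    by (rule W.M.finsum_addf[symmetric]) (use assms basis_closed co_closed in auto)
  also have "\<dots> = (\<Oplus>\<^bsub>W\<^esub>b\<in>B. (co B v b + co B w b) \<odot>\<^bsub>W\<^esub> b)"
  proof (rule W.M.finsum_cong')
    fix b assume "b \<in> B"
    thus "co B v b \<odot>\<^bsub>W\<^esub> b \<oplus>\<^bsub>W\<^esub> co B w b \<odot>\<^bsub>W\<^esub> b = (co B v b + co B w b) \<odot>\<^bsub>W\<^esub> b"
      using W.smult_l_distr[of "co B v b" "co B w b" b] assms basis_closed co_closed by auto
  qed (use assms basis_closed co_closed in \<open>auto intro!: W.smult_closed add_closed\<close>)
  finally show "v \<oplus>\<^bsub>W\<^esub> w = (\<Oplus>\<^bsub>W\<^esub>b\<in>B. (co B v b + co B w b) \<odot>\<^bsub>W\<^esub> b)" .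
qed (use assms co_closed in auto)

lemma co_smult: assumes "a \<in> carrier K" "w \<in> carrier W" "b \<in> B" shows "co B (a \<odot>\<^bsub>W\<^esub> w) b = a * co B w b"
proof (rule co_unique[OF _ _ assms(3)])
  have "a \<odot>\<^bsub>W\<^esub> w = a \<odot>\<^bsub>W\<^esub> (\<Oplus>\<^bsub>W\<^esub>b\<in>B. co B w b \<odot>\<^bsub>W\<^esub> b)"
    using co_expand assms by metis
  also have "\<dots> = (\<Oplus>\<^bsub>W\<^esub>b\<in>B. a \<odot>\<^bsub>W\<^esub> (co B w b \<odot>\<^bsub>W\<^esub> b))"
    by (rule W.finsum_smult) (use assms basis_closed co_closed in auto)
  also have "\<dots> = (\<Oplus>\<^bsub>W\<^esub>b\<in>B. (a * co B w b) \<odot>\<^bsub>W\<^esub> b)"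
  proof (rule W.M.finsum_cong')
    fix b assume "b \<in> B"
    thus "a \<odot>\<^bsub>W\<^esub> (co B w b \<odot>\<^bsub>W\<^esub> b) = (a * co B w b) \<odot>\<^bsub>W\<^esub> b"
      using W.smult_assoc1[of a "co B w b" b] assms basis_closed co_closed by auto
  qed (use assms basis_closed co_closed in \<open>auto intro!: W.smult_closed mult_closed\<close>)
  finally show "a \<odot>\<^bsub>W\<^esub> w = (\<Oplus>\<^bsub>W\<^esub>b\<in>B. (a * co B w b) \<odot>\<^bsub>W\<^esub> b)" .
qed (use assms co_closed in auto)

lemma co_finsum:
  assumes "finite I" "\<And>i. i \<in> I \<Longrightarrow> f i \<in> carrier W" "b \<in> B"
  shows "co B (\<Oplus>\<^bsub>W\<^esub>i\<in>I. f i) b = (\<Sum>i\<in>I. co B (f i) b)"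
  using assms(1,2)
proof (induction I rule: finite_induct)
  case empty
  have "co B \<zero>\<^bsub>W\<^esub> b = co B \<zero>\<^bsub>W\<^esub> b + co B \<zero>\<^bsub>W\<^esub> b" using co_add[of "\<zero>\<^bsub>W\<^esub>" "\<zero>\<^bsub>W\<^esub>" b] assms by simp
  thus ?case by simp
next
  case (insert i I)
  have "(\<Oplus>\<^bsub>W\<^esub>i\<in>insert i I. f i) = f i \<oplus>\<^bsub>W\<^esub> (\<Oplus>\<^bsub>W\<^esub>i\<in>I. f i)"
    using insert by (intro W.M.finsum_insert) auto
  moreover have "(\<Oplus>\<^bsub>W\<^esub>i\<in>I. f i) \<in> carrier W" using insert by (auto intro!: W.M.finsum_closed)
  ultimately show ?case using insert assms co_add by simp
qed

lemma co_basis: assumes "b \<in> B" "b' \<in> B" shows "co B b b' = (if b' = b then 1 else 0)"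
proof (rule co_unique[OF _ _ assms(2)])
  have "b = (\<Oplus>\<^bsub>W\<^esub>b'\<in>B. if b = b' then b' else \<zero>\<^bsub>W\<^esub>)"
    by (rule W.M.finsum_singleton[symmetric]) (use assms fin basis_closed in auto)
  also have "\<dots> = (\<Oplus>\<^bsub>W\<^esub>b'\<in>B. (if b' = b then 1 else 0) \<odot>\<^bsub>W\<^esub> b')"
    by (rule W.M.finsum_cong') (use basis_closed W.smult_one W.smult_l_null in auto)
  finally show "b = (\<Oplus>\<^bsub>W\<^esub>b'\<in>B. (if b' = b then 1 else 0) \<odot>\<^bsub>W\<^esub> b')" .
qed auto

lemma co_inject: assumes "v \<in> carrier W" "w \<in> carrier W" "\<And>b. b \<in> B \<Longrightarrow> co B v b = co B w b" shows "v = w"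
proof -
  have "v = (\<Oplus>\<^bsub>W\<^esub>b\<in>B. co B v b \<odot>\<^bsub>W\<^esub> b)" by (rule co_expand[OF assms(1)])
  also have "\<dots> = (\<Oplus>\<^bsub>W\<^esub>b\<in>B. co B w b \<odot>\<^bsub>W\<^esub> b)"
    by (rule W.M.finsum_cong') (use assms basis_closed co_closed in auto)
  also have "\<dots> = w" by (rule co_expand[OF assms(2), symmetric])
  finally show ?thesis .
qed

text \<open>The vector may be expanded in a finite set \<open>B'\<close> other than the basis
  \<open>B\<close> in which coordinates are taken; comparing traces in two bases needs this
  freedom.\<close>

lemma hom_expand:
  assumes T: "T \<in> LinearCombinations.module_hom K W W" and w: "w \<in> carrier W" and b: "b \<in> B"
    and B': "finite B'" "B' \<subseteq> carrier W" "w = (\<Oplus>\<^bsub>W\<^esub>x\<in>B'. a x \<odot>\<^bsub>W\<^esub> x)" "\<And>x. x \<in> B' \<Longrightarrow> a x \<in> carrier K"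
  shows "co B (T w) b = (\<Sum>x\<in>B'. a x * co B (T x) b)"
proof -
  note Tc = LinearCombinations.module_hom_closed[OF T] and Ta = LinearCombinations.module_hom_add[OF T] and Ts = LinearCombinations.module_hom_smult[OF T]
  have T0: "T \<zero>\<^bsub>W\<^esub> = \<zero>\<^bsub>W\<^esub>"
  proof -
    have "T \<zero>\<^bsub>W\<^esub> = T (\<zero>\<^bsub>K\<^esub> \<odot>\<^bsub>W\<^esub> \<zero>\<^bsub>W\<^esub>)" using W.smult_l_null[of "\<zero>\<^bsub>W\<^esub>"] by simp
    also have "\<dots> = \<zero>\<^bsub>W\<^esub>" using Ts[of "\<zero>\<^bsub>K\<^esub>" "\<zero>\<^bsub>W\<^esub>"] W.smult_l_null[of "T \<zero>\<^bsub>W\<^esub>"] Tc by auto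
    finally show ?thesis .
  qed
  have "T (\<Oplus>\<^bsub>W\<^esub>x\<in>C. a x \<odot>\<^bsub>W\<^esub> x) = (\<Oplus>\<^bsub>W\<^esub>x\<in>C. a x \<odot>\<^bsub>W\<^esub> T x)" if "finite C" "C \<subseteq> B'" for C
    using that
  proof (induction C rule: finite_induct)
    case (insert x C)
    have mem: "a y \<odot>\<^bsub>W\<^esub> y \<in> carrier W \<and> a y \<odot>\<^bsub>W\<^esub> T y \<in> carrier W" if "y \<in> insert x C" for y
    proof -
      have "y \<in> B'" using that insert by auto
      thus ?thesis using B'(2,4) Tc by (intro conjI W.smult_closed) auto
    qed
    have *: "(\<Oplus>\<^bsub>W\<^esub>x\<in>insert x C. a x \<odot>\<^bsub>W\<^esub> x) = a x \<odot>\<^bsub>W\<^esub> x \<oplus>\<^bsub>W\<^esub> (\<Oplus>\<^bsub>W\<^esub>x\<in>C. a x \<odot>\<^bsub>W\<^esub> x)"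
      "(\<Oplus>\<^bsub>W\<^esub>x\<in>insert x C. a x \<odot>\<^bsub>W\<^esub> T x) = a x \<odot>\<^bsub>W\<^esub> T x \<oplus>\<^bsub>W\<^esub> (\<Oplus>\<^bsub>W\<^esub>x\<in>C. a x \<odot>\<^bsub>W\<^esub> T x)"
      using insert.hyps mem by (auto intro!: W.M.finsum_insert)
    have "(\<Oplus>\<^bsub>W\<^esub>x\<in>C. a x \<odot>\<^bsub>W\<^esub> x) \<in> carrier W" "x \<in> carrier W" "a x \<in> carrier K"
      using insert.prems B' mem by (auto intro!: W.M.finsum_closed)
    thus ?case unfolding * using insert by (simp add: Ta Ts)
  qed (simp add: T0)
  from this[OF B'(1) subset_refl] have "T w = (\<Oplus>\<^bsub>W\<^esub>x\<in>B'. a x \<odot>\<^bsub>W\<^esub> T x)" using B'(3) by simp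
  hence "co B (T w) b = (\<Sum>x\<in>B'. co B (a x \<odot>\<^bsub>W\<^esub> T x) b)"
    using co_finsum[OF B'(1), of "\<lambda>x. a x \<odot>\<^bsub>W\<^esub> T x" b] B' Tc b by auto
  also have "\<dots> = (\<Sum>x\<in>B'. a x * co B (T x) b)"
    by (intro sum.cong refl co_smult b) (use B' Tc in auto)
  finally show ?thesis .
qed

end

text \<open>\<open>has_trace\<close> allows an arbitrary finite basis. Independence of the choice
  follows by writing both traces as one double sum over the two bases.\<close>

lemma has_trace_eq:
  assumes B: "finite B" "W.basis B" and T: "T \<in> LinearCombinations.module_hom K W W" and tr: "has_trace K W T t"
  shows "t = (\<Sum>b\<in>B. co B (T b) b)"
proof -
  obtain B' c where B': "finite B'" "W.basis B'"
    and c: "\<And>b. b \<in> B' \<Longrightarrow> c b \<in> B' \<rightarrow> carrier K" "\<And>b. b \<in> B' \<Longrightarrow> T b = W.lincomb (c b) B'"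
    and t: "t = (\<Oplus>\<^bsub>K\<^esub>b\<in>B'. c b b)"
    using tr unfolding has_trace_def by blast
  note Bc = basis_closed[OF B] and B'c = basis_closed[OF B'] and Tc = LinearCombinations.module_hom_closed[OF T]
  have id: "(\<lambda>w. w) \<in> LinearCombinations.module_hom K W W" by (simp add: LinearCombinations.module_hom_def)
  have "t = (\<Sum>b'\<in>B'. c b' b')" unfolding t using c by (intro finsum_eq B') auto
  also have "\<dots> = (\<Sum>b'\<in>B'. co B' (T b') b')"
  proof (intro sum.cong refl)
    fix b' assume b': "b' \<in> B'"
    have "T b' = (\<Oplus>\<^bsub>W\<^esub>b\<in>B'. c b' b \<odot>\<^bsub>W\<^esub> b)" using c(2)[OF b'] by (simp add: W.lincomb_def)
    from co_unique[OF B' _ this b'] c(1)[OF b'] show "c b' b' = co B' (T b') b'" by (simp add: Pi_def)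
  qed
  also have "\<dots> = (\<Sum>b'\<in>B'. \<Sum>b\<in>B. co B b' b * co B' (T b) b')"
    by (intro sum.cong refl hom_expand[OF B' T] B co_expand[OF B] co_closed[OF B]) (use Bc B'c in auto)
  also have "\<dots> = (\<Sum>b\<in>B. \<Sum>b'\<in>B'. co B' (T b) b' * co B b' b)"
    by (subst sum.swap) (simp add: mult.commute)
  also have "\<dots> = (\<Sum>b\<in>B. co B (T b) b)"
  proof (intro sum.cong refl)
    fix b assume b: "b \<in> B"
    have Tb: "T b \<in> carrier W" using Tc Bc b by auto
    \<comment> \<open>The vector \<open>T b\<close> is expanded in \<open>B'\<close> and its
      coordinate in \<open>B\<close> is read off, which is \<open>hom_expand\<close> for the
      identity map.\<close>
    show "(\<Sum>b'\<in>B'. co B' (T b) b' * co B b' b) = co B (T b) b"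
      by (rule hom_expand[OF B id Tb b B'(1) B'c co_expand[OF B' Tb], symmetric]) (rule co_closed[OF B' Tb])
  qed
  finally show ?thesis .
qed

end

section \<open>Quadratic spaces in coordinates\<close>

text \<open>Indexing the basis by a finite type turns endomorphisms of \<open>W\<close> into
  matrices of type \<open>complex^'n^'n\<close>, to which the results on idempotents apply.\<close>

locale coord_space = complex_space K W for K and W :: "(complex, 'w) module" +
  fixes B :: "'w set" and \<beta> :: "'n::finite \<Rightarrow> 'w"
  assumes fin: "finite B" and basis: "W.basis B" and bij: "bij_betw \<beta> UNIV B"
begin

lemma beta_mem [simp]: "\<beta> i \<in> B" using bij by (auto simp: bij_betw_def)
lemma beta_closed [simp]: "\<beta> i \<in> carrier W" using basis_closed[OF fin basis] by auto
lemma beta_inj [simp]: "\<beta> i = \<beta> j \<longleftrightarrow> i = j" using bij by (auto simp: bij_betw_def inj_on_def)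
lemma sum_beta: "(\<Sum>b\<in>B. g b) = (\<Sum>i\<in>UNIV. g (\<beta> i))" for g :: "'w \<Rightarrow> complex"
  by (rule sum.reindex_bij_betw[OF bij, symmetric])
lemma beta_cases: "b \<in> B \<Longrightarrow> \<exists>i. b = \<beta> i" using bij by (auto simp: bij_betw_def)

lemmas cof = co_closed[OF fin basis] co_add[OF fin basis] co_smult[OF fin basis]
  co_basis[OF fin basis] co_finsum[OF fin basis]

definition kap :: "'w \<Rightarrow> complex^'n" where "kap w = vec_lambda (\<lambda>i. co B w (\<beta> i))"
definition to_W :: "complex^'n \<Rightarrow> 'w" where "to_W v = (\<Oplus>\<^bsub>W\<^esub>b\<in>B. v $h (the_inv \<beta> b) \<odot>\<^bsub>W\<^esub> b)"
definition mat_of :: "('w \<Rightarrow> 'w) \<Rightarrow> complex^'n^'n" where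
  "mat_of T = vec_lambda (\<lambda>i. vec_lambda (\<lambda>j. co B (T (\<beta> j)) (\<beta> i)))"

lemma kap_nth [simp]: "kap w $h i = co B w (\<beta> i)" by (simp add: kap_def)

lemma kap_inject: "v \<in> carrier W \<Longrightarrow> w \<in> carrier W \<Longrightarrow> kap v = kap w \<Longrightarrow> v = w"
  by (rule co_inject[OF fin basis]) (auto dest!: beta_cases simp: vec_eq_iff)

lemma to_W: assumes "\<And>i. v $h i \<in> carrier K" shows "to_W v \<in> carrier W" "kap (to_W v) = v"
proof -
  have inv: "the_inv \<beta> (\<beta> i) = i" for i by (rule the_inv_f_f) (simp add: inj_def)
  show "to_W v \<in> carrier W" unfolding to_W_def
    by (rule W.M.finsum_closed) (use assms basis_closed[OF fin basis] in auto)
  have "co B (to_W v) (\<beta> i) = v $h i" for i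
    using co_unique[OF fin basis _ to_W_def beta_mem, of v i] assms by (simp add: inv)
  thus "kap (to_W v) = v" by (simp add: vec_eq_iff)
qed

lemma kap_hom:
  assumes T: "T \<in> LinearCombinations.module_hom K W W" and w: "w \<in> carrier W"
  shows "kap (T w) = mat_of T *v kap w"
proof -
  have "co B (T w) (\<beta> i) = (\<Sum>j\<in>UNIV. co B w (\<beta> j) * co B (T (\<beta> j)) (\<beta> i))" for i
    using hom_expand[OF fin basis T w beta_mem fin basis_closed[OF fin basis] co_expand[OF fin basis w] cof(1)[OF w]]
    by (simp add: sum_beta)
  thus ?thesis by (simp add: vec_eq_iff matrix_vector_mult_def mat_of_def mult.commute)
qed

lemma mat_of_K: "T \<in> LinearCombinations.module_hom K W W \<Longrightarrow> mat_of T $h i $h j \<in> carrier K"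
  using LinearCombinations.module_hom_closed[of T K W W] by (auto simp: mat_of_def intro!: cof)

lemma mat_of_comp:
  assumes T: "T \<in> LinearCombinations.module_hom K W W" and T': "T' \<in> LinearCombinations.module_hom K W W"
    and eq: "\<And>w. w \<in> carrier W \<Longrightarrow> T'' w = T (T' w)"
  shows "mat_of T'' = mat_of T ** mat_of T'"
proof -
  have "T' (\<beta> j) \<in> carrier W" for j using LinearCombinations.module_hom_closed[OF T'] by auto
  hence "co B (T'' (\<beta> j)) (\<beta> i) = (mat_of T *v kap (T' (\<beta> j))) $h i" for i j
    using kap_hom[OF T, of "T' (\<beta> j)"] eq[of "\<beta> j"] by (metis kap_nth beta_closed)
  thus ?thesis by (simp add: vec_eq_iff matrix_matrix_mult_def matrix_vector_mult_def mat_of_def)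
qed

lemma mat_of_id: "(\<And>w. w \<in> carrier W \<Longrightarrow> T w = w) \<Longrightarrow> mat_of T = mat 1"
  by (simp add: vec_eq_iff mat_of_def mat_def cof)

lemma trace_mat_of:
  assumes "T \<in> LinearCombinations.module_hom K W W" "has_trace K W T t"
  shows "trace (mat_of T) = t"
  using has_trace_eq[OF fin basis assms] by (simp add: trace_def mat_of_def sum_beta)

end

locale quad_coord = quadratic_space K W F + coord_space K W B \<beta>
  for K and W :: "(complex, 'w) module" and F B and \<beta> :: "'n::finite \<Rightarrow> 'w"
begin

text \<open>The complex bilinear extension of \<open>F\<close> in coordinates; rationality is
  tracked separately, by \<open>FV_K\<close>.\<close>

definition FV :: "complex^'n \<Rightarrow> complex^'n \<Rightarrow> complex" where
  "FV v w = (\<Sum>i\<in>UNIV. \<Sum>j\<in>UNIV. v $h i * w $h j * F (\<beta> i) (\<beta> j))"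

lemma F_kap: assumes v: "v \<in> carrier W" and w: "w \<in> carrier W" shows "F v w = FV (kap v) (kap w)"
proof -
  have expand: "F v w = (\<Sum>i\<in>UNIV. co B v (\<beta> i) * F (\<beta> i) w)" if "v \<in> carrier W" "w \<in> carrier W" for v w
  proof -
    have "F v w = F (\<Oplus>\<^bsub>W\<^esub>b\<in>B. co B v b \<odot>\<^bsub>W\<^esub> b) w" using co_expand[OF fin basis that(1)] by simp
    also have "\<dots> = (\<Sum>b\<in>B. F (co B v b \<odot>\<^bsub>W\<^esub> b) w)"
      by (rule F_finsum[OF fin]) (use that cof basis_closed[OF fin basis] in auto)
    also have "\<dots> = (\<Sum>i\<in>UNIV. F (co B v (\<beta> i) \<odot>\<^bsub>W\<^esub> \<beta> i) w)" by (rule sum_beta)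
    finally show ?thesis using that by (simp add: F_smult cof)
  qed
  have "F v w = (\<Sum>i\<in>UNIV. co B v (\<beta> i) * F w (\<beta> i))"
    using expand[OF v w] F_sym[OF w beta_closed] by simp
  also have "\<dots> = (\<Sum>i\<in>UNIV. co B v (\<beta> i) * (\<Sum>j\<in>UNIV. co B w (\<beta> j) * F (\<beta> i) (\<beta> j)))"
    using expand[OF w beta_closed] F_sym[OF beta_closed beta_closed] by (metis (no_types, lifting) sum.cong)
  finally show ?thesis by (simp add: FV_def sum_distrib_left mult.assoc)
qed

lemma FV_K: "(\<And>i. v $h i \<in> carrier K) \<Longrightarrow> (\<And>i. w $h i \<in> carrier K) \<Longrightarrow> FV v w \<in> carrier K"
  unfolding FV_def by (intro sum_closed mult_closed F_closed) auto

lemma FV_add: "FV (v + v') w = FV v w + FV v' w"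
  by (simp add: FV_def distrib_right sum.distrib)

lemma FV_scale: "FV (a *s v) w = a * FV v w"
  by (simp add: FV_def sum_distrib_left mult.assoc)

lemma FV_sym: "FV v w = FV w v"
  unfolding FV_def by (subst sum.swap) (simp add: F_sym[OF beta_closed beta_closed] mult_ac)

lemma FV_sum: "FV (\<Sum>x\<in>A. f x) w = (\<Sum>x\<in>A. FV (f x) w)"
proof (induction A rule: infinite_finite_induct)
  case (insert x A)
  thus ?case by (simp add: FV_add)
qed (use FV_scale[of 0 0 w] in simp_all)

lemma FV_axis: "FV (axis i 1) (axis j 1) = F (\<beta> i) (\<beta> j)"
proof -
  have "kap (\<beta> k) = axis k 1" for k by (simp add: vec_eq_iff axis_def cof)
  thus ?thesis using F_kap[of "\<beta> i" "\<beta> j"] by simp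
qed

lemma FV_expand: "FV v w = (\<Sum>i\<in>UNIV. v $h i * FV (axis i 1) w)"
  by (subst basis_expansion[of v, symmetric]) (simp add: FV_sum FV_scale)

text \<open>Invariance is given on \<open>W\<close>, that is, for coordinates in \<open>K\<close>.
  It is tested on unit vectors and spread to complex coordinates by bilinearity.\<close>

lemma FV_invariant:
  assumes T: "T \<in> LinearCombinations.module_hom K W W"
    and inv: "\<And>v w. v \<in> carrier W \<Longrightarrow> w \<in> carrier W \<Longrightarrow> F (T v) (T w) = F v w"
  shows "FV (mat_of T *v v) (mat_of T *v w) = FV v w"
proof -
  let ?A = "mat_of T"
  have Tb: "T (\<beta> i) \<in> carrier W" for i using LinearCombinations.module_hom_closed[OF T] by auto
  have "kap (\<beta> k) = axis k 1" for k by (simp add: vec_eq_iff axis_def cof)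
  hence base: "FV (?A *v axis i 1) (?A *v axis j 1) = FV (axis i 1) (axis j 1)" for i j
    using F_kap[OF Tb[of i] Tb[of j]] kap_hom[OF T beta_closed[of i]] kap_hom[OF T beta_closed[of j]]
      inv[of "\<beta> i" "\<beta> j"] F_kap[of "\<beta> i" "\<beta> j"] by simp
  have mv: "?A *v v = (\<Sum>i\<in>UNIV. v $h i *s (?A *v axis i 1))" for v
    by (simp add: vec_eq_iff matrix_vector_mult_def axis_def mult.commute if_distrib cong: if_cong)
  have one: "FV (?A *v v) z = (\<Sum>i\<in>UNIV. v $h i * FV (?A *v axis i 1) z)" for v z
    by (subst mv) (simp add: FV_sum FV_scale)
  have "FV (?A *v v) (?A *v w) = (\<Sum>i\<in>UNIV. v $h i * (\<Sum>j\<in>UNIV. w $h j * FV (?A *v axis i 1) (?A *v axis j 1)))"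
    using one[of v "?A *v w"] one[of w] FV_sym by (metis (no_types, lifting) sum.cong)
  also have "\<dots> = (\<Sum>i\<in>UNIV. v $h i * (\<Sum>j\<in>UNIV. w $h j * FV (axis i 1) (axis j 1)))" by (simp add: base)
  also have "\<dots> = FV v w" unfolding FV_axis unfolding FV_def by (simp add: sum_distrib_left mult.assoc)
  finally show ?thesis .
qed

text \<open>Orthogonality says that \<open>P\<close>, which computes coefficients, is a left inverse
  of the matrix \<open>Q\<close> with columns \<open>e i\<close>. Both are square, so it is also a
  right inverse, and this is the expansion.\<close>

lemma orthogonal_expansion:
  fixes e :: "'n \<Rightarrow> complex^'n"
  assumes d: "\<And>i. d i \<noteq> 0" and e: "\<And>i j. FV (e i) (e j) = (if i = j then d i else 0)"
  shows "v = (\<Sum>i\<in>UNIV. (FV v (e i) / d i) *s e i)"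
proof -
  define P :: "complex^'n^'n" where "P = vec_lambda (\<lambda>i. vec_lambda (\<lambda>k. FV (axis k 1) (e i) / d i))"
  define Q :: "complex^'n^'n" where "Q = vec_lambda (\<lambda>k. vec_lambda (\<lambda>i. e i $h k))"
  have P: "(\<Sum>k\<in>UNIV. P $h i $h k * v $h k) = FV v (e i) / d i" for i v
    unfolding FV_expand[of v] by (simp add: P_def sum_divide_distrib mult.commute)
  have "P ** Q = mat 1"
  proof -
    have "(P ** Q) $h i $h j = (if i = j then 1 else 0)" for i j
      using P[of i "e j"] e[of j i] d[of i] by (auto simp: matrix_matrix_mult_def Q_def)
    thus ?thesis by (simp add: vec_eq_iff mat_def)
  qed
  hence "Q ** P = mat 1" by (simp add: matrix_left_right_inverse)
  hence "v = Q *v (P *v v)" by (simp add: matrix_vector_mul_assoc)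
  also have "\<dots> = (\<Sum>i\<in>UNIV. (FV v (e i) / d i) *s e i)"
    by (simp add: vec_eq_iff matrix_vector_mult_def P) (simp add: Q_def mult.commute)
  finally show ?thesis .
qed

text \<open>The vector \<open>e z\<close> of norm \<open>c0\<close> is represented by a multiple of
  the chirality matrix, the others by multiples of the generators of a chiral system. The sizes fit:
  \<open>N = 16 ^ m\<close> has square \<open>2 ^ (8 * m)\<close>, the number of even monomials in
  \<open>8 * m + 1\<close> generators.\<close>

lemma brauer_trivial_of_orthogonal_basis:
  fixes e :: "'n \<Rightarrow> complex^'n"
  assumes e_K: "\<And>i k. e i $h k \<in> carrier K" and c: "c \<noteq> 0" "c0 \<noteq> 0"
    and e: "\<And>i j. FV (e i) (e j) = (if i = j then (if i = z then c0 else c) else 0)"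
    and card: "CARD('n) = 8 * m + 1"
  shows "brauer_trivial K (even_clifford_algebra K W F)"
proof -
  define p N where "p = 8 * m + 1" and "N = (16::nat) ^ m"
  have "card (UNIV - {z}) = 8 * m" using card by simp
  then obtain h where h: "bij_betw h {..<8 * m} (UNIV - {z})"
    using ex_bij_betw_nat_finite[of "UNIV - {z}"] by (auto simp: atLeast0LessThan)
  \<comment> \<open>Position 0 is reserved for the distinguished index \<open>z\<close>; the blocks
    of eight start at position 1.\<close>
  define \<sigma> where "\<sigma> j = (case j of 0 \<Rightarrow> z | Suc j \<Rightarrow> h j)" for j
  have \<sigma>_bij: "bij_betw \<sigma> {..<p} UNIV"
  proof (rule bij_betw_imageI)
    have hz: "h j \<noteq> z" if "j < 8 * m" for j using h that by (auto simp: bij_betw_def)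
    have "inj_on h {..<8 * m}" using h by (simp add: bij_betw_def)
    thus "inj_on \<sigma> {..<p}" using hz unfolding inj_on_def
      by (auto simp: \<sigma>_def p_def split: nat.splits)
    show "\<sigma> ` {..<p} = UNIV"
    proof -
      have "i \<in> \<sigma> ` {..<p}" for i
      proof (cases "i = z")
        case True
        thus ?thesis by (auto simp: \<sigma>_def p_def intro!: image_eqI[of _ _ 0])
      next
        case False
        then obtain j where "j < 8 * m" "i = h j" using h by (auto simp: bij_betw_def)
        thus ?thesis by (auto simp: \<sigma>_def p_def intro!: image_eqI[of _ _ "Suc j"])
      qed
      thus ?thesis by blast
    qed
  qed
  have \<sigma>_eq: "\<sigma> i = \<sigma> j \<longleftrightarrow> i = j" if "i < p" "j < p" for i j
    using \<sigma>_bij that by (auto simp: bij_betw_def inj_on_def)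
  have \<sigma>_z: "\<sigma> j = z \<longleftrightarrow> j = 0" if "j < p" for j
    using \<sigma>_eq[of j 0] that by (auto simp: \<sigma>_def p_def)
  define d where "d i = (if i = z then c0 else c)" for i
  define ew where "ew j = to_W (e (\<sigma> j))" for j
  have ew: "ew j \<in> carrier W" "kap (ew j) = e (\<sigma> j)" for j
    using to_W[of "e (\<sigma> j)"] e_K by (auto simp: ew_def)
  have F_ew: "F (ew i) (ew j) = (if i = j then (if i = 0 then c0 else c) else 0)" if "i < p" "j < p" for i j
    using F_kap[OF ew(1) ew(1), of i j] e \<sigma>_eq[OF that] \<sigma>_z[OF that(1)] by (auto simp: ew(2))
  have expand: "w = (\<Oplus>\<^bsub>W\<^esub>j\<in>{..<p}. (F w (ew j) / F (ew j) (ew j)) \<odot>\<^bsub>W\<^esub> ew j)" if w: "w \<in> carrier W" for w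
  proof (rule kap_inject[OF w])
    have cl: "F w (ew j) / F (ew j) (ew j) \<in> carrier K" for j using w ew by (auto simp: F_closed)
    show "(\<Oplus>\<^bsub>W\<^esub>j\<in>{..<p}. (F w (ew j) / F (ew j) (ew j)) \<odot>\<^bsub>W\<^esub> ew j) \<in> carrier W"
      using cl ew by (intro W.M.finsum_closed) auto
    have "kap w = (\<Sum>i\<in>UNIV. (FV (kap w) (e i) / d i) *s e i)"
      by (rule orthogonal_expansion) (use c e in \<open>auto simp: d_def\<close>)
    also have "\<dots> = (\<Sum>j<p. (FV (kap w) (e (\<sigma> j)) / d (\<sigma> j)) *s e (\<sigma> j))"
      by (rule sum.reindex_bij_betw[OF \<sigma>_bij, symmetric])
    also have "\<dots> = (\<Sum>j<p. (F w (ew j) / F (ew j) (ew j)) *s kap (ew j))"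
      by (intro sum.cong refl) (use F_kap[OF w ew(1)] F_ew \<sigma>_z in \<open>auto simp: ew(2) d_def\<close>)
    also have "\<dots> = kap (\<Oplus>\<^bsub>W\<^esub>j\<in>{..<p}. (F w (ew j) / F (ew j) (ew j)) \<odot>\<^bsub>W\<^esub> ew j)"
      using cl ew by (simp add: vec_eq_iff cof)
    finally show "kap w = kap (\<Oplus>\<^bsub>W\<^esub>j\<in>{..<p}. (F w (ew j) / F (ew j) (ew j)) \<odot>\<^bsub>W\<^esub> ew j)" .
  qed
  have cK: "c0 \<in> carrier K" "8 * m > 0 \<Longrightarrow> c \<in> carrier K"
    using F_closed[OF ew(1) ew(1), of 0 0] F_closed[OF ew(1) ew(1), of 1 1] F_ew[of 0 0] F_ew[of 1 1] by (auto simp: p_def)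
  \<comment> \<open>After multiplication by a root of \<open>c0 / 2\<close>, square 1 becomes
    \<open>c0 / 2\<close> and square \<open>c / c0\<close> becomes \<open>c / 2\<close>. For
    \<open>m = 0\<close> no basis vector has norm \<open>c\<close>, so \<open>c\<close> is not known
    to lie in \<open>K\<close>, and 1 is a placeholder.\<close>
  define k where "k = (if m = 0 then 1 else c / c0)"
  have kK: "k \<in> carrier K" using cK by (auto simp: k_def)
  obtain Om et where sys: "chiral_system (carrier K) k N (8 * m) Om et"
    using exists_chiral_system[of "carrier K" k m] kK by (auto simp: N_def)
  define \<theta> where "\<theta> = csqrt (c0 / 2)"
  have \<theta>: "\<theta> * \<theta> = c0 / 2" by (simp add: \<theta>_def flip: power2_eq_square)
  define H where "H j = (case j of 0 \<Rightarrow> Om | Suc j \<Rightarrow> et j)" for j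
  \<comment> \<open>The factor \<open>\<theta>\<close> need not lie in \<open>K\<close>: only products of evenly many \<open>\<Gamma> j\<close> have to be rational.\<close>
  define \<Gamma> where "\<Gamma> j = \<theta> \<cdot>\<^sub>m H j" for j
  have H: "H j \<in> carrier_mat N N" "\<forall>r<N. \<forall>s<N. H j $$ (r, s) \<in> carrier K"
    "H j * H j = (if j = 0 then 1 else k) \<cdot>\<^sub>m 1\<^sub>m N" if "j < p" for j
    using sys that by (auto simp: chiral_system_def H_def p_def one_smult_mat split: nat.splits)
  have H_anti: "H i * H j = (-1) \<cdot>\<^sub>m (H j * H i)" if ij: "i < p" "j < p" "i \<noteq> j" for i j
  proof (cases i)
    case 0
    then obtain j' where j: "j = Suc j'" "j' < 8 * m" using ij by (cases j) (auto simp: p_def)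
    have eq: "et j' * Om = (-1) \<cdot>\<^sub>m (Om * et j')" using sys j unfolding chiral_system_def by blast
    show ?thesis unfolding 0 j H_def by (simp add: eq smult_smult_mat one_smult_mat)
  next
    case (Suc i')
    show ?thesis
    proof (cases j)
      case 0
      have "et i' * Om = (-1) \<cdot>\<^sub>m (Om * et i')" using sys Suc ij(1) unfolding chiral_system_def p_def by auto
      thus ?thesis by (simp add: 0 Suc H_def)
    next
      case (Suc j')
      have "i' < 8 * m" "j' < 8 * m" "i' \<noteq> j'" using ij \<open>i = Suc i'\<close> Suc by (auto simp: p_def)
      hence "et i' * et j' = (-1) \<cdot>\<^sub>m (et j' * et i')" using sys unfolding chiral_system_def by blast
      thus ?thesis by (simp add: \<open>i = Suc i'\<close> Suc H_def)
    qed
  qed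
  have \<Gamma>_mult: "\<Gamma> i * \<Gamma> j = (c0 / 2) \<cdot>\<^sub>m (H i * H j)" if "i < p" "j < p" for i j
    using mult_smult_distrib[OF smult_carrier_mat[OF H(1)[OF that(1)]] H(1)[OF that(2)]]
      mult_smult_assoc_mat[OF H(1)[OF that(1)] H(1)[OF that(2)]]
    by (simp add: \<Gamma>_def smult_smult_mat \<theta>)
  interpret clifford_rep K W F \<Gamma> N p ew
  proof unfold_locales
    show "N > 0" by (simp add: N_def)
    have "N * N = (2 ^ 4) ^ (m + m)" by (simp add: N_def power_add)
    also have "\<dots> = 2 ^ (8 * m)" by (subst power_mult[symmetric]) simp
    finally show "N * N = 2 ^ (p - 1)" by (simp add: p_def)
    show "p > 0" by (simp add: p_def)
    show "F (ew j) (ew j) / 2 \<in> carrier K" for j using ew by (auto simp: F_closed)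
    show "F (ew j) (ew j) / 2 \<noteq> 0" if "j < p" for j using F_ew[OF that that] c by simp
    show "\<Gamma> j \<in> carrier_mat N N" if "j < p" for j using H(1)[OF that] by (simp add: \<Gamma>_def)
    show "\<Gamma> i * \<Gamma> j = - (\<Gamma> j * \<Gamma> i)" if "i < p" "j < p" "i \<noteq> j" for i j
      unfolding \<Gamma>_mult[OF that(1,2)] \<Gamma>_mult[OF that(2,1)] H_anti[OF that] by (rule eq_matI) auto
    show "\<Gamma> j * \<Gamma> j = (F (ew j) (ew j) / 2) \<cdot>\<^sub>m 1\<^sub>m N" if "j < p" for j
      unfolding \<Gamma>_mult[OF that that] H(3)[OF that] F_ew[OF that that] smult_smult_mat
      using c that by (auto simp: k_def p_def)
    show "(\<Gamma> i * \<Gamma> j) $$ (r, s) \<in> carrier K" if "i < p" "j < p" "r < N" "s < N" for i j r s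
    proof -
      have "(\<Gamma> i * \<Gamma> j) $$ (r, s) = c0 / 2 * (\<Sum>l<N. H i $$ (r, l) * H j $$ (l, s))"
        using that carrier_matD[OF H(1)[OF that(1)]] carrier_matD[OF H(1)[OF that(2)]]
        by (simp add: \<Gamma>_mult scalar_prod_def atLeast0LessThan)
      also have "\<dots> \<in> carrier K"
        using H(2)[OF that(1)] H(2)[OF that(2)] that(3,4) cK(1) by (intro mult_closed sum_closed divide_closed) auto
      finally show ?thesis .
    qed
    show "ew j \<in> carrier W" for j by (rule ew)
    show "F (ew i) (ew j) = 0" if "i < p" "j < p" "i \<noteq> j" for i j using F_ew[OF that(1,2)] that by simp
  qed (rule expand)
  obtain \<Phi> where "k_algebra_hom K C0 (mat_algebra N) \<Phi>" "bij_betw \<Phi> (carrier C0) (rational_mats N)"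
    using even_clifford_iso by blast
  thus ?thesis by (rule brauer_trivial_of_matrix_iso[OF C0_k_algebra N])
qed

end

section \<open>The group and its character\<close>

definition unip :: "'f::field \<Rightarrow> 'f mat" where "unip x = m2 1 0 x 1"
definition tor :: "'f::field \<Rightarrow> 'f mat" where "tor y = m2 y 0 0 (inverse y)"
definition weyl :: "'f::field mat" where "weyl = m2 0 1 1 0"

lemmas sl2_elt_defs = unip_def tor_def weyl_def

lemma det_m2_triangular: "Determinant.det (m2 a 0 c d) = a * d" "Determinant.det (m2 a b 0 d) = a * d" for a b c d :: "'f::field"
proof -
  have diag: "prod_list (diag_mat (m2 a b c d)) = a * d" for b c
    by (simp add: m2_def diag_mat_def numeral_2_eq_2)
  show "Determinant.det (m2 a 0 c d) = a * d"
    by (subst Determinant.det_lower_triangular[OF _ m2_closed]) (auto simp: diag, auto simp: m2_def)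
  show "Determinant.det (m2 a b 0 d) = a * d"
    by (subst Determinant.det_upper_triangular[OF _ m2_closed]) (auto simp: diag, auto simp: m2_def)
qed

lemma sl2_elts:
  "unip x \<in> carrier SL2" "y \<noteq> 0 \<Longrightarrow> tor y \<in> carrier SL2"
  "(1::'f::field) + 1 = 0 \<Longrightarrow> (weyl :: 'f mat) \<in> carrier SL2"
proof -
  show "unip x \<in> carrier SL2" "y \<noteq> 0 \<Longrightarrow> tor y \<in> carrier SL2"
    by (simp_all add: SL2_def unip_def tor_def m2_closed det_m2_triangular)
  assume 2: "(1::'f) + 1 = 0"
  \<comment> \<open>The product of three triangular matrices below has the entries 2 and 3, which
    are 0 and 1 here; this computes the determinant of the Weyl matrix.\<close>
  have "(2::'f) = 0" using 2 by simp
  moreover have "(3::'f) = 2 + 1" by simp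
  ultimately have eq: "(weyl :: 'f mat) = unip 1 * m2 1 1 0 1 * unip 1" by (simp add: sl2_elt_defs m2_mult)
  have "Determinant.det (weyl :: 'f mat) = 1"
    unfolding eq by (simp add: unip_def Determinant.det_mult[OF mult_carrier_mat[OF m2_closed m2_closed] m2_closed]
        Determinant.det_mult[OF m2_closed m2_closed] det_m2_triangular)
  thus "(weyl :: 'f mat) \<in> carrier SL2" by (simp add: SL2_def weyl_def m2_closed)
qed

lemma sl2_relations:
  "unip (x + y) = unip x * unip y" "unip 0 = 1\<^sub>m 2"
  "tor (y * z) = tor y * tor z" "tor 1 = 1\<^sub>m 2"
  "y \<noteq> 0 \<Longrightarrow> tor y * unip x = unip (x / (y * y)) * tor y"
  "weyl * weyl = 1\<^sub>m 2" "weyl * tor y = tor (inverse y) * weyl"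
  "(1::'f) + 1 = 0 \<Longrightarrow> x \<noteq> 0 \<Longrightarrow>
    weyl * unip x * weyl = unip (inverse x) * tor x * weyl * unip (inverse x)"
  for x y z :: "'f::field"
proof -
  assume 2: "(1::'f) + 1 = 0" "x \<noteq> 0"
  have "inverse x + inverse x = (1 + 1) * inverse x" by (simp only: distrib_right mult_1)
  hence "inverse x + inverse x = 0" by (simp only: 2(1) mult_zero_left)
  thus "weyl * unip x * weyl = unip (inverse x) * tor x * weyl * unip (inverse x)"
    using 2(2) by (simp add: sl2_elt_defs m2_mult)
qed (simp_all add: sl2_elt_defs m2_mult m2_one field_simps)

section \<open>The elements named in the character, and sums of its values\<close>

lemma elt_c_eq: "elt_c = unip 1"
  by (rule eq_matI) (auto simp: elt_c_def unip_def m2_def mat_of_rows_list_def less_2_cases_iff)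

lemma elt_a_eq: "elt_a \<nu> = tor \<nu>"
  by (rule eq_matI) (auto simp: elt_a_def tor_def m2_def mat_of_rows_list_def less_2_cases_iff)

lemma tor_pow:
  assumes "group (SL2 :: 'f::field mat monoid)"
  shows "tor \<nu> [^]\<^bsub>SL2\<^esub> l = tor ((\<nu>::'f) ^ l)"
proof -
  interpret group "SL2 :: 'f mat monoid" by fact
  show ?thesis
  proof (induction l)
    case 0
    have "tor (1::'f) = 1\<^sub>m 2" by (rule sl2_relations(4))
    thus ?case by (simp add: SL2_def)
  next
    case (Suc l)
    thus ?case using sl2_relations(3)[of "\<nu> ^ l" \<nu>] by (simp add: SL2_def mult.commute)
  qed
qed

text \<open>The sum of all field elements does not change when each is increased by 1, so the number
  of elements vanishes in the field.\<close>

lemma char_two_of_card: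
  assumes "CARD('f::{field,finite}) = 2 ^ n"
  shows "(1::'f) + 1 = 0"
proof -
  have "(\<Sum>x\<in>(UNIV::'f set). x) = (\<Sum>x\<in>UNIV. x + 1)"
    by (rule sum.reindex_bij_witness[of _ "\<lambda>x. x + 1" "\<lambda>x. x - 1"]) auto
  hence "of_nat CARD('f) = (0::'f)" by (simp add: sum.distrib)
  hence "(2::'f) ^ n = 0" by (simp add: assms)
  thus ?thesis by simp
qed

lemma powers_bij:
  fixes \<nu> :: "'f::{field,finite}"
  assumes "generates_units \<nu>"
  shows "bij_betw (\<lambda>l. \<nu> ^ l) {..<CARD('f) - 1} (UNIV - {0})"
proof -
  let ?q = "CARD('f) - 1"
  have \<nu>: "\<nu> \<noteq> 0" and gen: "\<And>x. x \<noteq> 0 \<Longrightarrow> \<exists>k. x = \<nu> ^ k" using assms by (auto simp: generates_units_def)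
  have cU: "card (UNIV - {0::'f}) = ?q" by simp
  have q0: "?q > 0"
  proof -
    have "(1::'f) \<in> UNIV - {0}" by simp
    hence "card (UNIV - {0::'f}) > 0" by (subst card_gt_0_iff) auto
    thus ?thesis by simp
  qed
  \<comment> \<open>Multiplication by \<open>\<nu>\<close> permutes the units, so comparing the
    products of all units gives \<open>\<nu> ^ ?q = 1\<close>.\<close>
  have "(\<Prod>x\<in>UNIV-{0}. x) = (\<Prod>x\<in>UNIV-{0}. \<nu> * x)"
    by (rule prod.reindex_bij_witness[of _ "\<lambda>x. \<nu> * x" "\<lambda>x. x / \<nu>"]) (use \<nu> in auto)
  also have "\<dots> = \<nu> ^ ?q * (\<Prod>x\<in>UNIV-{0}. x)" by (simp add: prod.distrib)
  finally have per: "\<nu> ^ ?q = 1" by simp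
  have surj: "(\<lambda>l. \<nu> ^ l) ` {..<?q} = UNIV - {0}"
  proof
    show "UNIV - {0} \<subseteq> (\<lambda>l. \<nu> ^ l) ` {..<?q}"
    proof
      fix x :: 'f assume "x \<in> UNIV - {0}"
      then obtain k where k: "x = \<nu> ^ k" using gen by auto
      have "\<nu> ^ k = \<nu> ^ (?q * (k div ?q) + k mod ?q)" by simp
      also have "\<dots> = (\<nu> ^ ?q) ^ (k div ?q) * \<nu> ^ (k mod ?q)" by (simp only: power_add power_mult)
      also have "\<dots> = \<nu> ^ (k mod ?q)" by (simp only: per power_one mult_1)
      finally have "\<nu> ^ k = \<nu> ^ (k mod ?q)" .
      thus "x \<in> (\<lambda>l. \<nu> ^ l) ` {..<?q}" using q0 k by auto
    qed
  qed (use \<nu> in auto)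
  have "inj_on (\<lambda>l. \<nu> ^ l) {..<?q}" by (rule eq_card_imp_inj_on) (use surj cU in auto)
  thus ?thesis using surj by (simp add: bij_betw_def)
qed

text \<open>As \<open>0 < i < m\<close>, the number \<open>zeta m ^ i\<close> differs from 1 while
  its \<open>m\<close>-th power is 1, so the geometric sums of its powers and of their inverses
  vanish.\<close>

lemma sum_root_of_unity:
  assumes "0 < i" "i < m"
  shows "(\<Sum>l<m. zeta m powi int (i * l) + zeta m powi (- int (i * l))) = 0"
proof -
  define \<omega> where "\<omega> = zeta m ^ i"
  have \<omega>: "\<omega> = exp (of_real (2 * pi * (of_nat i / of_nat m)) * \<i>)"
    by (simp add: \<omega>_def zeta_def exp_of_nat_mult[symmetric] field_simps)
  have "\<omega> ^ m = exp (of_nat i * (2 * of_real pi * \<i>))"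
    using assms by (simp add: \<omega> exp_of_nat_mult[symmetric] field_simps)
  also have "\<dots> = 1" unfolding exp_of_nat_mult by (simp add: exp_two_pi_i)
  finally have \<omega>m: "\<omega> ^ m = 1" .
  have "\<omega> \<noteq> 1"
  proof
    assume "\<omega> = 1"
    then obtain k :: int where "2 * pi * (real i / real m) = of_int (2 * k) * pi"
      unfolding \<omega> exp_eq_1 by auto
    hence "real i = of_int k * real m" using assms by (simp add: field_simps)
    hence "int i = k * int m" by (metis of_int_mult of_int_of_nat_eq of_int_eq_iff)
    hence "int m dvd int i" by simp
    thus False using assms by (simp add: nat_dvd_not_less)
  qed
  have z: "z \<noteq> 1 \<Longrightarrow> z ^ m = 1 \<Longrightarrow> (\<Sum>l<m. z ^ l) = 0" for z :: complex
    using geometric_sum[of z m] by simp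
  have "zeta m powi int (i * l) + zeta m powi (- int (i * l)) = \<omega> ^ l + inverse \<omega> ^ l" for l
    by (simp only: power_int_minus power_int_of_nat power_mult \<omega>_def power_inverse)
  hence "(\<Sum>l<m. zeta m powi int (i * l) + zeta m powi (- int (i * l))) = (\<Sum>l<m. \<omega> ^ l) + (\<Sum>l<m. inverse \<omega> ^ l)"
    by (simp add: sum.distrib)
  also have "\<dots> = 0" using z[OF \<open>\<omega> \<noteq> 1\<close> \<omega>m] z[of "inverse \<omega>"] \<open>\<omega> \<noteq> 1\<close> \<omega>m by (simp add: power_inverse)
  finally show ?thesis .
qed

theorem theorem6p4:
  fixes n q i :: nat
    and \<nu> :: "'f::{field,finite}"
    and \<chi> :: "'f mat \<Rightarrow> complex"
    and K :: "complex ring"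
    and W :: "(complex, 'w) module"
    and \<rho> :: "'f mat \<Rightarrow> 'w \<Rightarrow> 'w"
    and F :: "'w \<Rightarrow> 'w \<Rightarrow> complex"
  assumes "n \<ge> 2" and "odd n" and "q = 2 ^ n"
    and "card (UNIV :: 'f set) = q"
    and "generates_units \<nu>"
    and "1 \<le> i" and "i \<le> (q - 2) div 2"
    and "is_chi q \<nu> i \<chi>"
    and "K = character_field SL2 \<chi>"
    and "affords K W SL2 \<rho> \<chi>"
    and "invariant_symmetric_form K W SL2 \<rho> F"
    and "\<exists>v\<in>carrier W. \<exists>w\<in>carrier W. F v w \<noteq> 0"
  shows "brauer_trivial K (even_clifford_algebra K W F)"
proof -
  let ?G = "SL2 :: 'f mat monoid"
  interpret complex_subfield K
    unfolding \<open>K = _\<close> character_field_def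
  proof (rule complex_subfield.intro)
    show "field (class_ring\<lparr>carrier := generate_field class_ring (\<chi> ` carrier ?G)\<rparr>)"
      by (rule field.generate_field_is_field[OF class_field]) simp
  qed simp_all
  have gm: "group_module K W ?G \<rho>" and tr: "\<And>g. g \<in> carrier ?G \<Longrightarrow> has_trace K W (\<rho> g) (\<chi> g)"
    using \<open>affords _ _ _ _ _\<close> by (auto simp: affords_def)
  interpret complex_space K W
    by (rule complex_space.intro[OF complex_subfield_axioms group_module.axioms(1)[OF gm]])
  interpret GM: group_module K W ?G \<rho> by (rule gm)
  have chi: "\<chi> (1\<^sub>m 2) = of_nat (q + 1)" "\<chi> elt_c = 1"
    "\<And>l::nat. elt_a \<nu> [^]\<^bsub>?G\<^esub> l \<noteq> 1\<^sub>m 2 \<Longrightarrow>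
      \<chi> (elt_a \<nu> [^]\<^bsub>?G\<^esub> l) = zeta (q - 1) powi int (i * l) + zeta (q - 1) powi (- int (i * l))"
    using \<open>is_chi _ _ _ _\<close> by (auto simp: is_chi_def SL2_def)
  have one: "\<one>\<^bsub>?G\<^esub> = 1\<^sub>m 2" by (simp add: SL2_def)
  have two: "(1::'f) + 1 = 0" using assms(3,4) by (intro char_two_of_card) simp
  note hom = GM.action_linear
  \<comment> \<open>The trace of the identity element supplies a finite basis of \<open>W\<close>,
    and the degree of the character determines its size.\<close>
  obtain B where B: "finite B" "W.basis B"
    using tr[OF GM.G.one_closed] unfolding has_trace_def by blast
  have "of_nat (q + 1) = (\<Sum>b\<in>B. co B (\<rho> \<one>\<^bsub>?G\<^esub> b) b)"
    using has_trace_eq[OF B hom[OF GM.G.one_closed] tr[OF GM.G.one_closed]] chi(1) by (simp add: one)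
  also have "\<dots> = (\<Sum>b\<in>B. 1)"
  proof (intro sum.cong refl)
    fix b assume b: "b \<in> B"
    hence "\<rho> \<one>\<^bsub>?G\<^esub> b = b" using basis_closed[OF B] by (intro GM.action_one) auto
    thus "co B (\<rho> \<one>\<^bsub>?G\<^esub> b) b = 1" using co_basis[OF B b b] by simp
  qed
  finally have "complex_of_nat (card B) = of_nat (q + 1)" by simp
  hence "card B = q + 1" using of_nat_eq_iff by blast
  \<comment> \<open>The option type over the field has the right size \<open>q + 1\<close> and
    doubles as the index type of the orthogonal basis.\<close>
  moreover have card_opt: "CARD('f option) = q + 1" using assms(4) by (simp add: card_UNIV_option)
  ultimately obtain \<beta> :: "'f option \<Rightarrow> 'w" where \<beta>: "bij_betw \<beta> UNIV B"
    using finite_same_card_bij[of "UNIV :: 'f option set" B] B by auto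
  have form: "v \<in> carrier W \<Longrightarrow> w \<in> carrier W \<Longrightarrow> F v w \<in> carrier K \<and> F v w = F w v"
    "u \<in> carrier W \<Longrightarrow> v \<in> carrier W \<Longrightarrow> w \<in> carrier W \<Longrightarrow> F (u \<oplus>\<^bsub>W\<^esub> v) w = F u w + F v w"
    "a \<in> carrier K \<Longrightarrow> v \<in> carrier W \<Longrightarrow> w \<in> carrier W \<Longrightarrow> F (a \<odot>\<^bsub>W\<^esub> v) w = a * F v w"
    "g \<in> carrier ?G \<Longrightarrow> v \<in> carrier W \<Longrightarrow> w \<in> carrier W \<Longrightarrow> F (\<rho> g v) (\<rho> g w) = F v w" for a g u v w
    using \<open>invariant_symmetric_form _ _ _ _ _\<close> by (auto simp: invariant_symmetric_form_def)
  interpret quad_coord K W F B \<beta>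
    by unfold_locales (use form B \<beta> in auto)
  define R where "R g = mat_of (\<rho> g)" for g
  have R_mult: "R (g * h) = R g ** R h" if "g \<in> carrier ?G" "h \<in> carrier ?G" for g h
    unfolding R_def
    by (rule mat_of_comp[OF hom[OF that(1)] hom[OF that(2)]]) (use GM.action_mult[OF that] in \<open>simp add: SL2_def\<close>)
  have R_one: "R (1\<^sub>m 2) = mat 1"
    unfolding R_def by (rule mat_of_id) (use GM.action_one in \<open>simp add: one\<close>)
  have R_trace: "trace (R g) = \<chi> g" if "g \<in> carrier ?G" for g
    unfolding R_def by (rule trace_mat_of[OF hom[OF that] tr[OF that]])
  have R_FV: "FV (R g *v v) (R g *v w) = FV v w" if "g \<in> carrier ?G" for g v w
    unfolding R_def by (rule FV_invariant[OF hom[OF that] form(4)[OF that]])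
  have R_K: "R g $h j $h k \<in> carrier K" if "g \<in> carrier ?G" for g j k
    unfolding R_def by (rule mat_of_K[OF hom[OF that]])
  have mult_closed': "g * h \<in> carrier ?G" if "g \<in> carrier ?G" "h \<in> carrier ?G" for g h
    using GM.G.m_closed[OF that] by (simp add: SL2_def)
  note elts = sl2_elts(1,2) sl2_elts(3)[OF two]
  \<comment> \<open>Over all exponents below \<open>q - 1\<close> the formula for the torus values
    sums to zero. At exponent 0 it would give 2, so the remaining exponents give -2.\<close>
  have sum_t: "(\<Sum>y\<in>UNIV-{0,1}. trace (R (tor y))) = -2"
  proof -
    define g where "g l = zeta (q - 1) powi int (i * l) + zeta (q - 1) powi (- int (i * l))" for l
    have q: "q - 1 > 0" "i < q - 1" using assms(1,3,6,7) by auto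
    have bij: "bij_betw (\<lambda>l. \<nu> ^ l) {..<q - 1} (UNIV - {0})" using powers_bij[OF assms(5)] assms(4) by simp
    have "bij_betw (\<lambda>l. \<nu> ^ l) ({..<q - 1} - {0}) ((UNIV - {0}) - {\<nu> ^ 0})"
      using bij q by (intro bij_betw_DiffI) auto
    moreover have "(UNIV - {0::'f}) - {\<nu> ^ 0} = UNIV - {0, 1}" by auto
    ultimately have bij': "bij_betw (\<lambda>l. \<nu> ^ l) ({..<q - 1} - {0}) (UNIV - {0, 1})" by simp
    have "trace (R (tor (\<nu> ^ l))) = g l" if l: "l \<in> {..<q - 1} - {0}" for l
    proof -
      have "\<nu> ^ l \<noteq> 0" "\<nu> ^ l \<noteq> 1" using bij' l by (auto simp: bij_betw_def)
      have "tor (\<nu> ^ l) \<noteq> 1\<^sub>m 2"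
      proof
        assume "tor (\<nu> ^ l) = 1\<^sub>m 2"
        from arg_cong[OF this, of "\<lambda>M. M $$ (0, 0)"] show False using \<open>\<nu> ^ l \<noteq> 1\<close> by (simp add: tor_def m2_def)
      qed
      moreover have pow: "elt_a \<nu> [^]\<^bsub>?G\<^esub> l = tor (\<nu> ^ l)" unfolding elt_a_eq by (rule tor_pow[OF GM.G.is_group])
      ultimately show ?thesis using chi(3)[of l] R_trace[OF elts(2)[OF \<open>\<nu> ^ l \<noteq> 0\<close>]] by (simp add: g_def)
    qed
    hence "(\<Sum>y\<in>UNIV-{0,1}. trace (R (tor y))) = (\<Sum>l\<in>{..<q - 1} - {0}. g l)"
      using sum.reindex_bij_betw[OF bij', of "\<lambda>y. trace (R (tor y))"] by simp
    also have "\<dots> = (\<Sum>l<q - 1. g l) - g 0" using q by (subst sum_diff1) auto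
    also have "\<dots> = -2" using sum_root_of_unity[of i "q - 1"] q assms(6) by (simp add: g_def)
    finally show ?thesis .
  qed
  interpret SF: sl2_form "\<lambda>x. R (unip x)" "\<lambda>y. R (tor y)" "R weyl" FV "carrier K" q
  proof unfold_locales
    show "R (unip (x + y)) = R (unip x) ** R (unip y)" for x y
      by (simp add: sl2_relations(1) R_mult elts)
    show "R (tor (y * z)) = R (tor y) ** R (tor z)" if "y \<noteq> 0" "z \<noteq> 0" for y z
      using that by (simp add: sl2_relations(3) R_mult elts)
    show "R (tor y) ** R (unip x) = R (unip (x / (y * y))) ** R (tor y)" if "y \<noteq> 0" for x y
      using that by (simp add: sl2_relations(5) elts flip: R_mult)
    show "R weyl ** R weyl = mat 1" by (simp add: sl2_relations(6) R_one elts flip: R_mult)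
    show "R weyl ** R (tor y) = R (tor (inverse y)) ** R weyl" if "y \<noteq> 0" for y
      using that by (simp add: sl2_relations(7) elts flip: R_mult)
    show "R weyl ** R (unip x) ** R weyl = R (unip (inverse x)) ** R (tor x) ** R weyl ** R (unip (inverse x))"
      if "x \<noteq> 0" for x
      using that by (simp add: sl2_relations(8)[OF two] elts mult_closed' flip: R_mult)
    show "trace (R (unip 1)) = 1" using R_trace[OF elts(1)[of 1]] chi(2) by (simp add: elt_c_eq)
    show "\<exists>v w. FV v w \<noteq> 0" using assms(12) F_kap by metis
  qed (use two card_opt assms(4) sum_t R_one in
      \<open>auto simp: sl2_relations(2,4) FV_add FV_scale R_FV R_K elts intro: FV_sym FV_K\<close>)
  \<comment> \<open>Here \<open>n\<close> odd enters: \<open>2 ^ n\<close> is twice the square of an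
    integer, so \<open>r\<close> is rational and lies in \<open>K\<close>.\<close>
  define r :: complex where "r = 2 ^ ((n - 1) div 2)"
  have "(2::nat) ^ n = 2 * (2 ^ ((n - 1) div 2) * 2 ^ ((n - 1) div 2))"
  proof -
    have "n = Suc ((n - 1) div 2 + (n - 1) div 2)" using \<open>odd n\<close> by presburger
    hence "(2::nat) ^ n = 2 ^ Suc ((n - 1) div 2 + (n - 1) div 2)" by simp
    thus ?thesis by (simp only: power_Suc power_add)
  qed
  hence rq: "of_nat q = 2 * (r * r)" using assms(3) by (simp add: r_def)
  have rK: "r \<in> carrier K" unfolding r_def by (intro power_closed numeral_closed)
  obtain e :: "'f option \<Rightarrow> complex^'f option" and c c0 where e: "c \<noteq> 0" "c0 \<noteq> 0" "\<And>y j. e y $h j \<in> carrier K"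
    "\<And>y z. FV (e y) (e z) = (if y = z then (if y = None then c0 else c) else 0)"
    by (rule SF.exists_orthogonal_basis[OF rK rq]) (rule that)
  \<comment> \<open>An odd \<open>n \<ge> 2\<close> is at least 3, so \<open>q\<close> is a multiple
    of 8 and splits into blocks of octonion size.\<close>
  have "n \<ge> 3" using assms(1,2) by (cases "n = 2") auto
  hence "q = 8 * 2 ^ (n - 3)" using assms(3) power_add[of "2::nat" 3 "n - 3"] by simp
  thus ?thesis using brauer_trivial_of_orthogonal_basis[OF e(3,1,2,4)] card_opt by simp
qed

end
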